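(* Consider the control system $\dot x=f(x)+\sum_{i=1}^m g_i(x)u_i$, $y=h(x)$, on the state space $\mathcal{X}\subset\mathbb{R}^n$, assumed passive with nonnegative storage function $V:\mathcal{X}\to\mathbb{R}$. Let $\Gamma\subset V^{-1}(0)=\{x\in\mathcal{X}:V(x)=0\}$ be a closed set which is positively invariant for the open-loop system $\dot x=f(x)$. Let $u=-\varphi(x)$ be a passivity-based feedback, i.e., $\varphi:\mathcal{X}\to\mathcal{U}$ is a smooth function such that $\varphi(x)=0$ whenever $h(x)=0$ and $h(x)^\top\varphi(x)>0$ whenever $h(x)\neq0$; the closed-loop system is $\dot x=f(x)-\sum_{i=1}^m g_i(x)\varphi_i(x)$. If $\Gamma$ is compact, then: - $\Gamma$ is asymptotically stable for the closed-loop system if, and only if, the control system is locally $\Gamma$-detectable; - if all trajectories of the closed-loop system are bounded, then $\Gamma$ is globally asymptotically stable for the closed-loop system if, and only if, the control system is $\Gamma$-detectable. If $\Gamma$ is unbounded and the closed-loop system is locally uniformly bounded near $\Gamma$, then: - $\Gamma$ is asymptotically stable for the closed-loop system if, and only if, the control system is locally $\Gamma$-detectable; - if all trajectories of the closed-loop system are bounded, then $\Gamma$ is globally asymptotically stable for the closed-loop system if, and only if, the control system is $\Gamma$-detectable.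
   Context: Setting: $\mathcal{X}$ is either an open subset or a smooth submanifold of $\mathbb{R}^n$; $\mathcal{U}\subset\mathbb{R}^m$ and $\mathcal{Y}\subset\mathbb{R}^m$ are the sets of input and output values; $f,g_1,\dots,g_m$ are smooth vector fields on $\mathcal{X}$ and $h:\mathcal{X}\to\mathcal{Y}$ is smooth. The system is passive with storage function $V$, a $C^r$ ($r\ge1$) nonnegative function on $\mathcal{X}$: for every piecewise-continuous $u:[0,\infty)\to\mathcal{U}$, every $x_0\in\mathcal{X}$ and every $t$ in the maximal interval of existence of the solution $\phi_u(\cdot,x_0)$, $V(\phi_u(t,x_0))-V(x_0)\le\int_0^t u(\tau)^\top y(\tau)\,d\tau$ with $y(t)=h(\phi_u(t,x_0))$. This is equivalently expressed by the conditions $L_fV(x)\le0$ and $L_gV(x)=h(x)^\top$ for all $x\in\mathcal{X}$, where $L_gV=[L_{g_1}V\ \cdots\ L_{g_m}V]$ and $L$ denotes Lie derivative. Set $\mathcal{O}$: the maximal set contained in $h^{-1}(0)$ which is invariant for the open-loop system $\dot x=f(x)$. A set $S$ is invariant if solutions starting in $S$ remain in $S$ for all (positive and negative) times in their interval of existence, and positively invariant if they remain in $S$ for all $t\ge0$. $\Gamma$-detectability: the control system is locally $\Gamma$-detectable if $\Gamma$ is asymptotically stable relative to $\mathcal{O}$ for the open-loop system $\dot x=f(x)$, and $\Gamma$-detectable if $\Gamma$ is globally asymptotically stable relative to $\mathcal{O}$ for the open-loop system. Stability notions, for a dynamical system with solutions $\phi(t,x_0)$ on $\mathcal{X}$ and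 a closed positively invariant set $\Gamma$: write $\mathbb{R}^+=[0,\infty)$, $\|x\|_\Gamma=\inf_{y\in\Gamma}\|x-y\|$, $B_\alpha(x)=\{y\in\mathcal{X}:\|y-x\|<\alpha\}$, $B_\alpha(\Gamma)=\{y\in\mathcal{X}:\|y\|_\Gamma<\alpha\}$, $\phi(I,S)=\{\phi(t,x_0):t\in I,x_0\in S\}$, and let $\mathcal{N}(\Gamma)$ denote an open subset of $\mathcal{X}$ containing $\Gamma$. - $\Gamma$ is stable if for all $\varepsilon>0$ there is $\mathcal{N}(\Gamma)$ with $\phi(\mathbb{R}^+,\mathcal{N}(\Gamma))\subset B_\varepsilon(\Gamma)$. - $\Gamma$ is attractive if there is $\mathcal{N}(\Gamma)$ such that $\lim_{t\to\infty}\|\phi(t,x_0)\|_\Gamma=0$ for all $x_0\in\mathcal{N}(\Gamma)$; globally attractive if this holds with $\mathcal{N}(\Gamma)=\mathcal{X}$. - $\Gamma$ is [globally] asymptotically stable if it is stable and [globally] attractive. - Relative to a set $\mathcal{O}$ (with $\mathcal{O}\cap\Gamma\neq\emptyset$): the same notions with initial conditions restricted to $\mathcal{O}$, i.e., $\mathcal{N}(\Gamma)$ replaced by $\mathcal{N}(\Gamma)\cap\mathcal{O}$ (and $\mathcal{X}$ by $\mathcal{O}$ in the global case). - The system is locally uniformly bounded near $\Gamma$ if for each $x\in\Gamma$ there exist $\lambda,m>0$ with $\phi(\mathbb{R}^+,B_\lambda(x))\subset B_m(x)$. "Bounded" for trajectories refers to $t\ge0$. Statements involving $t\to\infty$ or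 $\phi(\mathbb{R}^+,\cdot)$ presuppose that the solutions concerned are defined for all $t\ge0$.
   Formalization: "Bounded" (trajectories, local uniform boundedness) also requires the closure to lie in X (void for X closed in R^n), and −φ(x) must lie in U as well as φ(x) (void for symmetric U); without these the claim fails. Γ is assumed nonempty and closed in X. *)

theory Defs
  imports "HOL-Analysis.Analysis"
begin

section \<open>Differentiability classes, submanifolds, vector fields\<close>

text \<open>On an open set \<open>S\<close> of a finite-dimensional space, a map is of class \<open>C\<^sup>k\<^sup>+\<^sup>1\<close> iff it is
  differentiable and all its directional derivatives are of class \<open>C\<^sup>k\<close>.\<close>

primrec Ck_on_open :: "nat \<Rightarrow> 'a::euclidean_space set \<Rightarrow> ('a \<Rightarrow> 'b::real_normed_vector) \<Rightarrow> bool" where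
  "Ck_on_open 0 S f \<longleftrightarrow> continuous_on S f"
| "Ck_on_open (Suc k) S f \<longleftrightarrow>
     (\<forall>x\<in>S. f differentiable (at x)) \<and>
     (\<forall>v. Ck_on_open k S (\<lambda>x. frechet_derivative f (at x) v))"

text \<open>A map on a set \<open>X\<close> that need not be open is of class \<open>C\<^sup>r\<close> if near each point of \<open>X\<close> it is the
  restriction of a \<open>C\<^sup>r\<close> map on an open set of the ambient space.  For open \<open>X\<close> this is the
  ordinary notion, for submanifolds it agrees with the one given by charts.\<close>

definition Cr_on :: "enat \<Rightarrow> 'a::euclidean_space set \<Rightarrow> ('a \<Rightarrow> 'b::real_normed_vector) \<Rightarrow> bool" where
  "Cr_on r X f \<longleftrightarrow>
     (\<forall>p\<in>X. \<exists>W F. open W \<and> p \<in> W \<and> (\<forall>k. enat k \<le> r \<longrightarrow> Ck_on_open k W F) \<and>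
        (\<forall>x\<in>W \<inter> X. F x = f x))"

abbreviation smooth_on :: "'a::euclidean_space set \<Rightarrow> ('a \<Rightarrow> 'b::real_normed_vector) \<Rightarrow> bool" where
  "smooth_on \<equiv> Cr_on \<infinity>"

definition smooth_submanifold :: "'a::euclidean_space set \<Rightarrow> bool" where
  "smooth_submanifold X \<longleftrightarrow>
     (\<exists>d. \<forall>p\<in>X. \<exists>W W' \<psi> \<eta> E. open W \<and> p \<in> W \<and> open W' \<and>
        homeomorphism W W' \<psi> \<eta> \<and> smooth_on W \<psi> \<and> smooth_on W' \<eta> \<and>
        subspace E \<and> dim E = d \<and> \<psi> ` (W \<inter> X) = W' \<inter> (E :: 'a set))"

definition tangent_space :: "'a::euclidean_space set \<Rightarrow> 'a \<Rightarrow> 'a set" where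
  "tangent_space X p =
     {v. \<exists>\<gamma> e. e > 0 \<and> smooth_on {-e<..<e::real} \<gamma> \<and> \<gamma> ` {-e<..<e} \<subseteq> X \<and>
           \<gamma> 0 = p \<and> (\<gamma> has_vector_derivative v) (at 0)}"

definition smooth_vector_field :: "'a::euclidean_space set \<Rightarrow> ('a \<Rightarrow> 'a) \<Rightarrow> bool" where
  "smooth_vector_field X F \<longleftrightarrow> smooth_on X F \<and> (\<forall>x\<in>X. F x \<in> tangent_space X x)"


section \<open>Solutions of autonomous systems on a state space\<close>

definition solution_on :: "'a::euclidean_space set \<Rightarrow> ('a \<Rightarrow> 'a) \<Rightarrow> real set \<Rightarrow> (real \<Rightarrow> 'a) \<Rightarrow> bool" where
  "solution_on X F J x \<longleftrightarrow>
     is_interval J \<and> 0 \<in> J \<and> x ` J \<subseteq> X \<and>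
     (\<forall>t\<in>J. (x has_vector_derivative F (x t)) (at t within J))"

text \<open>\<open>reach X F I S\<close> is \<open>\<phi>(I, S)\<close> for the flow \<open>\<phi>\<close> of \<open>F\<close> on \<open>X\<close>, with times outside the maximal
  interval of existence ignored: a time belongs to that interval iff it belongs to the domain of
  some solution.  That solutions exist for all \<open>t \<ge> 0\<close> is expressed separately.\<close>

definition reach :: "'a::euclidean_space set \<Rightarrow> ('a \<Rightarrow> 'a) \<Rightarrow> real set \<Rightarrow> 'a set \<Rightarrow> 'a set" where
  "reach X F I S = {y. \<exists>J x t. solution_on X F J x \<and> x 0 \<in> S \<and> t \<in> I \<inter> J \<and> y = x t}"

definition forward_complete :: "'a::euclidean_space set \<Rightarrow> ('a \<Rightarrow> 'a) \<Rightarrow> 'a set \<Rightarrow> bool" where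
  "forward_complete X F S \<longleftrightarrow> (\<forall>x0\<in>S. \<exists>x. solution_on X F {0..} x \<and> x 0 = x0)"

definition invariant :: "'a::euclidean_space set \<Rightarrow> ('a \<Rightarrow> 'a) \<Rightarrow> 'a set \<Rightarrow> bool" where
  "invariant X F S \<longleftrightarrow> reach X F UNIV S \<subseteq> S"

definition positively_invariant :: "'a::euclidean_space set \<Rightarrow> ('a \<Rightarrow> 'a) \<Rightarrow> 'a set \<Rightarrow> bool" where
  "positively_invariant X F S \<longleftrightarrow> forward_complete X F S \<and> reach X F {0..} S \<subseteq> S"


section \<open>Stability notions\<close>

definition ball_in :: "'a::euclidean_space set \<Rightarrow> 'a \<Rightarrow> real \<Rightarrow> 'a set" where
  "ball_in X x \<alpha> = {y\<in>X. norm (y - x) < \<alpha>}"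

definition set_ball :: "'a::euclidean_space set \<Rightarrow> 'a set \<Rightarrow> real \<Rightarrow> 'a set" where
  "set_ball X \<Gamma> \<alpha> = {y\<in>X. infdist y \<Gamma> < \<alpha>}"

definition open_nbhd :: "'a::euclidean_space set \<Rightarrow> 'a set \<Rightarrow> 'a set \<Rightarrow> bool" where
  "open_nbhd X \<Gamma> N \<longleftrightarrow> openin (top_of_set X) N \<and> \<Gamma> \<subseteq> N"

definition stable_rel :: "'a::euclidean_space set \<Rightarrow> ('a \<Rightarrow> 'a) \<Rightarrow> 'a set \<Rightarrow> 'a set \<Rightarrow> bool" where
  "stable_rel X F A \<Gamma> \<longleftrightarrow>
     (\<forall>\<epsilon>>0. \<exists>N. open_nbhd X \<Gamma> N \<and> forward_complete X F (N \<inter> A) \<and>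
        reach X F {0..} (N \<inter> A) \<subseteq> set_ball X \<Gamma> \<epsilon>)"

definition attracted :: "'a::euclidean_space set \<Rightarrow> ('a \<Rightarrow> 'a) \<Rightarrow> 'a set \<Rightarrow> 'a set \<Rightarrow> bool" where
  "attracted X F S \<Gamma> \<longleftrightarrow>
     forward_complete X F S \<and>
     (\<forall>x. solution_on X F {0..} x \<and> x 0 \<in> S \<longrightarrow> ((\<lambda>t. infdist (x t) \<Gamma>) \<longlongrightarrow> 0) at_top)"

definition attractive_rel :: "'a::euclidean_space set \<Rightarrow> ('a \<Rightarrow> 'a) \<Rightarrow> 'a set \<Rightarrow> 'a set \<Rightarrow> bool" where
  "attractive_rel X F A \<Gamma> \<longleftrightarrow> (\<exists>N. open_nbhd X \<Gamma> N \<and> attracted X F (N \<inter> A) \<Gamma>)"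

definition globally_attractive_rel :: "'a::euclidean_space set \<Rightarrow> ('a \<Rightarrow> 'a) \<Rightarrow> 'a set \<Rightarrow> 'a set \<Rightarrow> bool" where
  "globally_attractive_rel X F A \<Gamma> \<longleftrightarrow> attracted X F A \<Gamma>"

text \<open>Stability relative to \<open>A\<close> is only considered when \<open>A\<close> meets \<open>\<Gamma>\<close>; this is part of the definitions.\<close>

definition asymptotically_stable_rel :: "'a::euclidean_space set \<Rightarrow> ('a \<Rightarrow> 'a) \<Rightarrow> 'a set \<Rightarrow> 'a set \<Rightarrow> bool" where
  "asymptotically_stable_rel X F A \<Gamma> \<longleftrightarrow>
     A \<inter> \<Gamma> \<noteq> {} \<and> stable_rel X F A \<Gamma> \<and> attractive_rel X F A \<Gamma>"

definition globally_asymptotically_stable_rel :: "'a::euclidean_space set \<Rightarrow> ('a \<Rightarrow> 'a) \<Rightarrow> 'a set \<Rightarrow> 'a set \<Rightarrow> bool" where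
  "globally_asymptotically_stable_rel X F A \<Gamma> \<longleftrightarrow>
     A \<inter> \<Gamma> \<noteq> {} \<and> stable_rel X F A \<Gamma> \<and> globally_attractive_rel X F A \<Gamma>"

text \<open>The absolute notions are those relative to the whole state space, since open neighbourhoods
  of \<open>\<Gamma>\<close> are subsets of \<open>X\<close>.\<close>

definition asymptotically_stable :: "'a::euclidean_space set \<Rightarrow> ('a \<Rightarrow> 'a) \<Rightarrow> 'a set \<Rightarrow> bool" where
  "asymptotically_stable X F \<Gamma> \<longleftrightarrow> asymptotically_stable_rel X F X \<Gamma>"

definition globally_asymptotically_stable :: "'a::euclidean_space set \<Rightarrow> ('a \<Rightarrow> 'a) \<Rightarrow> 'a set \<Rightarrow> bool" where
  "globally_asymptotically_stable X F \<Gamma> \<longleftrightarrow> globally_asymptotically_stable_rel X F X \<Gamma>"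


section \<open>Boundedness\<close>

text \<open>If \<open>X\<close> is not closed in the ambient space, a motion may be bounded in norm and still run into
  the missing boundary of \<open>X\<close>, and its limit set in \<open>X\<close> may be empty.  Boundedness within the state
  space is therefore understood as boundedness in norm together with the closure being contained
  in \<open>X\<close>, that is, relative compactness in \<open>X\<close>.  If \<open>X\<close> is closed, the second condition is void.

  Some such condition is necessary.  On the half plane of the points \<open>(x, y)\<close> with \<open>x > 0\<close> take
  \<open>f = (-x, 0)\<close>, \<open>g = (0, x)\<close>, \<open>V = y\<^sup>2\<close>, \<open>h = \<phi> = 2xy\<close>, and let \<open>\<Gamma>\<close> be the set where \<open>y = 0\<close>.  Then the
  maximal invariant subset of the zero set of \<open>h\<close> is \<open>\<Gamma>\<close> and all closed-loop motions are bounded in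
  norm, but \<open>y\<close> does not tend to \<open>0\<close> unless it is \<open>0\<close> initially.\<close>

definition bounded_in :: "'a::euclidean_space set \<Rightarrow> 'a set \<Rightarrow> bool" where
  "bounded_in X S \<longleftrightarrow> bounded S \<and> closure S \<subseteq> X"

lemma bounded_in_closed: "closed X \<Longrightarrow> S \<subseteq> X \<Longrightarrow> bounded_in X S \<longleftrightarrow> bounded S"
  by (simp add: bounded_in_def closure_minimal)

definition trajectories_bounded :: "'a::euclidean_space set \<Rightarrow> ('a \<Rightarrow> 'a) \<Rightarrow> bool" where
  "trajectories_bounded X F \<longleftrightarrow>
     forward_complete X F X \<and> (\<forall>x0\<in>X. bounded_in X (reach X F {0..} {x0}))"

definition locally_uniformly_bounded_near :: "'a::euclidean_space set \<Rightarrow> ('a \<Rightarrow> 'a) \<Rightarrow> 'a set \<Rightarrow> bool" where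
  "locally_uniformly_bounded_near X F \<Gamma> \<longleftrightarrow>
     (\<forall>x\<in>\<Gamma>. \<exists>l>0. \<exists>m>0. forward_complete X F (ball_in X x l) \<and>
        reach X F {0..} (ball_in X x l) \<subseteq> ball_in X x m \<and>
        bounded_in X (reach X F {0..} (ball_in X x l)))"


section \<open>Control systems\<close>

definition control_field :: "('a \<Rightarrow> 'a) \<Rightarrow> ('m::finite \<Rightarrow> 'a \<Rightarrow> 'a::euclidean_space) \<Rightarrow> real^'m \<Rightarrow> 'a \<Rightarrow> 'a" where
  "control_field f g u x = f x + (\<Sum>i\<in>UNIV. (u $ i) *\<^sub>R g i x)"

definition closed_loop :: "('a \<Rightarrow> 'a) \<Rightarrow> ('m::finite \<Rightarrow> 'a \<Rightarrow> 'a::euclidean_space) \<Rightarrow> ('a \<Rightarrow> real^'m) \<Rightarrow> 'a \<Rightarrow> 'a" where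
  "closed_loop f g \<phi> x = f x - (\<Sum>i\<in>UNIV. (\<phi> x $ i) *\<^sub>R g i x)"

definition piecewise_continuous :: "(real \<Rightarrow> 'b::real_normed_vector) \<Rightarrow> bool" where
  "piecewise_continuous u \<longleftrightarrow>
     (\<forall>T. finite {t\<in>{0..T}. \<not> continuous (at t within {0..}) u}) \<and>
     (\<forall>t\<ge>0. \<exists>l. (u \<longlongrightarrow> l) (at_right t)) \<and> (\<forall>t>0. \<exists>l. (u \<longlongrightarrow> l) (at_left t))"

text \<open>For a piecewise continuous input the differential equation cannot be required at the jumps
  of the input, hence the integral form.\<close>

definition control_solution_on ::
    "'a::euclidean_space set \<Rightarrow> ('a \<Rightarrow> 'a) \<Rightarrow> ('m::finite \<Rightarrow> 'a \<Rightarrow> 'a) \<Rightarrow> (real \<Rightarrow> real^'m) \<Rightarrow>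
     real set \<Rightarrow> (real \<Rightarrow> 'a) \<Rightarrow> bool" where
  "control_solution_on X f g u J x \<longleftrightarrow>
     is_interval J \<and> 0 \<in> J \<and> J \<subseteq> {0..} \<and> x ` J \<subseteq> X \<and> continuous_on J x \<and>
     (\<forall>t\<in>J. ((\<lambda>s. control_field f g (u s) (x s)) has_integral (x t - x 0)) {0..t})"

definition passive_system ::
    "'a::euclidean_space set \<Rightarrow> (real^'m) set \<Rightarrow> ('a \<Rightarrow> 'a) \<Rightarrow> ('m::finite \<Rightarrow> 'a \<Rightarrow> 'a) \<Rightarrow>
     ('a \<Rightarrow> real^'m) \<Rightarrow> ('a \<Rightarrow> real) \<Rightarrow> bool" where
  "passive_system X U f g h V \<longleftrightarrow>
     (\<forall>u J x t. piecewise_continuous u \<and> u ` {0..} \<subseteq> U \<and> control_solution_on X f g u J x \<and> t \<in> J \<longrightarrow>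
        V (x t) - V (x 0) \<le> integral {0..t} (\<lambda>\<tau>. u \<tau> \<bullet> h (x \<tau>)))"

text \<open>Besides \<open>\<phi>\<close> taking values in \<open>U\<close>, the inputs \<open>-\<phi>(x)\<close> that are actually applied must be
  admissible; otherwise passivity, which only concerns inputs with values in \<open>U\<close>, says nothing
  about the closed loop.  The condition is void if \<open>U\<close> is symmetric, e.g. the whole space.\<close>

definition passivity_based_feedback ::
    "'a::euclidean_space set \<Rightarrow> (real^'m::finite) set \<Rightarrow> ('a \<Rightarrow> real^'m) \<Rightarrow> ('a \<Rightarrow> real^'m) \<Rightarrow> bool" where
  "passivity_based_feedback X U h \<phi> \<longleftrightarrow>
     smooth_on X \<phi> \<and> (\<forall>x\<in>X. \<phi> x \<in> U \<and> - \<phi> x \<in> U) \<and>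
     (\<forall>x\<in>X. (h x = 0 \<longrightarrow> \<phi> x = 0) \<and> (h x \<noteq> 0 \<longrightarrow> h x \<bullet> \<phi> x > 0))"

text \<open>Unions of invariant sets are invariant, so the union below is the maximal invariant subset
  of \<open>h\<inverse>(0)\<close>.\<close>

definition zero_output_set :: "'a::euclidean_space set \<Rightarrow> ('a \<Rightarrow> 'a) \<Rightarrow> ('a \<Rightarrow> 'b::zero) \<Rightarrow> 'a set" where
  "zero_output_set X f h = \<Union>{S. S \<subseteq> {x\<in>X. h x = 0} \<and> invariant X f S}"

definition locally_detectable :: "'a::euclidean_space set \<Rightarrow> ('a \<Rightarrow> 'a) \<Rightarrow> ('a \<Rightarrow> 'b::zero) \<Rightarrow> 'a set \<Rightarrow> bool" where
  "locally_detectable X f h \<Gamma> \<longleftrightarrow> asymptotically_stable_rel X f (zero_output_set X f h) \<Gamma>"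

definition detectable :: "'a::euclidean_space set \<Rightarrow> ('a \<Rightarrow> 'a) \<Rightarrow> ('a \<Rightarrow> 'b::zero) \<Rightarrow> 'a set \<Rightarrow> bool" where
  "detectable X f h \<Gamma> \<longleftrightarrow> globally_asymptotically_stable_rel X f (zero_output_set X f h) \<Gamma>"

end

theory Submission
  imports Defs
begin

text \<open>All arguments concern the closed-loop field \<open>F\<close>.  Since \<open>F = f\<close> where \<open>h = 0\<close>, the two fields
  have the same invariant subsets of \<open>h\<inverse>(0)\<close>, so \<open>\<O>\<close> and both detectability notions can be expressed
  through \<open>F\<close>; passivity is used only for \<open>u = -\<phi>(x)\<close>, where it makes \<open>V\<close> nonincreasing.

  Suppose \<open>\<Gamma>\<close> is asymptotically stable relative to \<open>\<O>\<close> but not stable.  Then there are solutions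
  \<open>z\<^sub>i\<close> starting near a point of \<open>\<Gamma>\<close> which reach distance \<open>e\<close> from \<open>\<Gamma>\<close>; let \<open>s\<^sub>i\<close> be the last time
  before that at which the distance is a much smaller \<open>\<rho>\<close>.  As \<open>\<Gamma>\<close> is positively invariant,
  \<open>s\<^sub>i \<rightarrow> \<infinity>\<close>, so \<open>V = 0\<close> on the whole orbit of a limit point \<open>q\<close> of \<open>z\<^sub>i(s\<^sub>i)\<close>, whence \<open>q \<in> \<O>\<close>.  The
  solution from \<open>q\<close> tends to \<open>\<Gamma>\<close> without leaving the \<open>e/2\<close>-ball, while the nearby \<open>z\<^sub>i\<close> stay
  at distance at least \<open>\<rho>\<close> until they reach distance \<open>e\<close>, a contradiction.  Attractivity follows by
  applying attractivity relative to \<open>\<O>\<close> to a limit point of a solution that is trapped in a compact set.\<close>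

section \<open>Ordinary differential equations with Lipschitz right-hand sides\<close>

text \<open>\<open>X\<close> may have empty interior, so solutions are first produced in the ambient
  space, for a Lipschitz extension of the field, and then shown to remain in \<open>X\<close>. Both
  time directions are needed: \<open>\<O>\<close> is invariant for negative times too, so a limit
  point of \<open>z\<^sub>i(s\<^sub>i)\<close> is in \<open>\<O>\<close> only if its backward orbit
  is controlled as well. This is why \<open>s\<^sub>i \<rightarrow> \<infinity>\<close> matters: it
  makes the points \<open>z\<^sub>i(s\<^sub>i - \<tau>)\<close> available for every
  \<open>\<tau>\<close>. If \<open>\<Gamma>\<close> is unbounded, closeness to
  \<open>\<Gamma>\<close> gives no compactness and a neighbourhood of \<open>\<Gamma>\<close> may
  become arbitrarily thin. Hence the sequences in the stability argument start near one fixed point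
  of \<open>\<Gamma>\<close>, and \<open>confining_near\<close> supplies a compact set for each such
  point. It holds for compact \<open>\<Gamma>\<close> and under local uniform boundedness, so one
  argument serves both cases. That \<open>\<Gamma>\<close> is positively invariant for
  \<open>F\<close> as well as for \<open>f\<close> is derived: \<open>V\<close> is minimal on
  \<open>\<Gamma>\<close>, hence constant along closed-loop solutions from \<open>\<Gamma>\<close>,
  so nothing is dissipated there, \<open>h\<close> vanishes on \<open>\<Gamma>\<close> and the
  fields agree on it.\<close>

lemma picard_lipschitz:
  fixes H :: "'a::euclidean_space \<Rightarrow> 'a"
  assumes lip: "L-lipschitz_on UNIV H" and d: "0 \<le> d" "L * d \<le> 1/2"
  shows "\<exists>x. x 0 = x0 \<and> (\<forall>t\<in>{0..d}. (x has_vector_derivative H (x t)) (at t within {0..d}))"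
proof -
  have contH: "continuous_on UNIV H"
    using lip by (rule lipschitz_on_continuous_on)
  have L: "0 \<le> L"
    using lip by (rule lipschitz_on_nonneg)
  \<comment> \<open>Clamping time makes the Picard operator a self-map of the bounded continuous
    functions on the whole line, a complete space given as a type, as \<open>banach_fix_type\<close>
    requires.\<close>
  define c where "c t = max 0 (min t d)" for t :: real
  have c: "c t \<in> {0..d}" for t
    using d by (auto simp: c_def)
  have contc: "continuous_on UNIV c"
    unfolding c_def by (intro continuous_intros)
  have contHu: "continuous_on S (\<lambda>s. H (apply_bcontfun u s))" for u :: "real \<Rightarrow>\<^sub>C 'a" and S
    by (rule continuous_on_compose2[OF contH]) auto
  define P where "P u t = x0 + integral {0..c t} (\<lambda>s. H (apply_bcontfun u s))" for u t
  have PB: "P u \<in> bcontfun" for u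
  proof -
    let ?I = "\<lambda>t. x0 + integral {0..t} (\<lambda>s. H (apply_bcontfun u s))"
    have ci: "continuous_on {0..d} ?I"
      by (intro continuous_intros indefinite_integral_continuous_1 integrable_continuous_real contHu)
    then have "bounded (?I ` {0..d})"
      by (simp add: compact_continuous_image compact_imp_bounded)
    then obtain b where b: "\<And>t. t \<in> {0..d} \<Longrightarrow> norm (?I t) \<le> b"
      unfolding bounded_iff by blast
    have "continuous_on UNIV (\<lambda>t. ?I (c t))"
      by (rule continuous_on_compose2[OF ci contc]) (use c in auto)
    moreover have "norm (?I (c t)) \<le> b" for t
      using b c by blast
    ultimately show ?thesis
      unfolding P_def by (rule bcontfun_normI)
  qed
  define T where "T u = Bcontfun (P u)" for u
  have T: "apply_bcontfun (T u) = P u" for u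
    using PB by (simp add: T_def Bcontfun_inverse)
  have contr: "dist (T u) (T v) \<le> 1/2 * dist u v" for u v
  proof (rule dist_bound)
    fix t
    have "P u t - P v t = integral {0..c t} (\<lambda>s. H (apply_bcontfun u s) - H (apply_bcontfun v s))"
      unfolding P_def
      by (subst integral_diff) (auto intro!: integrable_continuous_real contHu)
    also have "norm \<dots> \<le> (L * dist u v) * (c t - 0)"
    proof (rule integral_bound)
      show "0 \<le> c t" using c by auto
      show "continuous_on {0..c t} (\<lambda>s. H (apply_bcontfun u s) - H (apply_bcontfun v s))"
        by (intro continuous_intros contHu)
      fix s
      have "norm (H (apply_bcontfun u s) - H (apply_bcontfun v s)) \<le> L * norm (apply_bcontfun u s - apply_bcontfun v s)"
        using lip by (rule lipschitz_on_normD) auto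
      also have "\<dots> \<le> L * dist u v"
        using dist_bounded[of u s v] L by (intro mult_left_mono) (auto simp: dist_norm)
      finally show "norm (H (apply_bcontfun u s) - H (apply_bcontfun v s)) \<le> L * dist u v" .
    qed
    also have "\<dots> \<le> (L * d) * dist u v"
      using c[of t] L by (simp add: mult_left_mono mult_right_mono mult.assoc mult.commute[of "dist u v"])
    also have "\<dots> \<le> 1/2 * dist u v"
      using d by (intro mult_right_mono) auto
    finally show "dist (apply_bcontfun (T u) t) (apply_bcontfun (T v) t) \<le> 1/2 * dist u v"
      by (simp add: T dist_norm)
  qed
  obtain u where u: "T u = u"
    using banach_fix_type[of "1/2" T] contr by auto
  have ut: "apply_bcontfun u t = x0 + integral {0..c t} (\<lambda>s. H (apply_bcontfun u s))" for t
    using fun_cong[OF T[of u, unfolded u], of t] unfolding P_def .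
  have "apply_bcontfun u 0 = x0"
    using ut[of 0] d by (simp add: c_def)
  moreover have "(apply_bcontfun u has_vector_derivative H (apply_bcontfun u t)) (at t within {0..d})"
    if t: "t \<in> {0..d}" for t
  proof (rule has_vector_derivative_transform[OF t])
    show "apply_bcontfun u s = x0 + integral {0..s} (\<lambda>s. H (apply_bcontfun u s))" if "s \<in> {0..d}" for s
      using ut[of s] that by (simp add: c_def)
    show "((\<lambda>t. x0 + integral {0..t} (\<lambda>s. H (apply_bcontfun u s))) has_vector_derivative
        H (apply_bcontfun u t)) (at t within {0..d})"
      using has_vector_derivative_add[OF has_vector_derivative_const
          integral_has_vector_derivative[OF contHu t], of x0] by simp
  qed
  ultimately show ?thesis by blast
qed

text \<open>A Gronwall comparison for an upper right Dini derivative, since a distance to a set need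
  not be differentiable. Each line \<open>c * t\<close> with \<open>c > 0\<close> is a barrier: at
  the infimum \<open>\<tau>\<close> of the times at which \<open>D\<close> lies above it,
  \<open>L * T \<le> 1/2\<close> gives \<open>L * D \<tau> \<le> c / 2\<close>, and
  \<open>\<eta> = c / 2\<close> leaves a growth rate of at most \<open>c\<close>.\<close>

lemma dini_nonpos:
  fixes D :: "real \<Rightarrow> real"
  assumes cont: "continuous_on {0..T} D" and D0: "D 0 \<le> 0" and L: "0 \<le> L" "L * T \<le> 1/2"
    and step: "\<And>t \<eta>. \<lbrakk>0 \<le> t; t < T; 0 < \<eta>\<rbrakk> \<Longrightarrow>
      \<exists>s0>0. \<forall>s. 0 < s \<and> s < s0 \<and> t + s \<le> T \<longrightarrow> D (t + s) \<le> D t + s * (L * D t + \<eta>)"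
    and t: "t \<in> {0..T}"
  shows "D t \<le> 0"
proof -
  have main: "D t \<le> c * t" if "0 < c" "t \<in> {0..T}" for c t
  proof (rule ccontr)
    assume neg: "\<not> D t \<le> c * t"
    define A where "A = {t\<in>{0..T}. c * t < D t}"
    have A: "A \<noteq> {}" "bdd_below A"
      using neg that by (auto simp: A_def intro!: bdd_belowI[of _ 0])
    define \<tau> where "\<tau> = Inf A"
    have \<tau>0: "0 \<le> \<tau>"
      unfolding \<tau>_def using A by (intro cInf_greatest) (auto simp: A_def)
    have before: "D s \<le> c * s" if "0 \<le> s" "s < \<tau>" "s \<le> T" for s
      using cInf_lower[of s A] A that by (force simp: \<tau>_def A_def)
    have "\<tau> \<le> t"
      unfolding \<tau>_def using A neg that by (intro cInf_lower) (auto simp: A_def)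
    then have \<tau>T: "\<tau> \<le> T" using that by auto
    have D\<tau>: "D \<tau> \<le> c * \<tau>"
    proof (cases "\<tau> = 0")
      case False
      have "continuous_on {0..\<tau>} (\<lambda>s. D s - c * s)"
        by (intro continuous_intros continuous_on_subset[OF cont]) (use \<tau>T in auto)
      moreover have "closure {0..<\<tau>} = {0..\<tau>}"
        using False \<tau>0 by (intro closure_atLeastLessThan) auto
      ultimately have "D \<tau> - c * \<tau> \<le> 0"
        using before \<tau>0 \<tau>T by (intro continuous_le_on_closure[of "{0..<\<tau>}" "\<lambda>s. D s - c * s" \<tau> 0]) auto
      then show ?thesis by simp
    qed (use D0 in simp)
    then have "\<tau> \<noteq> t" using neg by auto
    with \<open>\<tau> \<le> t\<close> that have "\<tau> < T" by auto
    then obtain s0 where s0: "s0 > 0"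
      "\<And>s. \<lbrakk>0 < s; s < s0; \<tau> + s \<le> T\<rbrakk> \<Longrightarrow> D (\<tau> + s) \<le> D \<tau> + s * (L * D \<tau> + c / 2)"
      using step[of \<tau> "c/2"] \<tau>0 \<open>0 < c\<close> by auto
    obtain a where a: "a \<in> A" "a < \<tau> + s0"
      using cInf_less_iff[OF A, of "\<tau> + s0"] s0 by (auto simp: \<tau>_def)
    have "\<tau> \<le> a" unfolding \<tau>_def using a A by (intro cInf_lower)
    moreover have "a \<noteq> \<tau>" using a D\<tau> by (auto simp: A_def)
    ultimately have s: "0 < a - \<tau>" by simp
    have "D a \<le> D \<tau> + (a - \<tau>) * (L * D \<tau> + c / 2)"
      using s0(2)[of "a - \<tau>"] s a by (auto simp: A_def)
    also have "L * D \<tau> \<le> L * (c * \<tau>)"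
      using D\<tau> L by (intro mult_left_mono)
    also have "L * (c * \<tau>) \<le> c / 2"
    proof -
      have "L * \<tau> \<le> L * T" using L \<tau>T by (intro mult_left_mono)
      then have "c * (L * \<tau>) \<le> c * (1/2)" using L \<open>0 < c\<close> by (intro mult_left_mono) auto
      then show ?thesis by (simp add: mult_ac)
    qed
    finally have "D a \<le> D \<tau> + (a - \<tau>) * c" using s by simp
    then have "D a \<le> c * a" using D\<tau> by (simp add: algebra_simps)
    then show False using a by (auto simp: A_def)
  qed
  show ?thesis
  proof (rule ccontr)
    assume "\<not> D t \<le> 0"
    then have "0 < D t" and "0 < t" using D0 t by (auto simp: not_le dest: order_le_imp_less_or_eq)
    then show False using main[of "D t / (2 * t)" t] t by simp
  qed
qed

text \<open>A viability theorem of Nagumo type, by a Dini inequality for the distance to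
  \<open>K\<close>. Tangency is asked only at points nearest to the solution because
  \<open>K\<close> will be the part of \<open>X\<close> in a closed ball: through a point on the
  sphere, a curve in \<open>X\<close> may leave \<open>K\<close>.\<close>

lemma viability_compact:
  fixes K :: "'a::euclidean_space set"
  assumes K: "compact K" and lip: "L-lipschitz_on UNIV H" and d: "L * d \<le> 1/2"
    and x: "\<And>t. t \<in> {0..d} \<Longrightarrow> (x has_vector_derivative H (x t)) (at t within {0..d})"
    and x0: "x 0 \<in> K"
    and tangent: "\<And>t q. \<lbrakk>t \<in> {0..d}; q \<in> K; dist (x t) q = infdist (x t) K\<rbrakk> \<Longrightarrow>
      \<exists>\<gamma>. \<gamma> 0 = q \<and> (\<gamma> has_vector_derivative H q) (at 0) \<and> (\<forall>\<^sub>F s in at_right 0. \<gamma> s \<in> K)"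
    and t: "t \<in> {0..d}"
  shows "x t \<in> K"
proof -
  have ne: "K \<noteq> {}" using x0 by auto
  have contx: "continuous_on {0..d} x"
    using x by (rule continuous_on_vector_derivative)
  have "infdist (x t) K \<le> 0"
  proof (rule dini_nonpos[where D = "\<lambda>t. infdist (x t) K" and L = L and T = d])
    show "continuous_on {0..d} (\<lambda>t. infdist (x t) K)"
      by (intro continuous_intros contx)
    show "infdist (x 0) K \<le> 0" using x0 by simp
    show "0 \<le> L" using lip by (rule lipschitz_on_nonneg)
    show "L * d \<le> 1/2" "t \<in> {0..d}" by fact+
    fix t \<eta> :: real assume t: "0 \<le> t" "t < d" and \<eta>: "0 < \<eta>"
    obtain q where q: "q \<in> K" "infdist (x t) K = dist (x t) q"
      using infdist_attains_inf[of K "x t"] K ne by (auto simp: compact_imp_closed)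
    obtain \<gamma> where \<gamma>: "\<gamma> 0 = q" "(\<gamma> has_vector_derivative H q) (at 0)"
      and ev: "\<forall>\<^sub>F s in at_right 0. \<gamma> s \<in> K"
      using tangent[of t q] t q by auto
    obtain s1 where s1: "s1 > 0" "\<And>s. 0 < s \<Longrightarrow> s < s1 \<Longrightarrow> \<gamma> s \<in> K"
      using ev unfolding eventually_at_right_field by auto
    have "((\<lambda>s. x (t + s)) has_vector_derivative H (x t)) (at 0 within {0..d - t})"
    proof -
      have "((\<lambda>s. t + s) has_vector_derivative 1) (at 0 within {0..d - t})"
        using has_vector_derivative_add[OF has_vector_derivative_const has_vector_derivative_id] by simp
      moreover have "(x has_vector_derivative H (x t)) (at (t + 0) within (\<lambda>s. t + s) ` {0..d - t})"
        using has_vector_derivative_within_subset[OF x[of t], of "(\<lambda>s. t + s) ` {0..d - t}"] t by auto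
      ultimately show ?thesis
        using vector_diff_chain_within[of "\<lambda>s. t + s" 1 0 "{0..d - t}" x "H (x t)"]
        by (simp only: o_def scaleR_one add_0_right)
    qed
    then have "((\<lambda>s. x (t + s) - \<gamma> s) has_vector_derivative H (x t) - H q) (at 0 within {0..d - t})"
      by (rule has_vector_derivative_diff[OF _ has_vector_derivative_at_within[OF \<gamma>(2)]])
    then have "((\<lambda>s. x (t + s) - \<gamma> s) has_derivative (\<lambda>s. s *\<^sub>R (H (x t) - H q))) (at 0 within {0..d - t})"
      by (simp add: has_vector_derivative_def)
    then have "\<exists>s2>0. \<forall>s\<in>{0..d - t}. norm (s - 0) < s2 \<longrightarrow>
        norm (x (t + s) - \<gamma> s - (x (t + 0) - \<gamma> 0) - (s - 0) *\<^sub>R (H (x t) - H q)) \<le> \<eta> * norm (s - 0)"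
      unfolding has_derivative_within_alt using \<eta> by blast
    then obtain s2 where s2: "s2 > 0" "\<And>s. \<lbrakk>s \<in> {0..d - t}; \<bar>s\<bar> < s2\<rbrakk> \<Longrightarrow>
        norm (x (t + s) - \<gamma> s - (x t - q) - s *\<^sub>R (H (x t) - H q)) \<le> \<eta> * \<bar>s\<bar>"
      by (simp only: diff_0_right add_0_right \<gamma> real_norm_def) blast
    show "\<exists>s0>0. \<forall>s. 0 < s \<and> s < s0 \<and> t + s \<le> d \<longrightarrow>
        infdist (x (t + s)) K \<le> infdist (x t) K + s * (L * infdist (x t) K + \<eta>)"
    proof (intro exI[of _ "min s1 s2"] conjI allI impI; (elim conjE)?)
      show "0 < min s1 s2" using s1 s2 by simp
      fix s assume s: "0 < s" "s < min s1 s2" "t + s \<le> d"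
      have "infdist (x (t + s)) K \<le> norm (x (t + s) - \<gamma> s)"
        using infdist_le[OF s1(2)[of s], of "x (t + s)"] s by (simp add: dist_norm)
      \<comment> \<open>First-order expansion of the distance to the curve through the nearest
        point: the remainder costs \<open>\<eta> * s\<close>, and the difference of the velocities
        at most \<open>L * s\<close> times the present distance.\<close>
      also have "x (t + s) - \<gamma> s = (x (t + s) - \<gamma> s - (x t - q) - s *\<^sub>R (H (x t) - H q))
          + (x t - q) + s *\<^sub>R (H (x t) - H q)" by simp
      also have "norm \<dots> \<le> \<eta> * \<bar>s\<bar> + norm (x t - q) + s * norm (H (x t) - H q)"
        using s2(2)[of s] s by (intro norm_triangle_le add_mono) auto
      also have "norm (H (x t) - H q) \<le> L * norm (x t - q)"
        using lip by (rule lipschitz_on_normD) auto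
      finally show "infdist (x (t + s)) K \<le> infdist (x t) K + s * (L * infdist (x t) K + \<eta>)"
        using s by (simp add: q dist_norm algebra_simps)
    qed
  qed
  then show ?thesis
    using in_closed_iff_infdist_zero[OF compact_imp_closed[OF K] ne, of "x t"] infdist_nonneg[of "x t" K] by simp
qed

section \<open>Local Lipschitz extensions of smooth maps and their algebra\<close>

lemma Ck_on_open_1_lipschitz:
  fixes G :: "'a::euclidean_space \<Rightarrow> 'b::real_normed_vector"
  assumes "open W" "Ck_on_open 1 W G" "p \<in> W"
  shows "\<exists>e>0. \<exists>L. L-lipschitz_on (cball p e) G"
proof -
  obtain e where e: "e > 0" "cball p e \<subseteq> W"
    using assms by (auto simp: open_contains_cball)
  define D where "D x = frechet_derivative G (at x)" for x
  have der: "(G has_derivative D x) (at x)" if "x \<in> W" for x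
    using assms that unfolding D_def by (simp add: frechet_derivative_works)
  have cont: "continuous_on W (\<lambda>x. D x v)" for v
    using assms by (simp add: D_def)
  \<comment> \<open>\<open>Ck_on_open\<close> gives continuity of \<open>D x v\<close> in
    \<open>x\<close> for each fixed \<open>v\<close>, so the operator norm is bounded through the
    finitely many basis vectors.\<close>
  have "\<exists>B. \<forall>x\<in>cball p e. norm (D x b) \<le> B" for b
  proof -
    have "bounded ((\<lambda>x. D x b) ` cball p e)"
      by (intro compact_imp_bounded compact_continuous_image continuous_on_subset[OF cont e(2)]) auto
    then show ?thesis unfolding bounded_iff by blast
  qed
  then obtain B where B: "\<And>x b. x \<in> cball p e \<Longrightarrow> norm (D x b) \<le> B b"
    by metis
  have B0: "0 \<le> B b" for b
    using order_trans[OF norm_ge_zero B[of p b]] e by simp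
  define L where "L = (\<Sum>b\<in>Basis. B b)"
  have L0: "0 \<le> L" unfolding L_def using B0 by (intro sum_nonneg)
  have bound: "norm (D x v) \<le> L * norm v" if x: "x \<in> cball p e" for x v
  proof -
    have lin: "linear (D x)" using der[of x] e x has_derivative_linear by blast
    have "D x v = D x (\<Sum>b\<in>Basis. (v \<bullet> b) *\<^sub>R b)" by (simp add: euclidean_representation)
    also have "\<dots> = (\<Sum>b\<in>Basis. (v \<bullet> b) *\<^sub>R D x b)"
      using lin by (simp add: linear_sum linear_scale)
    also have "norm \<dots> \<le> (\<Sum>b\<in>Basis. norm v * B b)"
    proof (rule sum_norm_le)
      fix b :: 'a assume "b \<in> Basis"
      then show "norm ((v \<bullet> b) *\<^sub>R D x b) \<le> norm v * B b"
        using B[OF x, of b] Basis_le_norm[of b v] by (auto intro!: mult_mono)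
    qed
    finally show ?thesis unfolding L_def sum_distrib_right by (simp add: mult.commute)
  qed
  have "L-lipschitz_on (cball p e) G"
  proof (rule lipschitz_onI)
    fix x y assume xy: "x \<in> cball p e" "y \<in> cball p e"
    have "norm (G x - G y) \<le> L * norm (x - y)"
    proof (rule differentiable_bound[of "cball p e" G D])
      fix z assume z: "z \<in> cball p e"
      then show "(G has_derivative D z) (at z within cball p e)"
        using e by (blast intro: has_derivative_at_withinI[OF der])
      show "onorm (D z) \<le> L"
        using bound[OF z] L0 by (intro onorm_bound)
    qed (use xy in auto)
    then show "dist (G x) (G y) \<le> L * dist x y" by (simp add: dist_norm)
  qed (rule L0)
  then show ?thesis using e by blast
qed

text \<open>The extension lives on a full ambient ball because Picard iteration leaves
  \<open>X\<close> before the solution is known to lie in it. Closure of this property under sums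
  and products covers the closed-loop field.\<close>

definition locally_lipschitz_extendable ::
    "'a::euclidean_space set \<Rightarrow> ('a \<Rightarrow> 'b::real_normed_vector) \<Rightarrow> bool" where
  "locally_lipschitz_extendable X F \<longleftrightarrow>
     (\<forall>p\<in>X. \<exists>e>0. \<exists>L G. L-lipschitz_on (cball p e) G \<and> (\<forall>x\<in>X \<inter> cball p e. G x = F x))"

lemma smooth_on_locally_lipschitz_extendable:
  assumes "smooth_on X F"
  shows "locally_lipschitz_extendable X F"
  unfolding locally_lipschitz_extendable_def
proof
  fix p assume p: "p \<in> X"
  then obtain W G where W: "open W" "p \<in> W" "Ck_on_open 1 W G" "\<forall>x\<in>W \<inter> X. G x = F x"
    using assms unfolding Cr_on_def by (metis enat_ord_code(3))
  obtain e1 L where e1: "e1 > 0" "L-lipschitz_on (cball p e1) G"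
    using Ck_on_open_1_lipschitz W by metis
  obtain e2 where e2: "e2 > 0" "cball p e2 \<subseteq> W"
    using W by (auto simp: open_contains_cball)
  have "L-lipschitz_on (cball p (min e1 e2)) G"
    by (rule lipschitz_on_subset[OF e1(2)]) auto
  then show "\<exists>e>0. \<exists>L G. L-lipschitz_on (cball p e) G \<and> (\<forall>x\<in>X \<inter> cball p e. G x = F x)"
    using e1 e2 W by (intro exI[of _ "min e1 e2"]) (auto intro!: exI[of _ L] exI[of _ G])
qed

lemma locally_lipschitz_extendable_binary:
  fixes X :: "'a::euclidean_space set"
  assumes "locally_lipschitz_extendable X F1" "locally_lipschitz_extendable X F2"
    and "\<And>(p::'a) e L1 L2 G1 G2. \<lbrakk>L1-lipschitz_on (cball p e) G1; L2-lipschitz_on (cball p e) G2\<rbrakk> \<Longrightarrow>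
      \<exists>L. L-lipschitz_on (cball p e) (\<lambda>x. c (G1 x) (G2 x))"
  shows "locally_lipschitz_extendable X (\<lambda>x. c (F1 x) (F2 x))"
  unfolding locally_lipschitz_extendable_def
proof
  fix p assume p: "p \<in> X"
  obtain e1 L1 G1 where 1: "e1 > 0" "L1-lipschitz_on (cball p e1) G1" "\<forall>x\<in>X \<inter> cball p e1. G1 x = F1 x"
    using assms(1) p unfolding locally_lipschitz_extendable_def by metis
  obtain e2 L2 G2 where 2: "e2 > 0" "L2-lipschitz_on (cball p e2) G2" "\<forall>x\<in>X \<inter> cball p e2. G2 x = F2 x"
    using assms(2) p unfolding locally_lipschitz_extendable_def by metis
  define e where "e = min e1 e2"
  obtain L where "L-lipschitz_on (cball p e) (\<lambda>x. c (G1 x) (G2 x))"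
    using assms(3)[OF lipschitz_on_subset[OF 1(2)] lipschitz_on_subset[OF 2(2)], of p e]
      subset_cball[of e e1 p] subset_cball[of e e2 p] by (auto simp: e_def)
  moreover have "\<forall>x\<in>X \<inter> cball p e. c (G1 x) (G2 x) = c (F1 x) (F2 x)"
    using 1 2 by (auto simp: e_def)
  moreover have "e > 0" using 1 2 by (auto simp: e_def)
  ultimately show "\<exists>e>0. \<exists>L G. L-lipschitz_on (cball p e) G \<and>
      (\<forall>x\<in>X \<inter> cball p e. G x = c (F1 x) (F2 x))" by blast
qed

lemma locally_lipschitz_extendable_const: "locally_lipschitz_extendable X (\<lambda>x. a)"
proof -
  have "0-lipschitz_on (cball p 1) (\<lambda>x. a)" for p by (rule lipschitz_on_constant)
  then show ?thesis
    unfolding locally_lipschitz_extendable_def using zero_less_one by blast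
qed

lemma locally_lipschitz_extendable_add:
  assumes "locally_lipschitz_extendable X F1" "locally_lipschitz_extendable X F2"
  shows "locally_lipschitz_extendable X (\<lambda>x. F1 x + F2 x)"
  by (rule locally_lipschitz_extendable_binary[OF assms, where c = "(+)"])
    (rule exI, rule lipschitz_on_add)

lemma locally_lipschitz_extendable_diff:
  assumes "locally_lipschitz_extendable X F1" "locally_lipschitz_extendable X F2"
  shows "locally_lipschitz_extendable X (\<lambda>x. F1 x - F2 x)"
  by (rule locally_lipschitz_extendable_binary[OF assms, where c = "(-)"])
    (rule exI, rule lipschitz_on_diff)

lemma locally_lipschitz_extendable_sum:
  assumes "\<And>i. i \<in> I \<Longrightarrow> locally_lipschitz_extendable X (F i)"
  shows "locally_lipschitz_extendable X (\<lambda>x. \<Sum>i\<in>I. F i x)"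
  using assms
  by (induction I rule: infinite_finite_induct)
    (simp_all add: locally_lipschitz_extendable_const locally_lipschitz_extendable_add)

lemma lipschitz_on_compact_bounded:
  fixes G :: "'a::metric_space \<Rightarrow> 'b::real_normed_vector"
  assumes "L-lipschitz_on K G" "compact K"
  obtains B where "0 < B" "\<And>x. x \<in> K \<Longrightarrow> norm (G x) \<le> B"
proof -
  have "bounded (G ` K)"
    using assms by (intro compact_imp_bounded compact_continuous_image lipschitz_on_continuous_on)
  then show ?thesis using that by (auto simp: bounded_pos)
qed

lemma locally_lipschitz_extendable_scaleR:
  assumes "locally_lipschitz_extendable X (c :: 'a::euclidean_space \<Rightarrow> real)"
    and "locally_lipschitz_extendable X F"
  shows "locally_lipschitz_extendable X (\<lambda>x. c x *\<^sub>R F x)"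
  using assms
proof (rule locally_lipschitz_extendable_binary)
  fix p :: 'a and e L1 L2 and G1 :: "'a \<Rightarrow> real" and G2 :: "'a \<Rightarrow> 'b"
  assume L: "L1-lipschitz_on (cball p e) G1" "L2-lipschitz_on (cball p e) G2"
  obtain B1 where B1: "0 < B1" "\<And>x. x \<in> cball p e \<Longrightarrow> norm (G1 x) \<le> B1"
    using lipschitz_on_compact_bounded[OF L(1) compact_cball] by blast
  obtain B2 where B2: "0 < B2" "\<And>x. x \<in> cball p e \<Longrightarrow> norm (G2 x) \<le> B2"
    using lipschitz_on_compact_bounded[OF L(2) compact_cball] by blast
  have "(B1 * L2 + L1 * B2)-lipschitz_on (cball p e) (\<lambda>x. G1 x *\<^sub>R G2 x)"
  proof (rule lipschitz_onI)
    fix x y assume xy: "x \<in> cball p e" "y \<in> cball p e"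
    have "G1 x *\<^sub>R G2 x - G1 y *\<^sub>R G2 y = G1 x *\<^sub>R (G2 x - G2 y) + (G1 x - G1 y) *\<^sub>R G2 y"
      by (simp add: algebra_simps)
    also have "norm \<dots> \<le> norm (G1 x) * norm (G2 x - G2 y) + norm (G1 x - G1 y) * norm (G2 y)"
      by (metis norm_scaleR norm_triangle_ineq real_norm_def)
    also have "\<dots> \<le> B1 * (L2 * norm (x - y)) + (L1 * norm (x - y)) * B2"
      using B1 B2 xy lipschitz_on_normD[OF L(1) xy] lipschitz_on_normD[OF L(2) xy]
        lipschitz_on_nonneg[OF L(1)]
      by (intro add_mono mult_mono) auto
    finally show "dist (G1 x *\<^sub>R G2 x) (G1 y *\<^sub>R G2 y) \<le> (B1 * L2 + L1 * B2) * dist x y"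
      by (simp add: dist_norm algebra_simps)
  qed (use B1 B2 lipschitz_on_nonneg[OF L(1)] lipschitz_on_nonneg[OF L(2)] in simp)
  then show "\<exists>L. L-lipschitz_on (cball p e) (\<lambda>x. G1 x *\<^sub>R G2 x)" by blast
qed

lemma locally_lipschitz_extendable_vec_nth:
  fixes F :: "'a::euclidean_space \<Rightarrow> real^'m"
  assumes "locally_lipschitz_extendable X F"
  shows "locally_lipschitz_extendable X (\<lambda>x. F x $ i)"
  unfolding locally_lipschitz_extendable_def
proof
  fix p assume p: "p \<in> X"
  obtain e L G where 1: "e > 0" "L-lipschitz_on (cball p e) G" "\<forall>x\<in>X \<inter> cball p e. G x = F x"
    using assms(1) p unfolding locally_lipschitz_extendable_def by metis
  have "L-lipschitz_on (cball p e) (\<lambda>x. G x $ i)"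
  proof (rule lipschitz_onI)
    fix x y assume "x \<in> cball p e" "y \<in> cball p e"
    then show "dist (G x $ i) (G y $ i) \<le> L * dist x y"
      using lipschitz_onD[OF 1(2)] dist_vec_nth_le[of "G x" i "G y"] by fastforce
  qed (use 1 lipschitz_on_nonneg in blast)
  then show "\<exists>e>0. \<exists>L G. L-lipschitz_on (cball p e) G \<and> (\<forall>x\<in>X \<inter> cball p e. G x = F x $ i)"
    using 1 by (intro exI[of _ e] conjI exI[of _ L] exI[of _ "\<lambda>x. G x $ i"]) auto
qed

lemma Cr_on_continuous_on:
  assumes "Cr_on r X F"
  shows "continuous_on X F"
proof (clarsimp simp: continuous_on_eq_continuous_within)
  fix p assume p: "p \<in> X"
  then obtain W G where W: "open W" "p \<in> W" "Ck_on_open 0 W G" "\<forall>x\<in>W \<inter> X. G x = F x"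
    using assms unfolding Cr_on_def by (metis zero_enat_def i0_lb)
  then have "continuous (at p within X) G"
    by (simp add: continuous_on_eq_continuous_at continuous_at_imp_continuous_at_within)
  moreover have "\<forall>\<^sub>F x in at p within X. G x = F x"
    using W unfolding eventually_at_topological by blast
  ultimately show "continuous (at p within X) F"
    using W p tendsto_cong[of G F "at p within X" "F p"] by (simp add: continuous_within)
qed

lemma smooth_on_open_differentiable:
  assumes "open W" "smooth_on W F" "p \<in> W"
  shows "F differentiable (at p)"
proof -
  obtain W1 G where W: "open W1" "p \<in> W1" "Ck_on_open 1 W1 G" "\<forall>x\<in>W1 \<inter> W. G x = F x"
    using assms unfolding Cr_on_def by (metis enat_ord_code(3))
  then obtain D where "(G has_derivative D) (at p)"
    by (auto simp: differentiable_def)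
  then have "(F has_derivative D) (at p)"
    using W assms by (intro has_derivative_transform_within_open[of G D p UNIV "W1 \<inter> W" F]) auto
  then show ?thesis by (auto simp: differentiable_def)
qed

section \<open>Fields tangent to the state space\<close>

text \<open>Compared with \<open>tangent_space\<close>, the curve only has to be differentiable at
  0. This is what the viability argument consumes, and curves pulled back through a chart fit
  without a smoothness proof.\<close>

definition velocities :: "'a::euclidean_space set \<Rightarrow> 'a \<Rightarrow> 'a set" where
  "velocities X p = {v. \<exists>\<gamma>. \<gamma> 0 = p \<and> (\<gamma> has_vector_derivative v) (at 0) \<and>
     (\<forall>\<^sub>F s in nhds (0::real). \<gamma> s \<in> X)}"

lemma tangent_space_subset_velocities: "tangent_space X p \<subseteq> velocities X p"
proof
  fix v assume "v \<in> tangent_space X p"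
  then obtain \<gamma> e where \<gamma>: "e > 0" "\<gamma> ` {-e<..<e} \<subseteq> X" "\<gamma> 0 = p" "(\<gamma> has_vector_derivative v) (at 0)"
    unfolding tangent_space_def by blast
  have "\<forall>\<^sub>F s in nhds 0. s \<in> {-e<..<e}"
    using \<gamma> by (intro eventually_nhds_in_open) auto
  then have "\<forall>\<^sub>F s in nhds 0. \<gamma> s \<in> X"
    by (rule eventually_mono) (use \<gamma> in blast)
  with \<gamma> show "v \<in> velocities X p" unfolding velocities_def by blast
qed

lemma has_vector_derivative_line: "((\<lambda>s. p + s *\<^sub>R v) has_vector_derivative v) (at s)"
  using has_vector_derivative_add[OF has_vector_derivative_const
      has_vector_derivative_scaleR[OF DERIV_ident has_vector_derivative_const]] by simp

lemma eventually_line_in_open: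
  assumes "open W" "p \<in> W"
  shows "\<forall>\<^sub>F s in nhds (0::real). p + s *\<^sub>R (v :: 'a::real_normed_vector) \<in> W"
proof -
  have "((\<lambda>s. p + s *\<^sub>R v) \<longlongrightarrow> p + 0 *\<^sub>R v) (nhds (0::real))"
    by (intro tendsto_intros filterlim_ident)
  then show ?thesis using topological_tendstoD assms by fastforce
qed

lemma velocities_open:
  assumes "open X" "p \<in> X"
  shows "velocities X p = UNIV"
proof -
  have "v \<in> velocities X p" for v
    unfolding velocities_def
    using eventually_line_in_open[OF assms, of v] has_vector_derivative_line[of p v 0]
    by (intro CollectI exI[of _ "\<lambda>s. p + s *\<^sub>R v"]) simp
  then show ?thesis by blast
qed

text \<open>Each linear functional given by a vector orthogonal to \<open>E\<close> is zero along
  the curve, hence on its derivative, and \<open>E\<close> is its own double orthogonal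
  complement.\<close>

lemma has_derivative_in_subspace:
  fixes c :: "real \<Rightarrow> 'a::euclidean_space"
  assumes "(c has_vector_derivative v) (at 0)" "\<forall>\<^sub>F s in nhds 0. c s \<in> E" "subspace E"
  shows "v \<in> E"
proof -
  have "v \<bullet> w = 0" if "w \<in> E\<^sup>\<bottom>" for w
  proof -
    have "((\<lambda>s. c s \<bullet> w) has_vector_derivative v \<bullet> w) (at 0)"
      using bounded_linear.has_vector_derivative[OF bounded_linear_inner_left assms(1)] .
    moreover have "\<forall>\<^sub>F s in nhds 0. c s \<bullet> w = 0"
      using assms(2) by eventually_elim (use that in \<open>auto simp: orthogonal_comp_def orthogonal_def inner_commute\<close>)
    moreover from this have "c 0 \<bullet> w = 0"
      by (rule eventually_nhds_x_imp_x)
    ultimately have "((\<lambda>s::real. 0::real) has_vector_derivative v \<bullet> w) (at 0)"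
      using has_vector_derivative_cong_ev[where x = 0 and S = UNIV and f = "\<lambda>s. c s \<bullet> w" and g = "\<lambda>s. 0"]
      by simp
    then show ?thesis
      using vector_derivative_unique_at[OF _ has_vector_derivative_const] by metis
  qed
  then have "v \<in> E\<^sup>\<bottom>\<^sup>\<bottom>"
    by (auto simp: orthogonal_comp_def[of "E\<^sup>\<bottom>"] orthogonal_def inner_commute)
  then show ?thesis using orthogonal_comp_self[OF assms(3)] by simp
qed

text \<open>The velocities at \<open>p\<close> are the preimage of \<open>E\<close> under the
  derivative \<open>A\<close> of the chart. One inclusion pushes a curve through the chart; the
  other pulls back the line through \<open>\<psi> p\<close> with direction \<open>A v\<close>, and
  \<open>B (A v) = v\<close> identifies its velocity. Being a subspace makes \<open>-F\<close> and
  the closed-loop combination of fields tangent again.\<close>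

lemma velocities_submanifold:
  assumes "smooth_submanifold X" "p \<in> X"
  shows "subspace (velocities X p)"
proof -
  obtain W W' \<psi> \<eta> E where chart: "open W" "p \<in> W" "open W'" "homeomorphism W W' \<psi> \<eta>"
      "smooth_on W \<psi>" "smooth_on W' \<eta>" "subspace E" and XE: "\<psi> ` (W \<inter> X) = W' \<inter> (E :: 'a set)"
    using assms unfolding smooth_submanifold_def by blast
  have inv: "\<eta> (\<psi> x) = x" if "x \<in> W" for x
    using chart that by (auto simp: homeomorphism_def)
  have pE: "\<psi> p \<in> W'" "\<psi> p \<in> E" using XE assms chart by blast+
  obtain A where A: "(\<psi> has_derivative A) (at p)"
    using smooth_on_open_differentiable[OF chart(1,5,2)] by (auto simp: differentiable_def)
  obtain B where B: "(\<eta> has_derivative B) (at (\<psi> p))"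
    using smooth_on_open_differentiable[OF chart(3,6) pE(1)] by (auto simp: differentiable_def)
  have lin: "linear A" "linear B" using A B has_derivative_linear by blast+
  have BA: "B (A v) = v" for v
  proof -
    have "(\<eta> \<circ> \<psi> has_derivative B \<circ> A) (at p)"
      using A B by (rule diff_chain_at)
    moreover have "(\<eta> \<circ> \<psi> has_derivative (\<lambda>x. x)) (at p)"
      by (rule has_derivative_transform_within_open[OF has_derivative_ident chart(1,2)]) (simp add: inv)
    ultimately have "B \<circ> A = (\<lambda>x. x)" by (rule has_derivative_unique)
    then show ?thesis by (metis comp_apply)
  qed
  have "velocities X p = {v. A v \<in> E}"
  proof (intro equalityI subsetI CollectI)
    fix v assume "v \<in> velocities X p"
    then obtain \<gamma> where \<gamma>: "\<gamma> 0 = p" "(\<gamma> has_vector_derivative v) (at 0)" "\<forall>\<^sub>F s in nhds 0. \<gamma> s \<in> X"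
      unfolding velocities_def by blast
    have "(\<psi> \<circ> \<gamma> has_derivative A \<circ> (\<lambda>s. s *\<^sub>R v)) (at 0)"
      using \<gamma> A by (intro diff_chain_at) (auto simp: has_vector_derivative_def)
    then have der: "((\<lambda>s. \<psi> (\<gamma> s)) has_vector_derivative A v) (at 0)"
      using lin(1) by (simp add: has_vector_derivative_def o_def linear_scale)
    have "isCont \<gamma> 0"
      using \<gamma>(2) has_vector_derivative_continuous by blast
    then have "(\<gamma> \<longlongrightarrow> p) (nhds 0)"
      using \<gamma>(1) by (simp add: continuous_at_imp_continuous_within tendsto_nhds_iff isCont_def)
    then have "\<forall>\<^sub>F s in nhds 0. \<gamma> s \<in> W"
      using chart(1,2) by (rule topological_tendstoD)
    with \<gamma>(3) have "\<forall>\<^sub>F s in nhds 0. \<psi> (\<gamma> s) \<in> E"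
      by eventually_elim (use XE in blast)
    with der show "A v \<in> E" using chart(7) by (rule has_derivative_in_subspace)
  next
    fix v assume v: "v \<in> {v. A v \<in> E}"
    define \<gamma> where "\<gamma> s = \<eta> (\<psi> p + s *\<^sub>R A v)" for s
    have "\<gamma> 0 = p" using inv chart by (simp add: \<gamma>_def)
    moreover have "(\<gamma> has_vector_derivative v) (at 0)"
    proof -
      have "(\<eta> \<circ> (\<lambda>s. \<psi> p + s *\<^sub>R A v) has_derivative B \<circ> (\<lambda>s. s *\<^sub>R A v)) (at 0)"
        using B has_vector_derivative_line[of "\<psi> p" "A v" 0]
        by (intro diff_chain_at) (auto simp: has_vector_derivative_def)
      then show ?thesis
        using lin(2) by (simp add: has_vector_derivative_def o_def \<gamma>_def[abs_def] linear_scale BA)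
    qed
    moreover have "\<forall>\<^sub>F s in nhds 0. \<gamma> s \<in> X"
      using eventually_line_in_open[OF chart(3) pE(1), of "A v"]
    proof eventually_elim
      case (elim s)
      then have "\<psi> p + s *\<^sub>R A v \<in> \<psi> ` (W \<inter> X)"
        using XE v pE chart(7) by (simp add: subspace_add subspace_scale)
      then show ?case using inv by (auto simp: \<gamma>_def)
    qed
    ultimately show "v \<in> velocities X p" unfolding velocities_def by blast
  qed
  then show ?thesis
    using linear_subspace_vimage[OF lin(1) chart(7)] by (simp add: vimage_def)
qed

lemma subspace_velocities:
  assumes "open X \<or> smooth_submanifold X" "p \<in> X"
  shows "subspace (velocities X p)"
  using assms velocities_submanifold velocities_open[of X p] by auto

lemma locally_compact_state_space:
  fixes X :: "'a::euclidean_space set"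
  assumes "open X \<or> smooth_submanifold X"
  shows "locally compact X"
proof (cases "open X")
  case True
  then show ?thesis by (rule open_imp_locally_compact)
next
  case False
  with assms have sub: "smooth_submanifold X" by blast
  show ?thesis
    unfolding locally_compact_Int_cball
  proof
    fix p assume p: "p \<in> X"
    obtain W W' \<psi> \<eta> E where chart: "open W" "p \<in> W" "homeomorphism W W' \<psi> \<eta>" "subspace E"
        and XE: "\<psi> ` (W \<inter> X) = W' \<inter> (E :: 'a set)"
      using sub p unfolding smooth_submanifold_def by blast
    obtain e where e: "e > 0" "cball p e \<subseteq> W"
      using chart by (auto simp: open_contains_cball)
    \<comment> \<open>Injectivity of the chart turns the equality of images into a pointwise test;
      inside \<open>W\<close> the set \<open>X\<close> is then the preimage of the closed set
      \<open>E\<close>.\<close>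
    have "x \<in> X \<longleftrightarrow> \<psi> x \<in> E" if "x \<in> W" for x
    proof -
      have "inj_on \<psi> W" using chart(3) by (metis homeomorphism_def inj_on_inverseI)
      moreover have "\<psi> x \<in> W'" using chart(3) that by (auto simp: homeomorphism_def)
      ultimately show ?thesis using XE that by (auto dest: inj_onD)
    qed
    then have "cball p e \<inter> X = cball p e \<inter> \<psi> -` E"
      using e by blast
    moreover have "closed (cball p e \<inter> \<psi> -` E)"
      by (rule continuous_closed_preimage[OF _ closed_cball closed_subspace[OF chart(4)]])
        (use chart(3) e in \<open>auto simp: homeomorphism_def intro: continuous_on_subset\<close>)
    ultimately show "\<exists>e>0. closed (cball p e \<inter> X)"
      using e by auto
  qed
qed

text \<open>One \<open>\<delta>\<close> serves all starting points near \<open>p\<close>, so that a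
  finite subcover yields a common existence time on a compact set.\<close>

definition locally_solvable :: "'a::euclidean_space set \<Rightarrow> ('a \<Rightarrow> 'a) \<Rightarrow> bool" where
  "locally_solvable X F \<longleftrightarrow>
     (\<forall>p\<in>X. \<exists>e>0. \<exists>\<delta>>0. \<forall>x0\<in>X \<inter> ball p e. \<exists>x. solution_on X F {0..\<delta>} x \<and> x 0 = x0)"

text \<open>The distance of a solution of the extended field to \<open>X\<close> satisfies the differential inequality
  \<open>d' \<le> L d\<close>: compare the solution with a curve in \<open>X\<close> through a nearest point.\<close>

lemma locally_solvable_if_tangent:
  fixes X :: "'a::euclidean_space set"
  assumes X: "locally compact X" and F: "locally_lipschitz_extendable X F"
    and tangent: "\<And>x. x \<in> X \<Longrightarrow> F x \<in> velocities X x"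
  shows "locally_solvable X F"
  unfolding locally_solvable_def
proof
  fix p assume p: "p \<in> X"
  obtain e1 where e1: "e1 > 0" "closed (cball p e1 \<inter> X)"
    using X p by (auto simp: locally_compact_Int_cball)
  obtain e2 L G where e2: "e2 > 0" "L-lipschitz_on (cball p e2) G" "\<forall>x\<in>X \<inter> cball p e2. G x = F x"
    using F p unfolding locally_lipschitz_extendable_def by metis
  define e where "e = min e1 e2"
  have e0: "0 < e" using e1 e2 by (simp add: e_def)
  define B where "B = cball p e"
  have B: "convex B" "closed B" "B \<noteq> {}" "compact B" "B \<subseteq> cball p e1" "B \<subseteq> cball p e2"
    using e0 by (auto simp: B_def e_def)
  have GL: "L-lipschitz_on B G"
    using e2(2) B(6) by (rule lipschitz_on_subset)
  obtain M where M: "0 < M" "\<And>x. x \<in> B \<Longrightarrow> norm (G x) \<le> M"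
    using lipschitz_on_compact_bounded[OF GL B(4)] by blast
  \<comment> \<open>The projection onto a closed convex set is nonexpansive, so \<open>H\<close> is
    globally Lipschitz with the same constant \<open>L\<close>.\<close>
  define H where "H x = G (closest_point B x)" for x
  have inB: "closest_point B x \<in> B" for x
    using B by (intro closest_point_in_set)
  have HL: "L-lipschitz_on UNIV H"
  proof (rule lipschitz_onI)
    fix x y
    have "dist (H x) (H y) \<le> L * dist (closest_point B x) (closest_point B y)"
      unfolding H_def by (intro lipschitz_onD[OF GL] inB)
    also have "\<dots> \<le> L * dist x y"
      using closest_point_lipschitz[OF B(1,2,3)] lipschitz_on_nonneg[OF GL] by (intro mult_left_mono)
    finally show "dist (H x) (H y) \<le> L * dist x y" .
  qed (rule lipschitz_on_nonneg[OF GL])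
  have L0: "0 \<le> L" by (rule lipschitz_on_nonneg[OF GL])
  \<comment> \<open>The first term gives the bound \<open>L * \<delta> \<le> 1/2\<close> used for
    existence and viability; the second keeps the solution within \<open>e / 4\<close> of its start,
    hence within \<open>e / 2\<close> of \<open>p\<close>.\<close>
  define \<delta> where "\<delta> = min (1 / (2 * (L + 1))) (e / (4 * M))"
  have \<delta>: "0 < \<delta>" "L * \<delta> \<le> 1/2" "M * \<delta> \<le> e / 4"
  proof -
    show "0 < \<delta>" using L0 M e0 by (simp add: \<delta>_def)
    have "L * \<delta> \<le> L * (1 / (2 * (L + 1)))" using L0 by (intro mult_left_mono) (auto simp: \<delta>_def)
    also have "\<dots> \<le> 1/2" using L0 by (simp add: field_simps)
    finally show "L * \<delta> \<le> 1/2" .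
    have "M * \<delta> \<le> M * (e / (4 * M))" using M by (intro mult_left_mono) (auto simp: \<delta>_def)
    then show "M * \<delta> \<le> e / 4" using M by simp
  qed
  have "\<exists>x. solution_on X F {0..\<delta>} x \<and> x 0 = x0" if x0: "x0 \<in> X \<inter> ball p (e / 4)" for x0
  proof -
    obtain x where x: "x 0 = x0"
        "\<And>t. t \<in> {0..\<delta>} \<Longrightarrow> (x has_vector_derivative H (x t)) (at t within {0..\<delta>})"
      using picard_lipschitz[OF HL, of \<delta> x0] \<delta> by auto
    have near: "dist (x t) x0 \<le> e / 4" if t: "t \<in> {0..\<delta>}" for t
    proof -
      have "norm (x t - x 0) \<le> M * norm (t - 0)"
      proof (rule differentiable_bound[of "{0..\<delta>}" x "\<lambda>s u. u *\<^sub>R H (x s)"])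
        fix s assume "s \<in> {0..\<delta>}"
        then show "(x has_derivative (\<lambda>u. u *\<^sub>R H (x s))) (at s within {0..\<delta>})"
          using x(2) by (simp add: has_vector_derivative_def)
        show "onorm (\<lambda>u. u *\<^sub>R H (x s)) \<le> M"
          using M(1) M(2)[OF inB[of "x s"]]
          by (intro onorm_bound) (auto simp: H_def mult.commute[of M] intro!: mult_left_mono)
      qed (use t \<delta> in auto)
      also have "M * norm (t - 0) \<le> M * \<delta>" using t M by (intro mult_left_mono) auto
      finally show ?thesis using \<delta> x by (simp add: dist_norm)
    qed
    have near_p: "dist (x t) p < e / 2" if "t \<in> {0..\<delta>}" for t
      using near[OF that] x0 dist_triangle[of "x t" p x0] by (simp add: dist_commute)
    define K where "K = B \<inter> X"
    have K: "compact K"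
    proof -
      have "K = B \<inter> (cball p e1 \<inter> X)" using B by (auto simp: K_def)
      then show ?thesis using B e1 by (simp add: compact_Int_closed)
    qed
    have HF: "H q = F q" if "q \<in> K" for q
      using that B e2 by (auto simp: H_def K_def closest_point_self)
    have x0K: "x 0 \<in> K"
      using x x0 e0 by (auto simp: K_def B_def)
    have xK: "x t \<in> K" if "t \<in> {0..\<delta>}" for t
    proof (rule viability_compact[OF K HL \<delta>(2) x(2) x0K _ that])
      fix s q assume s: "s \<in> {0..\<delta>}" and q: "q \<in> K" "dist (x s) q = infdist (x s) K"
      \<comment> \<open>The starting point itself lies in \<open>K\<close>, so a nearest point
        \<open>q\<close> is no further away than it. Then \<open>q\<close> is within
        \<open>3 * e / 4\<close> of \<open>p\<close>, off the sphere, and a curve in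
        \<open>X\<close> through \<open>q\<close> stays in \<open>K\<close> for a short
        time.\<close>
      have "dist (x s) q \<le> e / 4"
        using infdist_le[OF x0K, of "x s"] near[OF s] q x by simp
      then have "q \<in> ball p e"
        using near_p[OF s] dist_triangle[of q p "x s"] e0 by (simp add: dist_commute)
      obtain \<gamma> where \<gamma>: "\<gamma> 0 = q" "(\<gamma> has_vector_derivative F q) (at 0)" "\<forall>\<^sub>F s in nhds 0. \<gamma> s \<in> X"
        using tangent[of q] q unfolding velocities_def K_def by blast
      have "isCont \<gamma> 0"
        using \<gamma>(2) has_vector_derivative_continuous by blast
      then have "(\<gamma> \<longlongrightarrow> q) (nhds 0)"
        using \<gamma>(1) by (simp add: tendsto_nhds_iff isCont_def)
      then have "\<forall>\<^sub>F s in nhds 0. \<gamma> s \<in> ball p e"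
        by (rule topological_tendstoD) (use \<open>q \<in> ball p e\<close> in auto)
      with \<gamma>(3) have "\<forall>\<^sub>F s in nhds 0. \<gamma> s \<in> K"
        by eventually_elim (auto simp: K_def B_def)
      then have "\<forall>\<^sub>F s in at_right 0. \<gamma> s \<in> K"
        by (rule filter_leD[OF at_within_le_nhds])
      with \<gamma> show "\<exists>\<gamma>. \<gamma> 0 = q \<and> (\<gamma> has_vector_derivative H q) (at 0) \<and> (\<forall>\<^sub>F s in at_right 0. \<gamma> s \<in> K)"
        using HF[OF q(1)] by auto
    qed auto
    have "solution_on X F {0..\<delta>} x"
      unfolding solution_on_def
    proof (intro conjI ballI)
      show "x ` {0..\<delta>} \<subseteq> X" using xK by (auto simp: K_def)
      show "(x has_vector_derivative F (x t)) (at t within {0..\<delta>})" if "t \<in> {0..\<delta>}" for t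
        using x(2)[OF that] HF[OF xK[OF that]] by simp
    qed (use \<delta> in auto)
    with x show ?thesis by blast
  qed
  then show "\<exists>e>0. \<exists>\<delta>>0. \<forall>x0\<in>X \<inter> ball p e. \<exists>x. solution_on X F {0..\<delta>} x \<and> x 0 = x0"
    using e0 \<delta>(1) by (intro exI[of _ "e / 4"]) auto
qed

section \<open>Solutions of regular fields\<close>

lemma solution_on_subset:
  assumes "solution_on X F J x" "J' \<subseteq> J" "is_interval J'" "0 \<in> J'"
  shows "solution_on X F J' x"
  using assms unfolding solution_on_def
  by (blast intro: has_vector_derivative_within_subset)

lemma solution_on_mem: "solution_on X F J x \<Longrightarrow> t \<in> J \<Longrightarrow> x t \<in> X"
  by (auto simp: solution_on_def)

lemma solution_on_derivative:
  "solution_on X F J x \<Longrightarrow> t \<in> J \<Longrightarrow> (x has_vector_derivative F (x t)) (at t within J)"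
  by (auto simp: solution_on_def)

lemma solution_on_continuous: "solution_on X F J x \<Longrightarrow> continuous_on J x"
  by (rule continuous_on_vector_derivative) (rule solution_on_derivative)

lemma solution_on_atLeastAtMost:
  assumes "solution_on X F J x" "t \<in> J" "0 \<le> t"
  shows "solution_on X F {0..t} x"
proof (rule solution_on_subset[OF assms(1)])
  have "is_interval J" "0 \<in> J" using assms(1) by (auto simp: solution_on_def)
  then show "{0..t} \<subseteq> J" using assms(2) mem_is_interval_1_I[of J 0 t] by auto
qed (use assms in auto)

lemma solution_on_shift:
  assumes "solution_on X F J x" "(\<lambda>t. s + t) ` J' \<subseteq> J" "is_interval J'" "0 \<in> J'"
  shows "solution_on X F J' (\<lambda>t. x (s + t))"
  unfolding solution_on_def
proof (intro conjI ballI)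
  fix t assume t: "t \<in> J'"
  have "((\<lambda>t. s + t) has_vector_derivative 1) (at t within J')"
    using has_vector_derivative_add[OF has_vector_derivative_const has_vector_derivative_id] by simp
  moreover have "(x has_vector_derivative F (x (s + t))) (at (s + t) within (\<lambda>t. s + t) ` J')"
    using assms t by (intro has_vector_derivative_within_subset[OF solution_on_derivative[OF assms(1)]]) auto
  ultimately show "((\<lambda>t. x (s + t)) has_vector_derivative F (x (s + t))) (at t within J')"
    using vector_diff_chain_within[of "\<lambda>t. s + t" 1 t J' x] by (simp only: o_def scaleR_one)
qed (use assms in \<open>auto simp: solution_on_def\<close>)

lemma solution_on_reflect:
  assumes "solution_on X F J x" "(\<lambda>t. s - t) ` J' \<subseteq> J" "is_interval J'" "0 \<in> J'"
  shows "solution_on X (\<lambda>x. - F x) J' (\<lambda>t. x (s - t))"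
  unfolding solution_on_def
proof (intro conjI ballI)
  fix t assume t: "t \<in> J'"
  have "((\<lambda>t. s - t) has_vector_derivative - 1) (at t within J')"
    using has_vector_derivative_diff[OF has_vector_derivative_const has_vector_derivative_id] by simp
  moreover have "(x has_vector_derivative F (x (s - t))) (at (s - t) within (\<lambda>t. s - t) ` J')"
    using assms t by (intro has_vector_derivative_within_subset[OF solution_on_derivative[OF assms(1)]]) auto
  ultimately show "((\<lambda>t. x (s - t)) has_vector_derivative - F (x (s - t))) (at t within J')"
    using vector_diff_chain_within[of "\<lambda>t. s - t" "-1" t J' x]
    by (simp only: o_def scaleR_minus_left scaleR_one)
qed (use assms in \<open>auto simp: solution_on_def\<close>)

lemma solution_on_append:
  assumes x: "solution_on X F {0..a} x" and y: "solution_on X F {0..b} y" and yx: "y 0 = x a"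
    and ab: "0 \<le> a" "0 \<le> b"
  shows "solution_on X F {0..a + b} (\<lambda>t. if t \<in> {0..a} then x t else y (t - a))"
  unfolding solution_on_def
proof (intro conjI ballI)
  show "(\<lambda>t. if t \<in> {0..a} then x t else y (t - a)) ` {0..a + b} \<subseteq> X"
    using solution_on_mem[OF x] solution_on_mem[OF y] by auto
  fix t assume t: "t \<in> {0..a + b}"
  have cl: "closure {0..a} \<inter> closure {a..a + b} = {a}" using ab by auto
  have un: "{0..a} \<union> {a} = {0..a}" "{a..a + b} \<union> {a} = {a..a + b}" using ab by auto
  have y': "((\<lambda>t. y (t - a)) has_vector_derivative F (y (t - a))) (at t within {a..a + b})"
    if "t \<in> {a..a + b}"
  proof -
    have "((\<lambda>t. t - a) has_vector_derivative 1) (at t within {a..a + b})"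
      using has_vector_derivative_diff[OF has_vector_derivative_id has_vector_derivative_const] by simp
    moreover have "(y has_vector_derivative F (y (t - a))) (at (t - a) within (\<lambda>t. t - a) ` {a..a + b})"
      using that by (intro has_vector_derivative_within_subset[OF solution_on_derivative[OF y]]) auto
    ultimately show ?thesis
      using vector_diff_chain_within[of "\<lambda>t. t - a" 1 t "{a..a + b}" y] by (simp only: o_def scaleR_one)
  qed
  have "((\<lambda>t. if t \<in> {0..a} then x t else y (t - a)) has_vector_derivative
      (if t \<in> {0..a} then F (x t) else F (y (t - a)))) (at t within {0..a + b})"
  proof (rule has_vector_derivative_If_within_closures[where T = "{a..a + b}"])
    show "t \<in> {0..a} \<union> {a..a + b}" "{0..a + b} = {0..a} \<union> {a..a + b}"
      using t ab by auto
    show "(x has_vector_derivative F (x t)) (at t within {0..a} \<union> (closure {0..a} \<inter> closure {a..a + b}))"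
      if "t \<in> {0..a} \<union> (closure {0..a} \<inter> closure {a..a + b})"
      using solution_on_derivative[OF x] that unfolding cl un by simp
    show "((\<lambda>t. y (t - a)) has_vector_derivative F (y (t - a)))
        (at t within {a..a + b} \<union> (closure {0..a} \<inter> closure {a..a + b}))"
      if "t \<in> {a..a + b} \<union> (closure {0..a} \<inter> closure {a..a + b})"
      using y' that unfolding cl un by simp
    assume "t \<in> closure {0..a}" "t \<in> closure {a..a + b}"
    then have "t = a" using cl by blast
    then show "x t = y (t - a)" "F (x t) = F (y (t - a))" using yx by simp_all
  qed
  then show "((\<lambda>t. if t \<in> {0..a} then x t else y (t - a)) has_vector_derivative
      F (if t \<in> {0..a} then x t else y (t - a))) (at t within {0..a + b})"
    by (simp only: if_distrib[of F])
qed (use ab in auto)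

text \<open>The squared distance times \<open>exp (- 2 * L * t)\<close> has nonpositive derivative;
  squaring avoids the kink of the norm at 0. The Lipschitz bound is asked only along the two
  solutions, so it can be used for a locally Lipschitz field as long as they stay close.\<close>

lemma gronwall_solutions:
  assumes z: "solution_on X F {0..T} z" and y: "solution_on X F {0..T} y" and T: "0 \<le> T"
    and lip: "\<And>t. \<lbrakk>0 < t; t < T\<rbrakk> \<Longrightarrow> norm (F (z t) - F (y t)) \<le> L * norm (z t - y t)"
  shows "norm (z T - y T) \<le> exp (L * T) * norm (z 0 - y 0)"
proof -
  define w where "w t = z t - y t" for t
  define u where "u t = (w t \<bullet> w t) * exp (- 2 * L * t)" for t
  have "u T \<le> u 0"
  proof (rule DERIV_nonpos_imp_decreasing_open[OF T])
    show "continuous_on {0..T} u"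
      unfolding u_def w_def
      by (intro continuous_intros solution_on_continuous[OF z] solution_on_continuous[OF y])
    fix t assume t: "0 < t" "t < T"
    define w' where "w' = F (z t) - F (y t)"
    have "(w has_vector_derivative w') (at t within {0..T})"
      unfolding w_def w'_def using t
      by (intro has_vector_derivative_diff solution_on_derivative[OF z] solution_on_derivative[OF y]) auto
    then have "(w has_vector_derivative w') (at t)"
      using t by (simp add: at_within_Icc_at)
    then have "((\<lambda>t. w t \<bullet> w t) has_real_derivative w t \<bullet> w' + w' \<bullet> w t) (at t)"
      unfolding has_real_derivative_iff_has_vector_derivative
      by (intro bounded_bilinear.has_vector_derivative[OF bounded_bilinear_inner])
    moreover have "((\<lambda>t. exp (- 2 * L * t)) has_real_derivative exp (- 2 * L * t) * (- 2 * L)) (at t)"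
      by (auto intro!: derivative_eq_intros)
    ultimately have "(u has_real_derivative (w t \<bullet> w' + w' \<bullet> w t) * exp (- 2 * L * t) +
        exp (- 2 * L * t) * (- 2 * L) * (w t \<bullet> w t)) (at t)"
      unfolding u_def by (rule DERIV_mult)
    moreover have "(w t \<bullet> w' + w' \<bullet> w t) * exp (- 2 * L * t) +
        exp (- 2 * L * t) * (- 2 * L) * (w t \<bullet> w t) = 2 * exp (- 2 * L * t) * (w t \<bullet> w' - L * (w t \<bullet> w t))"
      by (simp add: inner_commute algebra_simps)
    moreover have "w t \<bullet> w' \<le> L * (w t \<bullet> w t)"
    proof -
      have "w t \<bullet> w' \<le> norm (w t) * norm w'" by (rule norm_cauchy_schwarz)
      also have "\<dots> \<le> norm (w t) * (L * norm (w t))"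
        using lip[OF t] by (intro mult_left_mono) (auto simp: w_def w'_def)
      finally show ?thesis by (simp add: dot_square_norm power2_eq_square mult_ac)
    qed
    ultimately show "\<exists>d. (u has_real_derivative d) (at t) \<and> d \<le> 0"
      by (metis diff_le_0_iff_le exp_ge_zero mult_nonneg_nonpos zero_le_mult_iff zero_le_numeral)
  qed
  then have "(norm (w T))\<^sup>2 * exp (- 2 * L * T) \<le> (norm (w 0))\<^sup>2"
    by (simp add: u_def dot_square_norm)
  then have "(norm (w T))\<^sup>2 * exp (- 2 * L * T) * exp (2 * L * T) \<le> (norm (w 0))\<^sup>2 * exp (2 * L * T)"
    by (intro mult_right_mono) auto
  then have "(norm (w T))\<^sup>2 \<le> (exp (L * T) * norm (w 0))\<^sup>2"
    by (simp add: mult.assoc power_mult_distrib mult_exp_exp exp_double[symmetric] mult_ac)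
  then show ?thesis
    unfolding w_def by (rule power2_le_imp_le) auto
qed

text \<open>Solvability of \<open>-F\<close> is included to make the locale symmetric under time
  reversal: statements about negative times are forward statements about \<open>-F\<close>.\<close>

locale regular_field =
  fixes X :: "'a::euclidean_space set" and F :: "'a \<Rightarrow> 'a"
  assumes lip: "locally_lipschitz_extendable X F"
    and solvable: "locally_solvable X F" and solvable_backward: "locally_solvable X (\<lambda>x. - F x)"
begin

lemma backward: "regular_field X (\<lambda>x. - F x)"
proof
  show "locally_lipschitz_extendable X (\<lambda>x. - F x)"
    using locally_lipschitz_extendable_diff[OF locally_lipschitz_extendable_const[of X 0] lip] by simp
qed (use solvable solvable_backward in simp_all)

lemma solvable_at:
  assumes "p \<in> X"
  obtains \<delta> x where "0 < \<delta>" "solution_on X F {0..\<delta>} x" "x 0 = p"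
proof -
  obtain e \<delta> where "0 < e" "0 < \<delta>"
    "\<forall>x0\<in>X \<inter> ball p e. \<exists>x. solution_on X F {0..\<delta>} x \<and> x 0 = x0"
    using solvable assms unfolding locally_solvable_def by blast
  then show ?thesis using that assms centre_in_ball[of p e] by blast
qed

section \<open>Continuous dependence, uniqueness and continuation of solutions\<close>

lemma lipschitz_near_compact:
  assumes C: "compact C" "C \<subseteq> X"
  shows "\<exists>e>0. \<exists>L\<ge>0. \<forall>a\<in>C. \<forall>b\<in>X. dist a b < e \<longrightarrow> norm (F a - F b) \<le> L * norm (a - b)"
proof -
  have "\<exists>e L. e > 0 \<and> 0 \<le> L \<and> (\<forall>a\<in>X \<inter> ball p e. \<forall>b\<in>X \<inter> ball p e. norm (F a - F b) \<le> L * norm (a - b))"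
    if p: "p \<in> C" for p
  proof -
    obtain e L G where G: "e > 0" "L-lipschitz_on (cball p e) G" "\<forall>x\<in>X \<inter> cball p e. G x = F x"
      using lip p C unfolding locally_lipschitz_extendable_def by (metis subsetD)
    have "norm (F a - F b) \<le> L * norm (a - b)" if "a \<in> X \<inter> ball p e" "b \<in> X \<inter> ball p e" for a b
    proof -
      have "F a = G a" "F b = G b" "a \<in> cball p e" "b \<in> cball p e" using that G(3) by auto
      then show ?thesis using lipschitz_on_normD[OF G(2)] by simp
    qed
    then show ?thesis using G(1) lipschitz_on_nonneg[OF G(2)] by blast
  qed
  then obtain r M where rM: "\<And>p. p \<in> C \<Longrightarrow> r p > 0" "\<And>p. p \<in> C \<Longrightarrow> 0 \<le> M p"
      "\<And>p a b. \<lbrakk>p \<in> C; a \<in> X \<inter> ball p (r p); b \<in> X \<inter> ball p (r p)\<rbrakk> \<Longrightarrow>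
        norm (F a - F b) \<le> M p * norm (a - b)"
    by metis
  obtain D where D: "D \<subseteq> C" "finite D" "C \<subseteq> (\<Union>p\<in>D. ball p (r p))"
    by (rule compactE_image[OF C(1), of C "\<lambda>p. ball p (r p)"]) (use rM(1) in auto)
  \<comment> \<open>A Lebesgue number of the cover. It allows the second point to lie outside
    \<open>C\<close>, as a perturbed solution does with respect to the reference trajectory.\<close>
  obtain e where e: "e > 0" "\<forall>x\<in>C. \<exists>G\<in>(\<lambda>p. ball p (r p)) ` D. ball x e \<subseteq> G"
    by (rule Heine_Borel_lemma[OF C(1), of "(\<lambda>p. ball p (r p)) ` D"]) (use D(3) in auto)
  have "norm (F a - F b) \<le> (\<Sum>p\<in>D. M p) * norm (a - b)" if ab: "a \<in> C" "b \<in> X" "dist a b < e" for a b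
  proof -
    obtain p where p: "p \<in> D" "ball a e \<subseteq> ball p (r p)" using e ab by blast
    moreover have "a \<in> ball a e" "b \<in> ball a e" using e(1) ab by auto
    ultimately have "a \<in> ball p (r p)" "b \<in> ball p (r p)" by blast+
    then have "norm (F a - F b) \<le> M p * norm (a - b)" using ab p D C by (intro rM(3)) auto
    also have "\<dots> \<le> (\<Sum>p\<in>D. M p) * norm (a - b)"
      using p D rM(2) by (intro mult_right_mono member_le_sum) auto
    finally show ?thesis .
  qed
  moreover have "0 \<le> (\<Sum>p\<in>D. M p)" using D rM(2) by (intro sum_nonneg) auto
  ultimately show ?thesis using e(1) by blast
qed

text \<open>A first-exit argument: while the distance is below \<open>\<rho>\<close> the Lipschitz
  bound applies, and \<open>\<eta>\<close> is chosen so that Gronwall gives at most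
  \<open>\<rho> / 2\<close> at the exit time. The same \<open>\<eta>\<close> works for all
  \<open>\<tau> \<le> T\<close>, and \<open>z\<close> is only asked to exist up to
  \<open>\<tau>\<close>, because escaping solutions are compared before their lifetime is
  known.\<close>

lemma continuous_dependence:
  assumes y: "solution_on X F {0..T} y" and T: "0 \<le> T" and \<epsilon>: "0 < \<epsilon>"
  shows "\<exists>\<eta>>0. \<forall>\<tau> z. solution_on X F {0..\<tau>} z \<and> 0 \<le> \<tau> \<and> \<tau> \<le> T \<and> dist (z 0) (y 0) < \<eta> \<longrightarrow> dist (z \<tau>) (y \<tau>) < \<epsilon>"
proof -
  have "compact (y ` {0..T})"
    using solution_on_continuous[OF y] by (intro compact_continuous_image) auto
  moreover have "y ` {0..T} \<subseteq> X" using y by (auto simp: solution_on_def)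
  ultimately obtain e L where e: "0 < e" "0 \<le> L"
      "\<And>a b. \<lbrakk>a \<in> y ` {0..T}; b \<in> X; dist a b < e\<rbrakk> \<Longrightarrow> norm (F a - F b) \<le> L * norm (a - b)"
    using lipschitz_near_compact by metis
  define \<rho> where "\<rho> = min e \<epsilon>"
  define \<eta> where "\<eta> = \<rho> * exp (- (L * T)) / 2"
  have \<rho>: "0 < \<rho>" using e \<epsilon> by (simp add: \<rho>_def)
  have \<eta>: "0 < \<eta>" using \<rho> by (simp add: \<eta>_def)
  have "dist (z \<tau>) (y \<tau>) < \<rho>"
    if z: "solution_on X F {0..\<tau>} z" "0 \<le> \<tau>" "\<tau> \<le> T" "dist (z 0) (y 0) < \<eta>" for \<tau> z
  proof (rule ccontr)
    assume far: "\<not> dist (z \<tau>) (y \<tau>) < \<rho>"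
    have y\<tau>: "solution_on X F {0..\<tau>} y"
      using y by (rule solution_on_subset) (use z in auto)
    have cont: "continuous_on {0..\<tau>} (\<lambda>t. dist (z t) (y t))"
      by (intro continuous_intros solution_on_continuous[OF z(1)] solution_on_continuous[OF y\<tau>])
    define A where "A = {t\<in>{0..\<tau>}. dist (z t) (y t) \<in> {\<rho>..}}"
    have "A = {0..\<tau>} \<inter> (\<lambda>t. dist (z t) (y t)) -` {\<rho>..}" by (auto simp: A_def)
    then have "closed A"
      using continuous_closed_preimage[OF cont closed_atLeastAtMost closed_atLeast] by simp
    have A: "A \<noteq> {}" "bdd_below A" using far z by (auto simp: A_def intro!: bdd_belowI[of _ 0])
    define s where "s = Inf A"
    have sA: "s \<in> A" unfolding s_def using A \<open>closed A\<close> by (intro closed_contains_Inf)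
    then have s: "0 \<le> s" "s \<le> \<tau>" "\<rho> \<le> dist (z s) (y s)" by (auto simp: A_def)
    have before: "dist (z t) (y t) < \<rho>" if "0 \<le> t" "t < s" for t
      using cInf_lower[OF _ A(2), of t] that s by (force simp: s_def A_def)
    have "norm (z s - y s) \<le> exp (L * s) * norm (z 0 - y 0)"
    proof (rule gronwall_solutions)
      show "solution_on X F {0..s} z" "solution_on X F {0..s} y"
        using z(1) y\<tau> s by (auto intro: solution_on_subset)
      fix t assume t: "0 < t" "t < s"
      have "norm (F (y t) - F (z t)) \<le> L * norm (y t - z t)"
        using t s before[of t] z solution_on_mem[OF z(1), of t]
        by (intro e(3)) (auto simp: \<rho>_def dist_commute)
      then show "norm (F (z t) - F (y t)) \<le> L * norm (z t - y t)"
        by (simp add: norm_minus_commute)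
    qed (rule s)
    also have "\<dots> \<le> exp (L * T) * norm (z 0 - y 0)"
      using s z e by (intro mult_right_mono) (auto intro!: mult_left_mono)
    also have "\<dots> \<le> exp (L * T) * \<eta>"
      using z by (intro mult_left_mono) (auto simp: dist_norm)
    also have "\<dots> = \<rho> / 2" by (simp add: \<eta>_def exp_minus field_simps)
    finally show False using s \<rho> by (simp add: dist_norm)
  qed
  then show ?thesis using \<eta> by (intro exI[of _ \<eta>]) (auto simp: \<rho>_def)
qed

lemma solution_limit_forward:
  assumes y: "solution_on X F {0..t} y" and t: "0 \<le> t"
    and z: "\<forall>\<^sub>F i in sequentially. solution_on X F {0..t} (z i)" "(\<lambda>i. z i 0) \<longlonglongrightarrow> y 0"
  shows "(\<lambda>i. z i t) \<longlonglongrightarrow> y t"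
proof (rule tendstoI)
  fix \<epsilon> :: real assume "0 < \<epsilon>"
  then obtain \<eta> where \<eta>: "\<eta> > 0" "\<And>\<tau> z. \<lbrakk>solution_on X F {0..\<tau>} z; 0 \<le> \<tau>; \<tau> \<le> t; dist (z 0) (y 0) < \<eta>\<rbrakk> \<Longrightarrow> dist (z \<tau>) (y \<tau>) < \<epsilon>"
    using continuous_dependence[OF y t] by metis
  show "\<forall>\<^sub>F i in sequentially. dist (z i t) (y t) < \<epsilon>"
    using z(1) tendstoD[OF z(2) \<eta>(1)] by eventually_elim (use \<eta>(2) t in auto)
qed

text \<open>The moving base points \<open>s i\<close> and domains \<open>D i\<close> are there for
  limits along solutions observed at later and later times. Negative \<open>t\<close> is the forward
  case for \<open>-F\<close>.\<close>

lemma solution_limit: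
  assumes y: "solution_on X F J y" and t: "t \<in> J"
    and z: "\<forall>\<^sub>F i in sequentially. solution_on X F (D i) (z i) \<and> s i \<in> D i \<and> s i + t \<in> D i"
    and lim: "(\<lambda>i. z i (s i)) \<longlonglongrightarrow> y 0"
  shows "(\<lambda>i. z i (s i + t)) \<longlonglongrightarrow> y t"
proof (cases "0 \<le> t")
  case True
  have "\<forall>\<^sub>F i in sequentially. solution_on X F {0..t} (\<lambda>r. z i (s i + r))"
    using z
  proof eventually_elim
    case (elim i)
    then have "is_interval (D i)" by (simp add: solution_on_def)
    with elim have "(\<lambda>r. s i + r) ` {0..t} \<subseteq> D i"
      unfolding is_interval_1 by (smt (verit) atLeastAtMost_iff image_subset_iff)
    then show ?case using elim True by (intro solution_on_shift[of X F "D i"]) auto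
  qed
  then show ?thesis
    using solution_limit_forward[OF solution_on_atLeastAtMost[OF y t True] True, of "\<lambda>i r. z i (s i + r)"] lim
    by simp
next
  case False
  interpret B: regular_field X "\<lambda>x. - F x" by (rule backward)
  have "\<forall>\<^sub>F i in sequentially. solution_on X (\<lambda>x. - F x) {0..-t} (\<lambda>r. z i (s i - r))"
    using z
  proof eventually_elim
    case (elim i)
    then have "is_interval (D i)" by (simp add: solution_on_def)
    with elim have "(\<lambda>r. s i - r) ` {0..-t} \<subseteq> D i"
      unfolding is_interval_1 by (smt (verit) atLeastAtMost_iff image_subset_iff)
    then show ?case using elim False by (intro solution_on_reflect[of X F "D i"]) auto
  qed
  moreover have "solution_on X (\<lambda>x. - F x) {0..-t} (\<lambda>r. y (0 - r))"
  proof (rule solution_on_reflect[OF y])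
    have "is_interval J" "0 \<in> J" using y by (auto simp: solution_on_def)
    then show "(\<lambda>r. 0 - r) ` {0..-t} \<subseteq> J"
      using t unfolding is_interval_1 by (smt (verit) atLeastAtMost_iff image_subset_iff)
  qed (use False in auto)
  ultimately show ?thesis
    using B.solution_limit_forward[of "-t" "\<lambda>r. y (0 - r)" "\<lambda>i r. z i (s i - r)"] lim False by simp
qed

lemma solution_unique:
  assumes "solution_on X F J x" "solution_on X F J y" "x 0 = y 0" "t \<in> J"
  shows "x t = y t"
proof -
  have "0 \<in> J" using assms by (simp add: solution_on_def)
  \<comment> \<open>Uniqueness is continuous dependence for a constant sequence.\<close>
  then have "(\<lambda>i::nat. x (0 + t)) \<longlonglongrightarrow> y t"
    using solution_limit[OF assms(2,4), of "\<lambda>_. J" "\<lambda>_. x" "\<lambda>_. 0"] assms by simp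
  then show ?thesis by (simp add: LIMSEQ_const_iff)
qed

lemma uniformly_solvable:
  assumes C: "compact C" "C \<subseteq> X"
  shows "\<exists>\<delta>>0. \<forall>q\<in>C. \<exists>y. solution_on X F {0..\<delta>} y \<and> y 0 = q"
proof -
  obtain r \<delta> where r: "\<And>p. p \<in> C \<Longrightarrow> r p > 0" "\<And>p. p \<in> C \<Longrightarrow> 0 < \<delta> p"
    "\<And>p q. \<lbrakk>p \<in> C; q \<in> X \<inter> ball p (r p)\<rbrakk> \<Longrightarrow> \<exists>y. solution_on X F {0..\<delta> p::real} y \<and> y 0 = q"
    using solvable C(2) unfolding locally_solvable_def by (metis subsetD)
  obtain D where D: "D \<subseteq> C" "finite D" "C \<subseteq> (\<Union>p\<in>D. ball p (r p))"
    by (rule compactE_image[OF C(1), of C "\<lambda>p. ball p (r p)"]) (use r(1) in auto)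
  define d where "d = Min (insert 1 (\<delta> ` D))"
  have d: "0 < d" "\<And>p. p \<in> D \<Longrightarrow> d \<le> \<delta> p"
    using D r(2) by (auto simp: d_def)
  have "\<exists>y. solution_on X F {0..d} y \<and> y 0 = q" if q: "q \<in> C" for q
  proof -
    obtain p where p: "p \<in> D" "q \<in> ball p (r p)" using D q by blast
    then obtain y where "solution_on X F {0..\<delta> p} y" "y 0 = q"
      using r(3)[of p q] D q C by auto
    then show ?thesis
      using d(1) d(2)[OF p(1)] by (intro exI[of _ y]) (auto intro: solution_on_subset)
  qed
  then show ?thesis using d(1) by blast
qed

text \<open>As the end point of every solution from \<open>x0\<close> lies in the compact set
  \<open>C\<close>, continuation proceeds in steps of one fixed length \<open>\<delta>\<close>;
  uniqueness makes the resulting solutions agree, so they can be glued.\<close>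

lemma solution_extends:
  assumes C: "compact C" "C \<subseteq> X" and "x0 \<in> X"
    and confined: "\<And>\<tau> x. \<lbrakk>0 \<le> \<tau>; solution_on X F {0..\<tau>} x; x 0 = x0\<rbrakk> \<Longrightarrow> x \<tau> \<in> C"
  shows "\<exists>x. solution_on X F {0..} x \<and> x 0 = x0"
proof -
  obtain d y where y: "0 < d" "solution_on X F {0..d} y" "y 0 = x0"
    using solvable_at[OF \<open>x0 \<in> X\<close>] by blast
  have "solution_on X F {0..0} y"
    by (rule solution_on_atLeastAtMost[OF y(2)]) (use y in auto)
  then have x0: "x0 \<in> C"
    using confined[of 0 y] y by simp
  obtain \<delta> where \<delta>: "0 < \<delta>" "\<And>q. q \<in> C \<Longrightarrow> \<exists>y. solution_on X F {0..\<delta>} y \<and> y 0 = q"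
    using uniformly_solvable[OF C] by blast
  have "\<exists>x. solution_on X F {0..real n * \<delta>} x \<and> x 0 = x0" for n
  proof (induction n)
    case 0
    obtain y where "solution_on X F {0..\<delta>} y" "y 0 = x0" using \<delta>(2)[OF x0] by blast
    then have "solution_on X F {0..real 0 * \<delta>} y"
      using \<delta>(1) by (elim solution_on_atLeastAtMost) auto
    with \<open>y 0 = x0\<close> show ?case by blast
  next
    case (Suc n)
    then obtain x where x: "solution_on X F {0..real n * \<delta>} x" "x 0 = x0" by blast
    then have "x (real n * \<delta>) \<in> C" using \<delta>(1) by (intro confined) auto
    then obtain y where y: "solution_on X F {0..\<delta>} y" "y 0 = x (real n * \<delta>)" using \<delta>(2) by blast
    let ?z = "\<lambda>t. if t \<in> {0..real n * \<delta>} then x t else y (t - real n * \<delta>)"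
    have "solution_on X F {0..real n * \<delta> + \<delta>} ?z"
      by (rule solution_on_append[OF x(1) y]) (use \<delta>(1) in auto)
    moreover have "real n * \<delta> + \<delta> = real (Suc n) * \<delta>" by (simp add: algebra_simps)
    ultimately have z: "solution_on X F {0..real (Suc n) * \<delta>} ?z" by (simp only:)
    have z0: "?z 0 = x0" using x(2) \<delta>(1) by simp
    show ?case by (rule exI[of _ ?z], rule conjI[OF z z0])
  qed
  then have "\<forall>n. \<exists>x. solution_on X F {0..real n * \<delta>} x \<and> x 0 = x0" ..
  from choice[OF this] obtain \<xi> where
      \<xi>: "\<And>n. solution_on X F {0..real n * \<delta>} (\<xi> n)" "\<And>n. \<xi> n 0 = x0"
    by blast
  define N where "N t = nat \<lceil>t / \<delta>\<rceil>" for t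
  have N: "t \<le> real (N t) * \<delta>" for t
    using \<delta>(1) of_nat_ceiling[of "t / \<delta>"] by (simp add: N_def pos_divide_le_eq)
  define x where "x t = \<xi> (N t) t" for t
  have agree: "x t = \<xi> n t" if "t \<in> {0..real n * \<delta>}" for t n
    unfolding x_def
  proof (rule solution_unique[of "{0..t}" "\<xi> (N t)" "\<xi> n" t])
    show "solution_on X F {0..t} (\<xi> (N t))" "solution_on X F {0..t} (\<xi> n)"
      using that N[of t] by (auto intro: solution_on_atLeastAtMost[OF \<xi>(1)])
  qed (use that \<xi>(2) in auto)
  have "solution_on X F {0..} x"
    unfolding solution_on_def
  proof (intro conjI ballI)
    show "x ` {0..} \<subseteq> X"
      using N solution_on_mem[OF \<xi>(1)] by (auto simp: x_def)
    fix t :: real assume t: "t \<in> {0..}"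
    \<comment> \<open>The successor puts \<open>t\<close> strictly before the end of the interval,
      so that derivatives within it and within the half-line coincide.\<close>
    define n where "n = Suc (N t)"
    have n: "t < real n * \<delta>"
      using N[of t] \<delta>(1) by (simp add: n_def algebra_simps)
    have "(x has_vector_derivative F (\<xi> n t)) (at t within {0..real n * \<delta>})"
    proof (rule has_vector_derivative_transform)
      show tn: "t \<in> {0..real n * \<delta>}" using t n by auto
      show "(\<xi> n has_vector_derivative F (\<xi> n t)) (at t within {0..real n * \<delta>})"
        by (rule solution_on_derivative[OF \<xi>(1) tn])
    qed (rule agree)
    moreover have "at t within {0..real n * \<delta>} = at t within {0..}"
      by (rule at_within_nhd[of t "{..<real n * \<delta>}"]) (use n in auto)
    ultimately show "(x has_vector_derivative F (x t)) (at t within {0..})"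
      using agree[of t n] t n by simp
  qed (auto simp: is_interval_ci)
  moreover have "x 0 = x0" using agree[of 0 0] \<xi> by simp
  ultimately show ?thesis by blast
qed

end

section \<open>Invariant sets\<close>

lemma invariant_mem: "\<lbrakk>invariant X F S; solution_on X F J x; x 0 \<in> S; t \<in> J\<rbrakk> \<Longrightarrow> x t \<in> S"
  unfolding invariant_def reach_def by blast

text \<open>Negative times become positive times of the reversed field, so an invariance proof can
  be done on intervals starting at 0 and applied to \<open>F\<close> and to
  \<open>-F\<close>.\<close>

lemma invariant_iff_forward_backward:
  "invariant X F S \<longleftrightarrow>
    (\<forall>\<tau>\<ge>0. \<forall>w. solution_on X F {0..\<tau>} w \<and> w 0 \<in> S \<longrightarrow> w \<tau> \<in> S) \<and>
    (\<forall>\<tau>\<ge>0. \<forall>w. solution_on X (\<lambda>x. - F x) {0..\<tau>} w \<and> w 0 \<in> S \<longrightarrow> w \<tau> \<in> S)"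
    (is "_ \<longleftrightarrow> ?fwd \<and> ?bwd")
proof
  assume inv: "invariant X F S"
  have "w \<tau> \<in> S" if "0 \<le> \<tau>" "solution_on X F {0..\<tau>} w" "w 0 \<in> S" for \<tau> w
    using invariant_mem[OF inv that(2,3), of \<tau>] that(1) by simp
  moreover have "w \<tau> \<in> S"
    if \<tau>: "0 \<le> \<tau>" and w: "solution_on X (\<lambda>x. - F x) {0..\<tau>} w" "w 0 \<in> S" for \<tau> w
  proof -
    have "solution_on X (\<lambda>x. - (- F x)) {-\<tau>..0} (\<lambda>r. w (0 - r))"
      by (rule solution_on_reflect[OF w(1)]) (use \<tau> in auto)
    then have "solution_on X F {-\<tau>..0} (\<lambda>r. w (0 - r))" by simp
    from invariant_mem[OF inv this, of "-\<tau>"] show ?thesis using w(2) \<tau> by simp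
  qed
  ultimately show "?fwd \<and> ?bwd" by blast
next
  assume fb: "?fwd \<and> ?bwd"
  have "x t \<in> S" if x: "solution_on X F J x" "x 0 \<in> S" "t \<in> J" for J x t
  proof (cases "0 \<le> t")
    case True
    then show ?thesis using fb x(2) solution_on_atLeastAtMost[OF x(1,3)] by blast
  next
    case False
    have "is_interval J" "0 \<in> J" using x(1) by (auto simp: solution_on_def)
    then have "(\<lambda>r. 0 - r) ` {0..-t} \<subseteq> J"
      using x(3) mem_is_interval_1_I[of J t 0] by auto
    then have "solution_on X (\<lambda>x. - F x) {0..-t} (\<lambda>r. x (0 - r))"
      by (rule solution_on_reflect[OF x(1)]) (use False in auto)
    then show ?thesis using conjunct2[OF fb, rule_format, of "-t" "\<lambda>r. x (0 - r)"] x(2) False by simp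
  qed
  then show "invariant X F S" unfolding invariant_def reach_def by blast
qed

lemma invariant_backward: "invariant X F S \<Longrightarrow> invariant X (\<lambda>x. - F x) S"
  unfolding invariant_iff_forward_backward minus_minus by (rule conj_commute[THEN iffD1])

lemma solution_on_field_cong:
  assumes "solution_on X F J x" "\<And>t. t \<in> J \<Longrightarrow> F (x t) = G (x t)"
  shows "solution_on X G J x"
  using assms unfolding solution_on_def by metis

lemma invariant_zero_output_set: "invariant X F (zero_output_set X F h)"
  unfolding invariant_def
proof
  fix y assume "y \<in> reach X F UNIV (zero_output_set X F h)"
  then obtain J x t where x: "solution_on X F J x" "x 0 \<in> zero_output_set X F h" "t \<in> J" "y = x t"
    unfolding reach_def by blast
  then obtain S where "S \<subseteq> {x\<in>X. h x = 0}" "invariant X F S" "x 0 \<in> S"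
    unfolding zero_output_set_def by blast
  then show "y \<in> zero_output_set X F h"
    using invariant_mem[of X F S J x t] x unfolding zero_output_set_def by blast
qed

lemma zero_output_set_subset: "zero_output_set X F h \<subseteq> {x\<in>X. h x = 0}"
  unfolding zero_output_set_def by blast

text \<open>The full orbit of \<open>q\<close>, in both time directions, lies in \<open>P\<close>.
  Quantifying over all solution pieces replaces a maximal solution.\<close>

definition orbit_in :: "'a::euclidean_space set \<Rightarrow> ('a \<Rightarrow> 'a) \<Rightarrow> ('a \<Rightarrow> bool) \<Rightarrow> 'a \<Rightarrow> bool" where
  "orbit_in X F P q \<longleftrightarrow>
    (\<forall>\<tau>\<ge>0. \<forall>w. solution_on X F {0..\<tau>} w \<and> w 0 = q \<longrightarrow> P (w \<tau>)) \<and>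
    (\<forall>\<tau>\<ge>0. \<forall>w. solution_on X (\<lambda>x. - F x) {0..\<tau>} w \<and> w 0 = q \<longrightarrow> P (w \<tau>))"

context regular_field
begin

text \<open>A forward piece from \<open>w t\<close> is appended to \<open>w\<close>. A backward
  piece retraces \<open>w\<close> by uniqueness, and after time \<open>t\<close> continues as a
  backward solution from \<open>q\<close>.\<close>

lemma orbit_in_forward:
  assumes q: "orbit_in X F P q" and w: "solution_on X F {0..t} w" "w 0 = q" and t: "0 \<le> t"
  shows "orbit_in X F P (w t)"
proof -
  interpret B: regular_field X "\<lambda>x. - F x" by (rule backward)
  have fwd: "P (v \<tau>)" if "0 \<le> \<tau>" "solution_on X F {0..\<tau>} v" "v 0 = q" for \<tau> v
    using q that unfolding orbit_in_def by blast
  have bwd: "P (v \<tau>)" if "0 \<le> \<tau>" "solution_on X (\<lambda>x. - F x) {0..\<tau>} v" "v 0 = q" for \<tau> v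
    using q that unfolding orbit_in_def by blast
  have "P (v \<tau>)" if \<tau>: "0 \<le> \<tau>" and v: "solution_on X F {0..\<tau>} v" "v 0 = w t" for \<tau> v
  proof -
    let ?u = "\<lambda>s. if s \<in> {0..t} then w s else v (s - t)"
    have "solution_on X F {0..t + \<tau>} ?u" using w(1) v t \<tau> by (rule solution_on_append)
    moreover have "?u 0 = q" using w t by simp
    ultimately have "P (?u (t + \<tau>))" using t \<tau> by (intro fwd) auto
    \<comment> \<open>At \<open>\<tau> = 0\<close> the conditional still selects \<open>w t\<close>,
      which equals \<open>v 0\<close>.\<close>
    moreover have "?u (t + \<tau>) = v \<tau>" using v \<tau> by (cases "\<tau> = 0") auto
    ultimately show ?thesis by simp
  qed
  moreover have "P (v \<tau>)"
    if \<tau>: "0 \<le> \<tau>" and v: "solution_on X (\<lambda>x. - F x) {0..\<tau>} v" "v 0 = w t" for \<tau> v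
  proof -
    have rw: "solution_on X (\<lambda>x. - F x) {0..t} (\<lambda>r. w (t - r))"
      by (rule solution_on_reflect[OF w(1)]) (use t in auto)
    have eq: "v r = w (t - r)" if "0 \<le> r" "r \<le> t" "r \<le> \<tau>" for r
    proof (rule B.solution_unique[of "{0..r}" v "\<lambda>r. w (t - r)" r])
      show "solution_on X (\<lambda>x. - F x) {0..r} v"
        by (rule solution_on_atLeastAtMost[OF v(1)]) (use that in auto)
      show "solution_on X (\<lambda>x. - F x) {0..r} (\<lambda>r. w (t - r))"
        by (rule solution_on_atLeastAtMost[OF rw]) (use that in auto)
    qed (use v that in auto)
    show ?thesis
    proof (cases "\<tau> \<le> t")
      case True
      have "solution_on X F {0..t - \<tau>} w"
        by (rule solution_on_atLeastAtMost[OF w(1)]) (use True \<tau> in auto)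
      then have "P (w (t - \<tau>))" using w(2) True by (intro fwd) auto
      then show ?thesis using eq[of \<tau>] \<tau> True by simp
    next
      case False
      have "solution_on X (\<lambda>x. - F x) {0..\<tau> - t} (\<lambda>r. v (t + r))"
        by (rule solution_on_shift[OF v(1)]) (use False t in auto)
      moreover have "v (t + 0) = q" using eq[of t] t w(2) False by simp
      ultimately have "P (v (t + (\<tau> - t)))"
        using False by (intro bwd[of "\<tau> - t" "\<lambda>r. v (t + r)"]) auto
      then show ?thesis by simp
    qed
  qed
  ultimately show ?thesis unfolding orbit_in_def by blast
qed

lemma invariant_orbit_in: "invariant X F {q\<in>X. orbit_in X F P q}"
proof -
  interpret B: regular_field X "\<lambda>x. - F x" by (rule backward)
  have sym: "orbit_in X (\<lambda>x. - F x) P q \<longleftrightarrow> orbit_in X F P q" for q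
    unfolding orbit_in_def by auto
  have "w \<tau> \<in> {q\<in>X. orbit_in X F P q}"
    if "0 \<le> \<tau>" "solution_on X F {0..\<tau>} w" "w 0 \<in> {q\<in>X. orbit_in X F P q}" for \<tau> w
    using orbit_in_forward[of P "w 0" \<tau> w] solution_on_mem[OF that(2), of \<tau>] that by simp
  moreover have "w \<tau> \<in> {q\<in>X. orbit_in X F P q}"
    if "0 \<le> \<tau>" "solution_on X (\<lambda>x. - F x) {0..\<tau>} w" "w 0 \<in> {q\<in>X. orbit_in X F P q}" for \<tau> w
    using B.orbit_in_forward[of P "w 0" \<tau> w] solution_on_mem[OF that(2), of \<tau>] that by (simp add: sym)
  ultimately show ?thesis
    unfolding invariant_iff_forward_backward by blast
qed

text \<open>A solution of \<open>G\<close> from \<open>S\<close> is not known in advance to stay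
  where the fields agree. Let \<open>s\<close> be its first exit time from \<open>S\<close>. Up to
  \<open>s\<close> it is a solution of \<open>F\<close>, so its point at time \<open>s\<close> is in
  \<open>S\<close>. The solution of \<open>F\<close> from there stays in \<open>S\<close>, hence
  solves \<open>G\<close> too and, by uniqueness, continues the given one inside \<open>S\<close>
  beyond \<open>s\<close>.\<close>

lemma invariant_transfer_forward:
  assumes G: "regular_field X G" and S: "invariant X F S" "S \<subseteq> Z"
    and Z: "closedin (top_of_set X) Z" and eq: "\<And>x. x \<in> Z \<Longrightarrow> F x = G x"
    and z: "solution_on X G {0..T} z" "z 0 \<in> S" and T: "0 \<le> T"
  shows "z T \<in> S"
proof (rule ccontr)
  interpret G: regular_field X G by (rule G)
  assume out: "z T \<notin> S"
  define A where "A = {t\<in>{0..T}. z t \<notin> S}"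
  have A: "A \<noteq> {}" "bdd_below A" using out T by (auto simp: A_def intro!: bdd_belowI[of _ 0])
  define s where "s = Inf A"
  have s0: "0 \<le> s"
    unfolding s_def using A(1) by (intro cInf_greatest) (auto simp: A_def)
  have sT: "s \<le> T"
    unfolding s_def using A(2) out T by (intro cInf_lower) (auto simp: A_def)
  have before: "z t \<in> S" if "0 \<le> t" "t < s" for t
    using cInf_lower[OF _ A(2), of t] that sT by (force simp: s_def A_def)
  have zs: "solution_on X G {0..s} z"
    by (rule solution_on_atLeastAtMost[OF z(1)]) (use s0 sT in auto)
  have "z s \<in> S"
  proof (cases "s = 0")
    case False
    \<comment> \<open>\<open>S\<close> may fail to be closed; it is closedness of \<open>Z\<close>
      in \<open>X\<close> that includes the end time \<open>s\<close>.\<close>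
    have inZ: "z t \<in> Z" if "t \<in> {0..s}" for t
    proof -
      obtain W where W: "closed W" "Z = X \<inter> W" using Z by (auto simp: closedin_closed)
      have "z ` closure {0..<s} \<subseteq> W"
      proof (rule image_closure_subset)
        show "continuous_on (closure {0..<s}) z"
          using solution_on_continuous[OF zs] False s0 by simp
        show "z ` {0..<s} \<subseteq> W" using before S(2) W by auto
      qed (rule W)
      then have "z t \<in> W" using that False s0 by auto
      then show ?thesis using W solution_on_mem[OF zs that] by simp
    qed
    have "solution_on X F {0..s} z"
      by (rule solution_on_field_cong[OF zs]) (use eq inZ in auto)
    then show ?thesis by (rule invariant_mem[OF S(1)]) (use z s0 in auto)
  qed (use z in simp)
  have "z s \<in> X" using solution_on_mem[OF zs, of s] s0 by simp
  then obtain \<delta> y where y: "0 < \<delta>" "solution_on X F {0..\<delta>} y" "y 0 = z s"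
    by (rule solvable_at)
  have yS: "y r \<in> S" if "r \<in> {0..\<delta>}" for r
    by (rule invariant_mem[OF S(1) y(2)]) (use y \<open>z s \<in> S\<close> that in auto)
  have yG: "solution_on X G {0..\<delta>} y"
    by (rule solution_on_field_cong[OF y(2)]) (use yS S(2) eq in auto)
  have after: "z t \<in> S" if t: "s \<le> t" "t \<le> T" "t \<le> s + \<delta>" for t
  proof -
    have "z (s + (t - s)) = y (t - s)"
    proof (rule G.solution_unique[of "{0..t - s}" "\<lambda>r. z (s + r)" y])
      show "solution_on X G {0..t - s} (\<lambda>r. z (s + r))"
        by (rule solution_on_shift[OF z(1)]) (use s0 t in auto)
      show "solution_on X G {0..t - s} y"
        by (rule solution_on_atLeastAtMost[OF yG]) (use t in auto)
    qed (use y t in auto)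
    then show ?thesis using yS[of "t - s"] t by simp
  qed
  have "s + \<delta> \<le> a" if "a \<in> A" for a
  proof (rule ccontr)
    assume "\<not> s + \<delta> \<le> a"
    with that before[of a] after[of a] show False by (cases "a < s") (auto simp: A_def)
  qed
  then have "s + \<delta> \<le> Inf A" using A(1) by (intro cInf_greatest)
  then show False using y(1) by (simp add: s_def)
qed

lemma invariant_transfer:
  assumes G: "regular_field X G" and S: "invariant X F S" "S \<subseteq> Z"
    and Z: "closedin (top_of_set X) Z" and eq: "\<And>x. x \<in> Z \<Longrightarrow> F x = G x"
  shows "invariant X G S"
proof -
  interpret B: regular_field X "\<lambda>x. - F x" by (rule backward)
  have "w \<tau> \<in> S" if "0 \<le> \<tau>" "solution_on X G {0..\<tau>} w" "w 0 \<in> S" for \<tau> w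
    using invariant_transfer_forward[OF G S Z eq that(2,3,1)] .
  moreover have "w \<tau> \<in> S" if "0 \<le> \<tau>" "solution_on X (\<lambda>x. - G x) {0..\<tau>} w" "w 0 \<in> S" for \<tau> w
    by (rule B.invariant_transfer_forward[OF regular_field.backward[OF G] invariant_backward[OF S(1)]
          S(2) Z _ that(2,3,1)]) (simp add: eq)
  ultimately show ?thesis unfolding invariant_iff_forward_backward by blast
qed

end

lemma zero_output_set_cong:
  assumes F: "regular_field X F" and G: "regular_field X G"
    and Z: "closedin (top_of_set X) {x\<in>X. h x = 0}" and eq: "\<And>x. \<lbrakk>x \<in> X; h x = 0\<rbrakk> \<Longrightarrow> F x = G x"
  shows "zero_output_set X F h = zero_output_set X G h"
proof -
  have eqZ: "F x = G x" if "x \<in> {x\<in>X. h x = 0}" for x using that eq by blast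
  have "invariant X F S \<longleftrightarrow> invariant X G S" if "S \<subseteq> {x\<in>X. h x = 0}" for S
    using regular_field.invariant_transfer[OF F G _ that Z eqZ]
      regular_field.invariant_transfer[OF G F _ that Z eqZ[symmetric]] by blast
  then show ?thesis unfolding zero_output_set_def by (metis (no_types, lifting))
qed

text \<open>Solutions starting in \<open>A\<close> stay in \<open>A\<close>, where the fields agree,
  so both fields have the same solutions from \<open>A\<close>.\<close>

lemma
  assumes F: "invariant X F A" and G: "invariant X G A" and eq: "\<And>x. x \<in> A \<Longrightarrow> F x = G x"
  shows stable_rel_cong_invariant: "stable_rel X F A \<Gamma> \<longleftrightarrow> stable_rel X G A \<Gamma>"
    and attractive_rel_cong_invariant: "attractive_rel X F A \<Gamma> \<longleftrightarrow> attractive_rel X G A \<Gamma>"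
    and attracted_cong_invariant: "attracted X F A \<Gamma> \<longleftrightarrow> attracted X G A \<Gamma>"
proof -
  have sol: "solution_on X F J x \<longleftrightarrow> solution_on X G J x" if "x 0 \<in> A" for J x
  proof
    assume sol: "solution_on X F J x"
    show "solution_on X G J x"
      by (rule solution_on_field_cong[OF sol eq]) (rule invariant_mem[OF F sol that])
  next
    assume sol: "solution_on X G J x"
    show "solution_on X F J x"
      by (rule solution_on_field_cong[OF sol eq[symmetric]]) (rule invariant_mem[OF G sol that])
  qed
  have fc: "forward_complete X F S \<longleftrightarrow> forward_complete X G S" if "S \<subseteq> A" for S
    unfolding forward_complete_def by (intro ball_cong refl ex_cong1) (use sol that in auto)
  have re: "reach X F I S = reach X G I S" if "S \<subseteq> A" for S I
    unfolding reach_def by (intro Collect_cong ex_cong1) (use sol that in blast)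
  have at: "attracted X F S \<Gamma> \<longleftrightarrow> attracted X G S \<Gamma>" if S: "S \<subseteq> A" for S
    unfolding attracted_def fc[OF S]
    by (intro arg_cong2[where f = "(\<and>)"] refl all_cong1) (use sol S in blast)
  show "stable_rel X F A \<Gamma> \<longleftrightarrow> stable_rel X G A \<Gamma>"
    unfolding stable_rel_def by (simp add: fc re)
  show "attractive_rel X F A \<Gamma> \<longleftrightarrow> attractive_rel X G A \<Gamma>"
    unfolding attractive_rel_def by (simp add: at)
  show "attracted X F A \<Gamma> \<longleftrightarrow> attracted X G A \<Gamma>" by (simp add: at)
qed

lemma attracted_subset: "attracted X F B \<Gamma> \<Longrightarrow> A \<subseteq> B \<Longrightarrow> attracted X F A \<Gamma>"
  unfolding attracted_def forward_complete_def by blast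

lemma attractive_rel_subset:
  assumes "attractive_rel X F B \<Gamma>" "A \<subseteq> B"
  shows "attractive_rel X F A \<Gamma>"
proof -
  obtain N where "open_nbhd X \<Gamma> N" "attracted X F (N \<inter> B) \<Gamma>"
    using assms(1) unfolding attractive_rel_def by blast
  then show ?thesis
    using attracted_subset[of X F "N \<inter> B" \<Gamma> "N \<inter> A"] assms(2) unfolding attractive_rel_def by blast
qed

lemma stable_rel_subset:
  assumes "stable_rel X F B \<Gamma>" "A \<subseteq> B"
  shows "stable_rel X F A \<Gamma>"
  unfolding stable_rel_def
proof (intro allI impI)
  fix \<epsilon> :: real assume "0 < \<epsilon>"
  then obtain N where N: "open_nbhd X \<Gamma> N" "forward_complete X F (N \<inter> B)"
      "reach X F {0..} (N \<inter> B) \<subseteq> set_ball X \<Gamma> \<epsilon>"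
    using assms(1) unfolding stable_rel_def by blast
  have "forward_complete X F (N \<inter> A)"
    using N(2) assms(2) unfolding forward_complete_def by blast
  moreover have "reach X F {0..} (N \<inter> A) \<subseteq> reach X F {0..} (N \<inter> B)"
    using assms(2) unfolding reach_def by blast
  ultimately show "\<exists>N. open_nbhd X \<Gamma> N \<and> forward_complete X F (N \<inter> A) \<and>
      reach X F {0..} (N \<inter> A) \<subseteq> set_ball X \<Gamma> \<epsilon>"
    using N by blast
qed

section \<open>Dissipation and limit points\<close>

lemma in_closedin_infdist_zero:
  assumes \<Gamma>: "closedin (top_of_set X) \<Gamma>" "\<Gamma> \<noteq> {}" and c: "c \<in> X" "infdist c \<Gamma> = 0"
  shows "c \<in> \<Gamma>"
proof -
  obtain W where W: "closed W" "\<Gamma> = X \<inter> W" using \<Gamma>(1) by (auto simp: closedin_closed)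
  have "c \<in> closure \<Gamma>" using in_closure_iff_infdist_zero[OF \<Gamma>(2)] c(2) by simp
  moreover have "closure \<Gamma> \<subseteq> W" by (rule closure_minimal) (use W in auto)
  ultimately show ?thesis using W c by blast
qed

text \<open>On the compact part of \<open>K\<close> outside the neighbourhood the distance to
  \<open>\<Gamma>\<close> has a positive minimum. This is the local substitute for a uniform
  tube.\<close>

lemma open_nbhd_on_compact:
  assumes K: "compact K" "K \<subseteq> X" and \<Gamma>: "closedin (top_of_set X) \<Gamma>" "\<Gamma> \<noteq> {}"
    and N: "open_nbhd X \<Gamma> N"
  shows "\<exists>\<rho>>0. \<forall>c\<in>K. infdist c \<Gamma> \<le> \<rho> \<longrightarrow> c \<in> N"
proof -
  obtain W where W: "open W" "N = X \<inter> W" and N\<Gamma>: "\<Gamma> \<subseteq> N"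
    using N unfolding open_nbhd_def by (auto simp: openin_open)
  show ?thesis
  proof (cases "K - W = {}")
    case True
    then have "\<forall>c\<in>K. c \<in> N" using K(2) W by blast
    then show ?thesis using zero_less_one by blast
  next
    case False
    have "compact (K - W)" using K(1) W(1) by (rule compact_diff)
    moreover have "continuous_on (K - W) (\<lambda>y. infdist y \<Gamma>)" by (intro continuous_intros)
    ultimately obtain c where c: "c \<in> K - W" "\<And>y. y \<in> K - W \<Longrightarrow> infdist c \<Gamma> \<le> infdist y \<Gamma>"
      using continuous_attains_inf[of "K - W" "\<lambda>y. infdist y \<Gamma>"] False by blast
    have "infdist c \<Gamma> \<noteq> 0"
      using in_closedin_infdist_zero[OF \<Gamma>, of c] c(1) K(2) N\<Gamma> W by blast
    then have "0 < infdist c \<Gamma> / 2" using infdist_nonneg[of c \<Gamma>] by simp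
    moreover have "y \<in> N" if "y \<in> K" "infdist y \<Gamma> \<le> infdist c \<Gamma> / 2" for y
      using c(2)[of y] that K(2) W \<open>0 < infdist c \<Gamma> / 2\<close> by force
    ultimately show ?thesis by blast
  qed
qed

text \<open>The order of choice matters: \<open>t\<close> is the first time at level
  \<open>b\<close>, which keeps the function below \<open>b\<close> on all of \<open>{0..t}\<close>,
  and only then \<open>s\<close> is the last time up to \<open>t\<close> at level \<open>a\<close>,
  which keeps it above \<open>a\<close> in between.\<close>

lemma last_and_first_crossing:
  fixes \<phi> :: "real \<Rightarrow> real"
  assumes cont: "continuous_on {0..\<tau>} \<phi>" and \<tau>: "0 \<le> \<tau>" and ab: "\<phi> 0 < a" "a < b" "b \<le> \<phi> \<tau>"
  shows "\<exists>s t. 0 \<le> s \<and> s \<le> t \<and> t \<le> \<tau> \<and> \<phi> s = a \<and> \<phi> t = b \<and>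
    (\<forall>r\<in>{0..t}. \<phi> r \<le> b) \<and> (\<forall>r\<in>{s..t}. a \<le> \<phi> r)"
proof -
  define B where "B = {0..\<tau>} \<inter> \<phi> -` {b..}"
  have B: "closed B" "B \<noteq> {}" "bdd_below B"
    unfolding B_def using continuous_closed_preimage[OF cont closed_atLeastAtMost closed_atLeast] \<tau> ab
    by (auto intro!: bdd_belowI[of _ 0])
  define t where "t = Inf B"
  have tB: "t \<in> B" unfolding t_def using B by (intro closed_contains_Inf)
  then have t: "0 \<le> t" "t \<le> \<tau>" "b \<le> \<phi> t" by (auto simp: B_def)
  have before: "\<phi> r < b" if "0 \<le> r" "r < t" for r
    using cInf_lower[OF _ B(3), of r] that t by (force simp: t_def B_def)
  have cont_t: "continuous_on {0..t} \<phi>"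
    by (rule continuous_on_subset[OF cont]) (use t in auto)
  have \<phi>t: "\<phi> t = b"
  proof -
    obtain r where r: "0 \<le> r" "r \<le> t" "\<phi> r = b"
      using IVT'[of \<phi> 0 b t] cont_t t ab by auto
    then show ?thesis using before[of r] by (cases "r = t") auto
  qed
  define A where "A = {0..t} \<inter> \<phi> -` {..a}"
  have A: "closed A" "A \<noteq> {}" "bdd_above A"
    unfolding A_def using continuous_closed_preimage[OF cont_t closed_atLeastAtMost closed_atMost] t ab
    by (auto intro!: bdd_aboveI[of _ t])
  define s where "s = Sup A"
  have "s \<in> A" unfolding s_def using A by (intro closed_contains_Sup)
  then have s: "0 \<le> s" "s \<le> t" "\<phi> s \<le> a" by (auto simp: A_def)
  have after: "a < \<phi> r" if "s < r" "r \<le> t" for r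
    using cSup_upper[OF _ A(3), of r] that s by (force simp: s_def A_def)
  have \<phi>s: "\<phi> s = a"
  proof -
    have "continuous_on {s..t} \<phi>"
      by (rule continuous_on_subset[OF cont_t]) (use s in auto)
    then obtain r where r: "s \<le> r" "r \<le> t" "\<phi> r = a"
      using IVT'[of \<phi> s a t] s ab \<phi>t by auto
    then show ?thesis using after[of r] by (cases "r = s") auto
  qed
  have "\<phi> r \<le> b" if "r \<in> {0..t}" for r
    using before[of r] \<phi>t that by (cases "r = t") auto
  moreover have "a \<le> \<phi> r" if "r \<in> {s..t}" for r
    using after[of r] \<phi>s that by (cases "r = s") auto
  ultimately show ?thesis using s t \<phi>s \<phi>t by blast
qed

text \<open>\<open>k\<close> is the dissipated power \<open>h x \<bullet> \<phi> x\<close> of the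
  closed loop, whose zeros are those of \<open>h\<close>. Dissipation is recorded in integrated
  form, as passivity provides it.\<close>

locale passive_field = regular_field X F for X :: "'a::euclidean_space set" and F +
  fixes V k :: "'a \<Rightarrow> real"
  assumes cont_V: "continuous_on X V" and V_nonneg: "\<And>x. x \<in> X \<Longrightarrow> 0 \<le> V x"
    and cont_k: "continuous_on X k" and k_nonneg: "\<And>x. x \<in> X \<Longrightarrow> 0 \<le> k x"
    and dissipation: "\<And>\<tau> z. \<lbrakk>0 \<le> \<tau>; solution_on X F {0..\<tau>} z\<rbrakk> \<Longrightarrow>
      V (z \<tau>) - V (z 0) \<le> - integral {0..\<tau>} (\<lambda>s. k (z s))"
begin

abbreviation \<O> :: "'a set" where "\<O> \<equiv> zero_output_set X F k"

lemma continuous_on_k_solution: "solution_on X F J z \<Longrightarrow> continuous_on J (\<lambda>s. k (z s))"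
  by (rule continuous_on_compose2[OF cont_k solution_on_continuous]) (auto simp: solution_on_def)

lemma V_nonincreasing:
  assumes z: "solution_on X F J z" and st: "s \<in> J" "t \<in> J" "s \<le> t"
  shows "V (z t) \<le> V (z s)"
proof -
  have "is_interval J" using z by (simp add: solution_on_def)
  then have "(\<lambda>r. s + r) ` {0..t - s} \<subseteq> J"
    using st mem_is_interval_1_I[of J s t] by auto
  then have w: "solution_on X F {0..t - s} (\<lambda>r. z (s + r))"
    by (rule solution_on_shift[OF z]) (use st in auto)
  have "0 \<le> integral {0..t - s} (\<lambda>r. k (z (s + r)))"
    by (intro integral_nonneg integrable_continuous_real continuous_on_k_solution[OF w] k_nonneg
        solution_on_mem[OF w])
  then show ?thesis using dissipation[OF _ w] st by simp
qed

text \<open>Along a short solution from \<open>q\<close> the integral of the continuous nonnegative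
  function \<open>k\<close> is zero, so \<open>k\<close> is zero along it, including at its
  start.\<close>

lemma k_zero_if_V_constant:
  assumes q: "q \<in> X" and const: "\<And>\<tau> w. \<lbrakk>0 \<le> \<tau>; solution_on X F {0..\<tau>} w; w 0 = q\<rbrakk> \<Longrightarrow> V (w \<tau>) = c"
  shows "k q = 0"
proof -
  obtain \<delta> y where y: "0 < \<delta>" "solution_on X F {0..\<delta>} y" "y 0 = q"
    using solvable_at[OF q] by blast
  have "solution_on X F {0..0} y"
    by (rule solution_on_atLeastAtMost[OF y(2)]) (use y in auto)
  then have "V (y 0) = c" by (rule const[OF order_refl]) (rule y)
  moreover have "V (y \<delta>) = c" using y by (intro const) auto
  ultimately have "integral {0..\<delta>} (\<lambda>s. k (y s)) \<le> 0"
    using dissipation[OF _ y(2)] y(1) by simp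
  moreover have nonneg: "0 \<le> k (y s)" if "s \<in> {0..\<delta>}" for s
    by (rule k_nonneg[OF solution_on_mem[OF y(2) that]])
  then have "0 \<le> integral {0..\<delta>} (\<lambda>s. k (y s))"
    by (intro integral_nonneg integrable_continuous_real continuous_on_k_solution[OF y(2)])
  ultimately have "integral {0..\<delta>} (\<lambda>s. k (y s)) = 0" by simp
  then have "\<forall>s\<in>{0..\<delta>}. k (y s) = 0"
    using integral_eq_0_iff[OF continuous_on_k_solution[OF y(2)] y(1) nonneg] by blast
  then show ?thesis using y by auto
qed

text \<open>The points on whose whole orbit \<open>V\<close> equals \<open>c\<close> form an
  invariant set, and \<open>k\<close> vanishes on it; it is therefore one of the sets whose union is
  \<open>\<O>\<close>.\<close>

lemma constant_V_in_zero_output_set: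
  assumes "q \<in> X" "orbit_in X F (\<lambda>x. V x = c) q"
  shows "q \<in> \<O>"
proof -
  let ?S = "{q\<in>X. orbit_in X F (\<lambda>x. V x = c) q}"
  have "k p = 0" if "p \<in> ?S" for p
    using that unfolding orbit_in_def by (intro k_zero_if_V_constant[of p c]) blast+
  then have "?S \<subseteq> {x\<in>X. k x = 0}" by blast
  then have "?S \<subseteq> \<O>"
    unfolding zero_output_set_def using invariant_orbit_in[of "\<lambda>x. V x = c"] by blast
  then show ?thesis using assms by blast
qed

lemma tendsto_V: "\<lbrakk>a \<longlonglongrightarrow> p; p \<in> X; \<forall>\<^sub>F i in sequentially. a i \<in> X\<rbrakk> \<Longrightarrow> (\<lambda>i. V (a i)) \<longlonglongrightarrow> V p"
  by (rule continuous_on_tendsto_compose[OF cont_V])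

text \<open>Backwards from \<open>q\<close>, a solution is the limit of
  \<open>z i (s i - \<tau>)\<close>, which exists eventually because \<open>s\<close> tends to
  infinity. Forwards, \<open>z i\<close> may end right after \<open>s i\<close>, so constancy of
  \<open>V\<close> is a separate hypothesis. Both limit points of a single bounded solution and
  limits of escaping sequences fit this form.\<close>

lemma limit_in_zero_output_set:
  assumes q: "q \<in> X" and lim: "(\<lambda>i. z i (s i)) \<longlonglongrightarrow> q"
    and z: "\<And>i. solution_on X F (D i) (z i)" and s: "\<And>i. s i \<in> D i" "\<And>i. 0 \<in> D i"
    and s_infinity: "filterlim s at_top sequentially"
    and V_bwd: "\<And>\<tau>. 0 \<le> \<tau> \<Longrightarrow> (\<lambda>i. V (z i (s i - \<tau>))) \<longlonglongrightarrow> c"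
    and V_fwd: "\<And>\<tau> w. \<lbrakk>0 \<le> \<tau>; solution_on X F {0..\<tau>} w; w 0 = q\<rbrakk> \<Longrightarrow> V (w \<tau>) = c"
  shows "q \<in> \<O>"
proof (rule constant_V_in_zero_output_set[OF q])
  have "V (w \<tau>) = c" if \<tau>: "0 \<le> \<tau>" and w: "solution_on X (\<lambda>x. - F x) {0..\<tau>} w" "w 0 = q" for \<tau> w
  proof -
    have "solution_on X (\<lambda>x. - (- F x)) {-\<tau>..0} (\<lambda>r. w (0 - r))"
      by (rule solution_on_reflect[OF w(1)]) (use \<tau> in auto)
    then have v: "solution_on X F {-\<tau>..0} (\<lambda>r. w (0 - r))" by simp
    have "\<forall>\<^sub>F i in sequentially. \<tau> \<le> s i"
      using s_infinity unfolding filterlim_at_top by blast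
    then have ev: "\<forall>\<^sub>F i in sequentially. solution_on X F (D i) (z i) \<and> s i \<in> D i \<and> s i + - \<tau> \<in> D i"
    proof eventually_elim
      case (elim i)
      have "is_interval (D i)" using z[of i] by (simp add: solution_on_def)
      then have "s i + - \<tau> \<in> D i"
        using mem_is_interval_1_I[of "D i" 0 "s i" "s i + - \<tau>"] s elim \<tau> by simp
      then show ?case using z s by simp
    qed
    have "(\<lambda>i. z i (s i + - \<tau>)) \<longlonglongrightarrow> w (0 - (- \<tau>))"
      by (rule solution_limit[OF v _ ev]) (use \<tau> lim w(2) in auto)
    then have "(\<lambda>i. z i (s i - \<tau>)) \<longlonglongrightarrow> w \<tau>" by simp
    moreover have "\<forall>\<^sub>F i in sequentially. z i (s i - \<tau>) \<in> X"
      using ev by eventually_elim (use solution_on_mem in force)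
    moreover have "w \<tau> \<in> X" by (rule solution_on_mem[OF w(1)]) (use \<tau> in auto)
    ultimately have "(\<lambda>i. V (z i (s i - \<tau>))) \<longlonglongrightarrow> V (w \<tau>)" using tendsto_V by blast
    then show ?thesis using V_bwd[OF \<tau>] LIMSEQ_unique by blast
  qed
  then show "orbit_in X F (\<lambda>x. V x = c) q"
    unfolding orbit_in_def using V_fwd by blast
qed

lemma V_converges:
  assumes x: "solution_on X F {0..} x"
  shows "\<exists>c. ((\<lambda>t. V (x t)) \<longlongrightarrow> c) at_top"
proof -
  define c where "c = Inf ((\<lambda>t. V (x t)) ` {0..})"
  have bdd: "bdd_below ((\<lambda>t. V (x t)) ` {0..})"
    using V_nonneg solution_on_mem[OF x] by (intro bdd_belowI2[of _ 0]) auto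
  have "((\<lambda>t. V (x t)) \<longlongrightarrow> c) at_top"
  proof (rule order_tendstoI)
    fix a assume "a < c"
    have "\<forall>\<^sub>F t in at_top. (0::real) \<le> t" by (rule eventually_ge_at_top)
    then show "\<forall>\<^sub>F t in at_top. a < V (x t)"
    proof eventually_elim
      case (elim t)
      then have "c \<le> V (x t)" unfolding c_def using bdd by (intro cInf_lower) auto
      then show ?case using \<open>a < c\<close> by simp
    qed
  next
    fix a assume "c < a"
    then obtain t0 where t0: "0 \<le> t0" "V (x t0) < a"
      unfolding c_def using cInf_less_iff[OF _ bdd] by auto
    have "\<forall>\<^sub>F t in at_top. t0 \<le> t" by (rule eventually_ge_at_top)
    then show "\<forall>\<^sub>F t in at_top. V (x t) < a"
    proof eventually_elim
      case (elim t)
      then have "V (x t) \<le> V (x t0)" using t0 by (intro V_nonincreasing[OF x]) auto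
      then show ?case using t0 by simp
    qed
  qed
  then show ?thesis by blast
qed

text \<open>LaSalle's principle: \<open>V\<close> converges to some \<open>c\<close> along
  \<open>x\<close>, so by continuous dependence it equals \<open>c\<close> on the whole orbit of any
  limit point.\<close>

lemma omega_limit_point:
  assumes x: "solution_on X F {0..} x" and C: "compact C" "C \<subseteq> X" "\<And>t. 0 \<le> t \<Longrightarrow> x t \<in> C"
  obtains q s where "q \<in> C" "q \<in> \<O>" "\<And>i::nat. 0 \<le> s i" "filterlim s at_top sequentially"
    "(\<lambda>i. x (s i)) \<longlonglongrightarrow> q"
proof -
  obtain q \<sigma> where q: "q \<in> C" and \<sigma>: "strict_mono (\<sigma> :: nat \<Rightarrow> nat)"
    and lim: "((\<lambda>i. x (real i)) \<circ> \<sigma>) \<longlonglongrightarrow> q"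
    using seq_compactE[OF compact_imp_seq_compact[OF C(1)], of "\<lambda>i. x (real i)"] C(3) by auto
  define s where "s i = real (\<sigma> i)" for i
  have s: "filterlim s at_top sequentially"
    unfolding s_def[abs_def]
    by (rule filterlim_compose[OF filterlim_real_sequentially filterlim_subseq[OF \<sigma>]])
  have s0: "0 \<le> s i" for i by (simp add: s_def)
  have lim: "(\<lambda>i. x (s i)) \<longlonglongrightarrow> q" using lim by (simp add: o_def s_def)
  have qX: "q \<in> X" using q C by blast
  obtain c where c: "((\<lambda>t. V (x t)) \<longlongrightarrow> c) at_top" using V_converges[OF x] by blast
  have Vlim: "(\<lambda>i. V (x (s i + t))) \<longlonglongrightarrow> c" for t
  proof -
    have "filterlim (\<lambda>i. t + s i) at_top sequentially"
      by (rule filterlim_tendsto_add_at_top[OF tendsto_const s])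
    then show ?thesis using filterlim_compose[OF c] by (simp add: add.commute)
  qed
  have "q \<in> \<O>"
  proof (rule limit_in_zero_output_set[where z = "\<lambda>_. x" and D = "\<lambda>_. {0..}" and s = s and c = c])
    show "(\<lambda>i. V (x (s i - \<tau>))) \<longlonglongrightarrow> c" for \<tau>
      using Vlim[of "- \<tau>"] by simp
    fix \<tau> w assume \<tau>: "0 \<le> \<tau>" and w: "solution_on X F {0..\<tau>} w" "w 0 = q"
    have "(\<lambda>i. x (s i + \<tau>)) \<longlonglongrightarrow> w \<tau>"
      by (rule solution_limit[OF w(1), where D = "\<lambda>_. {0..}"]) (use \<tau> x s0 lim w(2) in auto)
    moreover have "w \<tau> \<in> X" by (rule solution_on_mem[OF w(1)]) (use \<tau> in auto)
    moreover have "x (s i + \<tau>) \<in> X" for i using C s0[of i] \<tau> by auto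
    ultimately have "(\<lambda>i. V (x (s i + \<tau>))) \<longlonglongrightarrow> V (w \<tau>)" by (intro tendsto_V) auto
    then show "V (w \<tau>) = c" using Vlim[of \<tau>] by (rule LIMSEQ_unique)
  qed (use qX lim x s0 s in auto)
  then show ?thesis using that q s0 s lim by blast
qed

end

section \<open>Reduction of stability to the zero output set\<close>

text \<open>The common core of the two boundedness hypotheses: solutions that start near
  \<open>x\<close> and keep close to \<open>\<Gamma>\<close> cannot leave a compact subset of
  \<open>X\<close>. For compact \<open>\<Gamma>\<close> the tube confines, under local uniform
  boundedness the starting ball does.\<close>

definition confined_to ::
    "'a::euclidean_space set \<Rightarrow> ('a \<Rightarrow> 'a) \<Rightarrow> 'a set \<Rightarrow> 'a \<Rightarrow> 'a set \<Rightarrow> real \<Rightarrow> real \<Rightarrow> bool" where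
  "confined_to X F \<Gamma> x K r l \<longleftrightarrow> compact K \<and> K \<subseteq> X \<and> 0 < r \<and> 0 < l \<and>
     (\<forall>\<tau>\<ge>0. \<forall>z. solution_on X F {0..\<tau>} z \<and> dist (z 0) x < l \<and> (\<forall>t\<in>{0..\<tau>}. infdist (z t) \<Gamma> \<le> r) \<longrightarrow>
        z \<tau> \<in> K)"

definition confining_near :: "'a::euclidean_space set \<Rightarrow> ('a \<Rightarrow> 'a) \<Rightarrow> 'a set \<Rightarrow> bool" where
  "confining_near X F \<Gamma> \<longleftrightarrow> (\<forall>x\<in>\<Gamma>. \<exists>K r l. confined_to X F \<Gamma> x K r l)"

lemma confined_toD:
  assumes "confined_to X F \<Gamma> x K r l" "0 \<le> \<tau>" "solution_on X F {0..\<tau>} z" "dist (z 0) x < l"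
    "\<And>t. t \<in> {0..\<tau>} \<Longrightarrow> infdist (z t) \<Gamma> \<le> r"
  shows "z \<tau> \<in> K"
  using assms unfolding confined_to_def by blast

locale passive_field_set = passive_field +
  fixes \<Gamma> :: "'a set"
  assumes closed_\<Gamma>: "closedin (top_of_set X) \<Gamma>" and nonempty_\<Gamma>: "\<Gamma> \<noteq> {}"
    and V_\<Gamma>: "\<And>x. x \<in> \<Gamma> \<Longrightarrow> V x = 0"
    and solution_in_\<Gamma>: "\<And>x. x \<in> \<Gamma> \<Longrightarrow> \<exists>y. solution_on X F {0..} y \<and> y 0 = x \<and> (\<forall>t\<ge>0. y t \<in> \<Gamma>)"
begin

lemma \<Gamma>_subset: "\<Gamma> \<subseteq> X"
  using closed_\<Gamma> closedin_imp_subset by blast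

lemma no_escaping_sequence:
  assumes x: "x \<in> \<Gamma>" and K: "compact K" "K \<subseteq> X"
    and z: "\<And>i. solution_on X F {0..t i} (z i)" and st: "\<And>i. 0 \<le> s i" "\<And>i. s i \<le> t i"
    and start: "(\<lambda>i. z i 0) \<longlonglongrightarrow> x"
    and zs: "\<And>i. z i (s i) \<in> K" "\<And>i. infdist (z i (s i)) \<Gamma> = \<rho>"
    and zt: "\<And>i. infdist (z i (t i)) \<Gamma> = e"
    and far: "\<And>i r. r \<in> {s i..t i} \<Longrightarrow> \<rho> \<le> infdist (z i r) \<Gamma>"
    and \<rho>: "0 < \<rho>" "\<rho> \<le> e / 2"
    and N: "\<And>c. \<lbrakk>c \<in> K; infdist c \<Gamma> = \<rho>\<rbrakk> \<Longrightarrow> c \<in> N1 \<inter> N2"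
    and attr: "attracted X F (N1 \<inter> \<O>) \<Gamma>" and stab: "reach X F {0..} (N2 \<inter> \<O>) \<subseteq> set_ball X \<Gamma> (e / 2)"
  shows False
proof -
  obtain q \<sigma> where q: "q \<in> K" and \<sigma>: "strict_mono (\<sigma> :: nat \<Rightarrow> nat)"
    and lim': "((\<lambda>i. z i (s i)) \<circ> \<sigma>) \<longlonglongrightarrow> q"
    using seq_compactE[OF compact_imp_seq_compact[OF K(1)], of "\<lambda>i. z i (s i)"] zs(1) by auto
  define Z where "Z i = z (\<sigma> i)" for i
  define S where "S i = s (\<sigma> i)" for i
  define T where "T i = t (\<sigma> i)" for i
  have Z: "solution_on X F {0..T i} (Z i)" for i unfolding Z_def T_def by (rule z)
  have ST: "0 \<le> S i" "S i \<le> T i" for i unfolding S_def T_def by (rule st)+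
  have lim: "(\<lambda>i. Z i (S i)) \<longlonglongrightarrow> q" using lim' by (simp add: o_def Z_def S_def)
  have start: "(\<lambda>i. Z i 0) \<longlonglongrightarrow> x"
    using LIMSEQ_subseq_LIMSEQ[OF start \<sigma>] by (simp add: o_def Z_def)
  have qX: "q \<in> X" and xX: "x \<in> X" using q K x \<Gamma>_subset by auto
  have q\<rho>: "infdist q \<Gamma> = \<rho>"
  proof -
    have "(\<lambda>i. infdist (Z i (S i)) \<Gamma>) \<longlonglongrightarrow> infdist q \<Gamma>" by (intro tendsto_infdist lim)
    moreover have "(\<lambda>i. infdist (Z i (S i)) \<Gamma>) = (\<lambda>i. \<rho>)" using zs(2) by (simp add: Z_def S_def)
    ultimately show ?thesis by (simp add: LIMSEQ_const_iff)
  qed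
  \<comment> \<open>On any bounded time interval the solutions eventually stay within less than
    \<open>\<rho>\<close> of a solution inside \<open>\<Gamma>\<close>, whereas at time
    \<open>S i\<close> their distance to \<open>\<Gamma>\<close> is exactly
    \<open>\<rho>\<close>.\<close>
  have S_infinity: "filterlim S at_top sequentially"
    unfolding filterlim_at_top
  proof
    fix R :: real
    define R' where "R' = max R 0"
    obtain y where y: "solution_on X F {0..} y" "y 0 = x" "\<And>t. 0 \<le> t \<Longrightarrow> y t \<in> \<Gamma>"
      using solution_in_\<Gamma>[OF x] by blast
    have "solution_on X F {0..R'} y"
      by (rule solution_on_atLeastAtMost[OF y(1)]) (auto simp: R'_def)
    then obtain \<eta> where \<eta>: "0 < \<eta>" "\<And>\<tau> w. \<lbrakk>solution_on X F {0..\<tau>} w; 0 \<le> \<tau>; \<tau> \<le> R'; dist (w 0) (y 0) < \<eta>\<rbrakk> \<Longrightarrow>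
        dist (w \<tau>) (y \<tau>) < \<rho>"
      using continuous_dependence[of R' y \<rho>] \<rho>(1) by (auto simp: R'_def)
    have "\<forall>\<^sub>F i in sequentially. dist (Z i 0) x < \<eta>" using tendstoD[OF start \<eta>(1)] .
    then show "\<forall>\<^sub>F i in sequentially. R \<le> S i"
    proof eventually_elim
      case (elim i)
      show ?case
      proof (rule ccontr)
        assume "\<not> R \<le> S i"
        then have "S i \<le> R'" by (simp add: R'_def)
        moreover have "solution_on X F {0..S i} (Z i)"
          by (rule solution_on_atLeastAtMost[OF Z]) (use ST in auto)
        ultimately have "dist (Z i (S i)) (y (S i)) < \<rho>"
          using \<eta>(2)[of "S i" "Z i"] ST elim y(2) by simp
        moreover have "infdist (Z i (S i)) \<Gamma> \<le> dist (Z i (S i)) (y (S i))"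
          by (rule infdist_le) (use y(3) ST in auto)
        ultimately show False using zs(2)[of "\<sigma> i"] by (simp add: Z_def S_def)
      qed
    qed
  qed
  have V_start: "(\<lambda>i. V (Z i 0)) \<longlonglongrightarrow> 0"
  proof -
    have "Z i 0 \<in> X" for i by (rule solution_on_mem[OF Z]) (use order_trans[OF ST] in simp)
    then show ?thesis using tendsto_V[OF start xX] V_\<Gamma>[OF x] by simp
  qed
  \<comment> \<open>\<open>V\<close> is squeezed between 0 and its starting values, which tend to
    the value 0 that it has on \<open>\<Gamma>\<close>.\<close>
  have V_lim: "(\<lambda>i. V (Z i (S i - \<tau>))) \<longlonglongrightarrow> 0" if \<tau>: "0 \<le> \<tau>" for \<tau>
  proof (rule tendsto_sandwich[OF _ _ tendsto_const V_start])
    have "\<forall>\<^sub>F i in sequentially. \<tau> \<le> S i"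
      using S_infinity unfolding filterlim_at_top by blast
    then have ev: "\<forall>\<^sub>F i in sequentially. S i - \<tau> \<in> {0..T i}"
      by eventually_elim (use ST \<tau> in \<open>auto intro: order_trans[OF _ ST(2)]\<close>)
    then show "\<forall>\<^sub>F i in sequentially. 0 \<le> V (Z i (S i - \<tau>))"
      by eventually_elim (rule V_nonneg[OF solution_on_mem[OF Z]])
    show "\<forall>\<^sub>F i in sequentially. V (Z i (S i - \<tau>)) \<le> V (Z i 0)"
      using ev by eventually_elim (rule V_nonincreasing[OF Z], auto)
  qed
  have Vq: "V q = 0"
  proof -
    have "Z i (S i) \<in> X" for i by (rule solution_on_mem[OF Z]) (use ST in simp)
    then have "(\<lambda>i. V (Z i (S i))) \<longlonglongrightarrow> V q" by (intro tendsto_V[OF lim qX]) simp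
    then show ?thesis using V_lim[of 0] LIMSEQ_unique by fastforce
  qed
  have qO: "q \<in> \<O>"
  proof (rule limit_in_zero_output_set[where z = Z and s = S and D = "\<lambda>i. {0..T i}" and c = 0])
    show "0 \<in> {0..T i}" "S i \<in> {0..T i}" for i using ST[of i] by auto
    show "solution_on X F {0..T i} (Z i)" for i by (rule Z)
    show "(\<lambda>i. V (Z i (S i - \<tau>))) \<longlonglongrightarrow> 0" if "0 \<le> \<tau>" for \<tau> by (rule V_lim[OF that])
    fix \<tau> w assume \<tau>: "0 \<le> \<tau>" and w: "solution_on X F {0..\<tau>} w" "w 0 = q"
    have "V (w \<tau>) \<le> V (w 0)" by (rule V_nonincreasing[OF w(1)]) (use \<tau> in auto)
    moreover have "0 \<le> V (w \<tau>)" by (rule V_nonneg[OF solution_on_mem[OF w(1)]]) (use \<tau> in auto)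
    ultimately show "V (w \<tau>) = 0" using w(2) Vq by simp
  qed (rule qX lim S_infinity)+
  have qN: "q \<in> N1" "q \<in> N2" using N[OF q q\<rho>] by auto
  obtain y where y: "solution_on X F {0..} y" "y 0 = q"
    using attr qN qO unfolding attracted_def forward_complete_def by blast
  have "((\<lambda>t. infdist (y t) \<Gamma>) \<longlongrightarrow> 0) at_top"
    using attr qN qO y unfolding attracted_def by blast
  then have "\<forall>\<^sub>F t in at_top. infdist (y t) \<Gamma> < \<rho> / 2"
    by (rule order_tendstoD) (use \<rho> in simp)
  moreover have "\<forall>\<^sub>F t in at_top. (0::real) \<le> t" by (rule eventually_ge_at_top)
  ultimately have "\<forall>\<^sub>F t in at_top. infdist (y t) \<Gamma> < \<rho> / 2 \<and> 0 \<le> t" by (rule eventually_conj)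
  then obtain R where R: "infdist (y R) \<Gamma> < \<rho> / 2" "0 \<le> R"
    using eventually_happens'[OF trivial_limit_at_top_linorder] by blast
  have near: "infdist (y t) \<Gamma> < e / 2" if "0 \<le> t" for t
  proof -
    have "y t \<in> reach X F {0..} (N2 \<inter> \<O>)"
      unfolding reach_def using y qN qO that by (intro CollectI exI[of _ "{0..}"] exI[of _ y] exI[of _ t]) simp
    then show ?thesis using stab unfolding set_ball_def by blast
  qed
  have "solution_on X F {0..R} y"
    by (rule solution_on_atLeastAtMost[OF y(1)]) (use R in auto)
  then obtain \<eta> where \<eta>: "0 < \<eta>" "\<And>\<tau> w. \<lbrakk>solution_on X F {0..\<tau>} w; 0 \<le> \<tau>; \<tau> \<le> R; dist (w 0) (y 0) < \<eta>\<rbrakk> \<Longrightarrow>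
      dist (w \<tau>) (y \<tau>) < \<rho> / 2"
    using continuous_dependence[of R y "\<rho> / 2"] \<rho>(1) R(2) by auto
  obtain i where i: "dist (Z i (S i)) q < \<eta>"
    using eventually_happens'[OF trivial_limit_sequentially tendstoD[OF lim \<eta>(1)]] by blast
  \<comment> \<open>At time \<open>R\<close> the solution \<open>y\<close> is within
    \<open>\<rho> / 2\<close> of \<open>\<Gamma>\<close>. If \<open>Z i\<close> is still observed
    then, it comes closer than \<open>\<rho>\<close>; otherwise it reaches distance \<open>e\<close>
    while \<open>y\<close> is below \<open>e / 2\<close> and the error is below
    \<open>\<rho> / 2 \<le> e / 4\<close>.\<close>
  define \<tau> where "\<tau> = min R (T i - S i)"
  have \<tau>: "0 \<le> \<tau>" "\<tau> \<le> R" "S i + \<tau> \<le> T i" using R ST[of i] by (auto simp: \<tau>_def)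
  have "solution_on X F {0..\<tau>} (\<lambda>r. Z i (S i + r))"
    by (rule solution_on_shift[OF Z]) (use \<tau> ST[of i] in auto)
  then have close: "dist (Z i (S i + \<tau>)) (y \<tau>) < \<rho> / 2"
    using \<eta>(2)[of \<tau> "\<lambda>r. Z i (S i + r)"] \<tau> i y(2) by simp
  have tri: "infdist (Z i (S i + \<tau>)) \<Gamma> \<le> infdist (y \<tau>) \<Gamma> + dist (Z i (S i + \<tau>)) (y \<tau>)"
    by (rule infdist_triangle)
  show False
  proof (cases "R \<le> T i - S i")
    case True
    then have "\<tau> = R" by (simp add: \<tau>_def)
    moreover have "\<rho> \<le> infdist (Z i (S i + \<tau>)) \<Gamma>"
      unfolding Z_def by (rule far) (use \<tau> in \<open>auto simp: S_def T_def\<close>)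
    ultimately show False using tri close R(1) by simp
  next
    case False
    then have "S i + \<tau> = T i" by (simp add: \<tau>_def)
    then have "infdist (Z i (S i + \<tau>)) \<Gamma> = e" using zt[of "\<sigma> i"] by (simp add: Z_def T_def)
    then show False using tri close near[OF \<tau>(1)] \<rho> by simp
  qed
qed

text \<open>Stability at a single point of \<open>\<Gamma>\<close>, for whatever part of each
  solution exists. The radius \<open>\<eta>\<close> may depend on \<open>x\<close>, as it must when
  \<open>\<Gamma>\<close> is unbounded.\<close>

lemma uniformly_near:
  assumes conf: "confining_near X F \<Gamma>" and stable: "stable_rel X F \<O> \<Gamma>" and attr: "attractive_rel X F \<O> \<Gamma>"
    and x: "x \<in> \<Gamma>" and \<epsilon>: "0 < \<epsilon>"
  shows "\<exists>\<eta>>0. \<forall>\<tau>\<ge>0. \<forall>z. solution_on X F {0..\<tau>} z \<and> dist (z 0) x < \<eta> \<longrightarrow> infdist (z \<tau>) \<Gamma> < \<epsilon>"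
proof (rule ccontr)
  assume contra: "\<not> ?thesis"
  obtain K r l where Krl: "confined_to X F \<Gamma> x K r l"
    using conf x unfolding confining_near_def by blast
  then have K: "compact K" "K \<subseteq> X" and rl: "0 < r" "0 < l" by (auto simp: confined_to_def)
  note confined = confined_toD[OF Krl]
  obtain N1 where N1: "open_nbhd X \<Gamma> N1" "attracted X F (N1 \<inter> \<O>) \<Gamma>"
    using attr unfolding attractive_rel_def by blast
  obtain \<rho>1 where \<rho>1: "0 < \<rho>1" "\<And>c. \<lbrakk>c \<in> K; infdist c \<Gamma> \<le> \<rho>1\<rbrakk> \<Longrightarrow> c \<in> N1"
    using open_nbhd_on_compact[OF K closed_\<Gamma> nonempty_\<Gamma> N1(1)] by blast
  \<comment> \<open>\<open>e \<le> \<epsilon>\<close> makes every counterexample cross level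
    \<open>e\<close>, \<open>e \<le> r\<close> keeps it confined to \<open>K\<close> up to that
    crossing, and \<open>e \<le> \<rho>1\<close> puts the points of \<open>K\<close> below that
    level into \<open>N1\<close>. As \<open>N2\<close> depends on \<open>e\<close>, the lower level
    \<open>\<rho>\<close> is fixed last.\<close>
  define e where "e = min \<epsilon> (min r \<rho>1)"
  have e: "0 < e" "e \<le> \<epsilon>" "e \<le> r" "e \<le> \<rho>1" using \<epsilon> rl \<rho>1 by (auto simp: e_def)
  obtain N2 where N2: "open_nbhd X \<Gamma> N2" "reach X F {0..} (N2 \<inter> \<O>) \<subseteq> set_ball X \<Gamma> (e / 2)"
    using stable[unfolded stable_rel_def, rule_format, of "e / 2"] e(1) by auto
  obtain \<rho>2 where \<rho>2: "0 < \<rho>2" "\<And>c. \<lbrakk>c \<in> K; infdist c \<Gamma> \<le> \<rho>2\<rbrakk> \<Longrightarrow> c \<in> N2"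
    using open_nbhd_on_compact[OF K closed_\<Gamma> nonempty_\<Gamma> N2(1)] by blast
  define \<rho> where "\<rho> = min \<rho>2 (e / 2)"
  have \<rho>: "0 < \<rho>" "\<rho> \<le> \<rho>2" "\<rho> \<le> e / 2" using \<rho>2 e by (auto simp: \<rho>_def)
  define P where "P i z s t \<longleftrightarrow> solution_on X F {0..t} z \<and> 0 \<le> s \<and> s \<le> t \<and>
      dist (z 0) x < min l (inverse (real (Suc i))) \<and> infdist (z s) \<Gamma> = \<rho> \<and> infdist (z t) \<Gamma> = e \<and>
      (\<forall>r\<in>{0..t}. infdist (z r) \<Gamma> \<le> e) \<and> (\<forall>r\<in>{s..t}. \<rho> \<le> infdist (z r) \<Gamma>)" for i z s t
  have "\<exists>z s t. P i z s t" for i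
  proof -
    \<comment> \<open>The three terms ensure confinement, convergence of the starting points to
      \<open>x\<close>, and a start below level \<open>\<rho>\<close>.\<close>
    define \<eta> where "\<eta> = min (min l (inverse (real (Suc i)))) \<rho>"
    have "0 < \<eta>" using rl \<rho> by (simp add: \<eta>_def)
    then obtain \<tau> z where z: "0 \<le> \<tau>" "solution_on X F {0..\<tau>} z" "dist (z 0) x < \<eta>" "\<epsilon> \<le> infdist (z \<tau>) \<Gamma>"
      using contra by (meson not_less)
    have "continuous_on {0..\<tau>} (\<lambda>t. infdist (z t) \<Gamma>)"
      by (intro continuous_intros solution_on_continuous[OF z(2)])
    moreover have "infdist (z 0) \<Gamma> < \<rho>"
      using infdist_le[OF x, of "z 0"] z(3) by (simp add: \<eta>_def)
    moreover have "\<rho> < e" "e \<le> infdist (z \<tau>) \<Gamma>" using \<rho> e z(4) by simp_all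
    ultimately obtain s t where st: "0 \<le> s" "s \<le> t" "t \<le> \<tau>" "infdist (z s) \<Gamma> = \<rho>" "infdist (z t) \<Gamma> = e"
        "\<forall>r\<in>{0..t}. infdist (z r) \<Gamma> \<le> e" "\<forall>r\<in>{s..t}. \<rho> \<le> infdist (z r) \<Gamma>"
      using last_and_first_crossing[OF _ z(1), of "\<lambda>t. infdist (z t) \<Gamma>" \<rho> e] by blast
    moreover have "solution_on X F {0..t} z"
      by (rule solution_on_atLeastAtMost[OF z(2)]) (use st in auto)
    moreover have "dist (z 0) x < min l (inverse (real (Suc i)))" using z(3) by (simp add: \<eta>_def)
    ultimately have "P i z s t" unfolding P_def by blast
    then show ?thesis by blast
  qed
  then obtain z s t where P: "\<And>i. P i (z i) (s i) (t i)" by metis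
  have z: "solution_on X F {0..t i} (z i)" and st: "0 \<le> s i" "s i \<le> t i"
    and d: "dist (z i 0) x < l" "dist (z i 0) x < inverse (real (Suc i))"
    and zs: "infdist (z i (s i)) \<Gamma> = \<rho>" and zt: "infdist (z i (t i)) \<Gamma> = e"
    and le: "\<And>r. r \<in> {0..t i} \<Longrightarrow> infdist (z i r) \<Gamma> \<le> e"
    and far: "\<And>r. r \<in> {s i..t i} \<Longrightarrow> \<rho> \<le> infdist (z i r) \<Gamma>" for i
    using P[of i] unfolding P_def by auto
  show False
  proof (rule no_escaping_sequence[OF x K z st _ _ zs zt far \<rho>(1,3) _ N1(2) N2(2)])
    show "(\<lambda>i. z i 0) \<longlonglongrightarrow> x"
    proof (rule metric_tendsto_imp_tendsto[OF LIMSEQ_inverse_real_of_nat])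
      show "\<forall>\<^sub>F i in sequentially. dist (z i 0) x \<le> dist (inverse (real (Suc i))) 0"
        using d(2) by (intro always_eventually allI) (simp add: less_imp_le)
    qed
    show "z i (s i) \<in> K" for i
    proof (rule confined[OF st(1)])
      show "solution_on X F {0..s i} (z i)"
        by (rule solution_on_atLeastAtMost[OF z]) (use st in auto)
      show "infdist (z i u) \<Gamma> \<le> r" if "u \<in> {0..s i}" for u
        using le[of u i] that st(2)[of i] e(3) by auto
    qed (rule d)
    show "c \<in> N1 \<inter> N2" if "c \<in> K" "infdist c \<Gamma> = \<rho>" for c
      using \<rho>1(2)[of c] \<rho>2(2)[of c] that \<rho> e by auto
  qed
qed

text \<open>The neighbourhood \<open>N\<close> need not contain a tube of uniform width around \<open>\<Gamma>\<close>.\<close>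

lemma trapped_near:
  assumes conf: "confining_near X F \<Gamma>"
    and near: "\<And>\<epsilon>. 0 < \<epsilon> \<Longrightarrow> \<exists>\<eta>>0. \<forall>\<tau>\<ge>0. \<forall>z. solution_on X F {0..\<tau>} z \<and> dist (z 0) x < \<eta> \<longrightarrow> infdist (z \<tau>) \<Gamma> < \<epsilon>"
    and x: "x \<in> \<Gamma>" and \<epsilon>: "0 < \<epsilon>" and N: "open_nbhd X \<Gamma> N"
  shows "\<exists>\<eta>>0. \<exists>C. compact C \<and> C \<subseteq> X \<and> C \<subseteq> N \<and>
    (\<forall>\<tau>\<ge>0. \<forall>z. solution_on X F {0..\<tau>} z \<and> dist (z 0) x < \<eta> \<longrightarrow> z \<tau> \<in> C \<and> infdist (z \<tau>) \<Gamma> < \<epsilon>)"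
proof -
  obtain K r l where Krl: "confined_to X F \<Gamma> x K r l"
    using conf x unfolding confining_near_def by blast
  then have K: "compact K" "K \<subseteq> X" and rl: "0 < r" "0 < l" by (auto simp: confined_to_def)
  note confined = confined_toD[OF Krl]
  obtain \<rho> where \<rho>: "0 < \<rho>" "\<And>c. \<lbrakk>c \<in> K; infdist c \<Gamma> \<le> \<rho>\<rbrakk> \<Longrightarrow> c \<in> N"
    using open_nbhd_on_compact[OF K closed_\<Gamma> nonempty_\<Gamma> N] by blast
  define e where "e = min \<epsilon> (min r \<rho>)"
  have e: "0 < e" "e \<le> \<epsilon>" "e \<le> r" "e \<le> \<rho>" using \<epsilon> rl \<rho> by (auto simp: e_def)
  obtain \<eta> where \<eta>: "0 < \<eta>"
      "\<And>\<tau> z. \<lbrakk>0 \<le> \<tau>; solution_on X F {0..\<tau>} z; dist (z 0) x < \<eta>\<rbrakk> \<Longrightarrow> infdist (z \<tau>) \<Gamma> < e"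
    using near[OF e(1)] by blast
  define C where "C = K \<inter> {y. infdist y \<Gamma> \<le> e}"
  have "closed {y. infdist y \<Gamma> \<le> e}" by (intro closed_Collect_le continuous_intros)
  then have "compact C" unfolding C_def using K(1) by (rule compact_Int_closed[rotated])
  moreover have "C \<subseteq> X" "C \<subseteq> N" using K(2) \<rho>(2) e by (auto simp: C_def)
  moreover have "z \<tau> \<in> C \<and> infdist (z \<tau>) \<Gamma> < \<epsilon>"
    if \<tau>: "0 \<le> \<tau>" and z: "solution_on X F {0..\<tau>} z" "dist (z 0) x < min \<eta> l" for \<tau> z
  proof -
    \<comment> \<open>The distance bound at all earlier times is obtained before any confinement;
      being below \<open>r\<close>, it then places \<open>z \<tau>\<close> in
      \<open>K\<close>.\<close>
    have lt: "infdist (z t) \<Gamma> < e" if "t \<in> {0..\<tau>}" for t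
    proof (rule \<eta>(2))
      show "solution_on X F {0..t} z"
        by (rule solution_on_atLeastAtMost[OF z(1)]) (use that in auto)
    qed (use that z in auto)
    have "z \<tau> \<in> K"
      by (rule confined[OF \<tau> z(1)]) (use z(2) lt e(3) in \<open>auto intro: less_imp_le less_le_trans\<close>)
    then show ?thesis using lt[of \<tau>] \<tau> e by (auto simp: C_def)
  qed
  moreover have "0 < min \<eta> l" using \<eta> rl by simp
  ultimately show ?thesis by blast
qed

end

context passive_field_set
begin

text \<open>The union over \<open>\<Gamma>\<close> of balls with point-dependent radii. That the
  compact sets lie in \<open>N\<close> puts the limit points of trapped solutions into the region
  where attractivity relative to \<open>\<O>\<close> is assumed.\<close>

lemma trapping_nbhd:
  assumes conf: "confining_near X F \<Gamma>" and stable: "stable_rel X F \<O> \<Gamma>" and attr: "attractive_rel X F \<O> \<Gamma>"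
    and \<epsilon>: "0 < \<epsilon>" and N: "open_nbhd X \<Gamma> N"
  obtains M where "open_nbhd X \<Gamma> M"
    "\<And>p. p \<in> M \<Longrightarrow> \<exists>C. compact C \<and> C \<subseteq> X \<and> C \<subseteq> N \<and>
      (\<forall>\<tau>\<ge>0. \<forall>z. solution_on X F {0..\<tau>} z \<and> z 0 = p \<longrightarrow> z \<tau> \<in> C \<and> infdist (z \<tau>) \<Gamma> < \<epsilon>)"
proof -
  have "\<exists>\<eta>>0. \<exists>C. compact C \<and> C \<subseteq> X \<and> C \<subseteq> N \<and>
    (\<forall>\<tau>\<ge>0. \<forall>z. solution_on X F {0..\<tau>} z \<and> dist (z 0) x < \<eta> \<longrightarrow> z \<tau> \<in> C \<and> infdist (z \<tau>) \<Gamma> < \<epsilon>)"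
    if "x \<in> \<Gamma>" for x
    using trapped_near[OF conf uniformly_near[OF conf stable attr that] that \<epsilon> N] .
  then obtain \<eta> C where \<eta>: "\<And>x. x \<in> \<Gamma> \<Longrightarrow> 0 < \<eta> x"
    and C: "\<And>x. x \<in> \<Gamma> \<Longrightarrow> compact (C x) \<and> C x \<subseteq> X \<and> C x \<subseteq> N \<and>
      (\<forall>\<tau>\<ge>0. \<forall>z. solution_on X F {0..\<tau>} z \<and> dist (z 0) x < \<eta> x \<longrightarrow> z \<tau> \<in> C x \<and> infdist (z \<tau>) \<Gamma> < \<epsilon>)"
    by metis
  define M where "M = X \<inter> (\<Union>x\<in>\<Gamma>. ball x (\<eta> x))"
  have "open_nbhd X \<Gamma> M"
    unfolding open_nbhd_def M_def using \<eta> \<Gamma>_subset by (force intro: openin_open_Int)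
  moreover have "\<exists>C. compact C \<and> C \<subseteq> X \<and> C \<subseteq> N \<and>
      (\<forall>\<tau>\<ge>0. \<forall>z. solution_on X F {0..\<tau>} z \<and> z 0 = p \<longrightarrow> z \<tau> \<in> C \<and> infdist (z \<tau>) \<Gamma> < \<epsilon>)"
    if p: "p \<in> M" for p
  proof -
    obtain x where x: "x \<in> \<Gamma>" "dist p x < \<eta> x" using p by (auto simp: M_def dist_commute)
    then show ?thesis using C[OF x(1)] by blast
  qed
  ultimately show ?thesis by (rule that)
qed

lemma stable_rel_state_space:
  assumes conf: "confining_near X F \<Gamma>" and stable: "stable_rel X F \<O> \<Gamma>" and attr: "attractive_rel X F \<O> \<Gamma>"
  shows "stable_rel X F X \<Gamma>"
  unfolding stable_rel_def
proof (intro allI impI)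
  fix \<epsilon> :: real assume \<epsilon>: "0 < \<epsilon>"
  have "open_nbhd X \<Gamma> X" unfolding open_nbhd_def using \<Gamma>_subset by simp
  from trapping_nbhd[OF conf stable attr \<epsilon> this] obtain M where M: "open_nbhd X \<Gamma> M"
    and trap: "\<And>p. p \<in> M \<Longrightarrow> \<exists>C. compact C \<and> C \<subseteq> X \<and> C \<subseteq> X \<and>
      (\<forall>\<tau>\<ge>0. \<forall>z. solution_on X F {0..\<tau>} z \<and> z 0 = p \<longrightarrow> z \<tau> \<in> C \<and> infdist (z \<tau>) \<Gamma> < \<epsilon>)"
    by blast
  have "\<exists>x. solution_on X F {0..} x \<and> x 0 = p" if p: "p \<in> M \<inter> X" for p
  proof -
    obtain C where C: "compact C" "C \<subseteq> X"
      "\<And>\<tau> z. \<lbrakk>0 \<le> \<tau>; solution_on X F {0..\<tau>} z; z 0 = p\<rbrakk> \<Longrightarrow> z \<tau> \<in> C"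
      using trap[of p] p by blast
    show ?thesis
    proof (rule solution_extends[OF C(1,2)])
      show "p \<in> X" using p by simp
    qed (rule C(3))
  qed
  then have "forward_complete X F (M \<inter> X)" unfolding forward_complete_def by blast
  moreover have "reach X F {0..} (M \<inter> X) \<subseteq> set_ball X \<Gamma> \<epsilon>"
  proof
    fix y assume "y \<in> reach X F {0..} (M \<inter> X)"
    then obtain J z t where z: "solution_on X F J z" "z 0 \<in> M" "t \<in> J" "0 \<le> t" "y = z t"
      unfolding reach_def by auto
    have "infdist (z t) \<Gamma> < \<epsilon>"
      using trap[OF z(2)] z(4) solution_on_atLeastAtMost[OF z(1,3,4)] by blast
    then show "y \<in> set_ball X \<Gamma> \<epsilon>"
      unfolding set_ball_def using z solution_on_mem[OF z(1,3)] by simp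
  qed
  ultimately show "\<exists>N. open_nbhd X \<Gamma> N \<and> forward_complete X F (N \<inter> X) \<and>
      reach X F {0..} (N \<inter> X) \<subseteq> set_ball X \<Gamma> \<epsilon>"
    using M by blast
qed

text \<open>A limit point \<open>q\<close> in \<open>\<O>\<close> only shows that \<open>x\<close>
  comes close to \<open>\<Gamma>\<close> at some times, by following the solution from
  \<open>q\<close>. Stability turns one such visit into closeness for all later times.\<close>

lemma solution_attracted:
  assumes stable: "stable_rel X F X \<Gamma>" and attr: "attracted X F (N \<inter> \<O>) \<Gamma>"
    and x: "solution_on X F {0..} x" and C: "compact C" "C \<subseteq> X" "C \<subseteq> N" "\<And>t. 0 \<le> t \<Longrightarrow> x t \<in> C"
  shows "((\<lambda>t. infdist (x t) \<Gamma>) \<longlongrightarrow> 0) at_top"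
proof (rule tendstoI)
  fix \<epsilon> :: real assume \<epsilon>: "0 < \<epsilon>"
  obtain q s where q: "q \<in> C" "q \<in> \<O>" and s: "\<And>i::nat. 0 \<le> s i"
    and lim: "(\<lambda>i. x (s i)) \<longlonglongrightarrow> q"
    using omega_limit_point[OF x C(1,2,4)] by blast
  obtain y where y: "solution_on X F {0..} y" "y 0 = q"
    using attr q C(3) unfolding attracted_def forward_complete_def by blast
  have y0: "((\<lambda>t. infdist (y t) \<Gamma>) \<longlongrightarrow> 0) at_top"
    using attr q C(3) y unfolding attracted_def by blast
  obtain M where M: "open_nbhd X \<Gamma> M" "reach X F {0..} (M \<inter> X) \<subseteq> set_ball X \<Gamma> \<epsilon>"
    using stable \<epsilon> unfolding stable_rel_def by blast
  obtain \<rho> where \<rho>: "0 < \<rho>" "\<And>c. \<lbrakk>c \<in> C; infdist c \<Gamma> \<le> \<rho>\<rbrakk> \<Longrightarrow> c \<in> M"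
    using open_nbhd_on_compact[OF C(1,2) closed_\<Gamma> nonempty_\<Gamma> M(1)] by blast
  have "\<forall>\<^sub>F t in at_top. infdist (y t) \<Gamma> < \<rho>" using order_tendstoD(2)[OF y0 \<rho>(1)] .
  moreover have "\<forall>\<^sub>F t in at_top. (0::real) \<le> t" by (rule eventually_ge_at_top)
  ultimately have "\<forall>\<^sub>F t in at_top. infdist (y t) \<Gamma> < \<rho> \<and> 0 \<le> t" by (rule eventually_conj)
  then obtain R where R: "infdist (y R) \<Gamma> < \<rho>" "0 \<le> R"
    using eventually_happens'[OF trivial_limit_at_top_linorder] by blast
  have lim_R: "(\<lambda>i. x (s i + R)) \<longlonglongrightarrow> y R"
    by (rule solution_limit[OF y(1), where D = "\<lambda>_. {0..}"]) (use R x s lim y(2) in auto)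
  have "x (s i + R) \<in> C" for i by (rule C(4)) (use s[of i] R in simp)
  \<comment> \<open>The width \<open>\<rho>\<close> guarantees membership in \<open>M\<close> only
    on \<open>C\<close>, so the limit point \<open>y R\<close> must be placed there first. Relative
    openness of \<open>M\<close> then catches \<open>x\<close> itself.\<close>
  then have "y R \<in> C"
    using closed_sequentially[OF compact_imp_closed[OF C(1)] _ lim_R] by blast
  then have "y R \<in> M" using \<rho>(2) R by simp
  moreover obtain W where W: "open W" "M = X \<inter> W"
    using M(1) unfolding open_nbhd_def by (auto simp: openin_open)
  ultimately have "\<forall>\<^sub>F i in sequentially. x (s i + R) \<in> W"
    by (intro topological_tendstoD[OF lim_R]) auto
  then obtain i where i: "x (s i + R) \<in> W"
    using eventually_happens'[OF trivial_limit_sequentially] by blast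
  define T where "T = s i + R"
  have T: "0 \<le> T" "x T \<in> M"
    using i s[of i] R W solution_on_mem[OF x, of T] by (auto simp: T_def)
  have "\<forall>\<^sub>F t in at_top. T \<le> t" by (rule eventually_ge_at_top)
  then show "\<forall>\<^sub>F t in at_top. dist (infdist (x t) \<Gamma>) 0 < \<epsilon>"
  proof eventually_elim
    case (elim t)
    have "solution_on X F {0..} (\<lambda>r. x (T + r))"
      by (rule solution_on_shift[OF x]) (use T in \<open>auto simp: is_interval_ci\<close>)
    then have "x (T + (t - T)) \<in> reach X F {0..} (M \<inter> X)"
      unfolding reach_def using T elim solution_on_mem[OF x, of T]
      by (intro CollectI exI[of _ "{0..}"] exI[of _ "\<lambda>r. x (T + r)"] exI[of _ "t - T"]) simp
    then have "infdist (x t) \<Gamma> < \<epsilon>" using M(2) unfolding set_ball_def by auto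
    then show ?case using infdist_nonneg[of "x t" \<Gamma>] by simp
  qed
qed

lemma attractive_rel_state_space:
  assumes conf: "confining_near X F \<Gamma>" and stable: "stable_rel X F \<O> \<Gamma>" and attr: "attractive_rel X F \<O> \<Gamma>"
  shows "attractive_rel X F X \<Gamma>"
proof -
  obtain N where N: "open_nbhd X \<Gamma> N" "attracted X F (N \<inter> \<O>) \<Gamma>"
    using attr unfolding attractive_rel_def by blast
  from trapping_nbhd[OF conf stable attr zero_less_one N(1)] obtain M where M: "open_nbhd X \<Gamma> M"
    and trap: "\<And>p. p \<in> M \<Longrightarrow> \<exists>C. compact C \<and> C \<subseteq> X \<and> C \<subseteq> N \<and>
      (\<forall>\<tau>\<ge>0. \<forall>z. solution_on X F {0..\<tau>} z \<and> z 0 = p \<longrightarrow> z \<tau> \<in> C \<and> infdist (z \<tau>) \<Gamma> < 1)"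
    by blast
  have trap': "\<exists>C. compact C \<and> C \<subseteq> X \<and> C \<subseteq> N \<and>
      (\<forall>\<tau> z. 0 \<le> \<tau> \<and> solution_on X F {0..\<tau>} z \<and> z 0 = p \<longrightarrow> z \<tau> \<in> C)" if "p \<in> M" for p
    using trap[OF that] by blast
  have "\<exists>x. solution_on X F {0..} x \<and> x 0 = p" if p: "p \<in> M \<inter> X" for p
  proof -
    obtain C where C: "compact C" "C \<subseteq> X"
      "\<And>\<tau> z. \<lbrakk>0 \<le> \<tau>; solution_on X F {0..\<tau>} z; z 0 = p\<rbrakk> \<Longrightarrow> z \<tau> \<in> C"
      using trap'[of p] p by blast
    show ?thesis
    proof (rule solution_extends[OF C(1,2)])
      show "p \<in> X" using p by simp
    qed (rule C(3))
  qed
  then have "forward_complete X F (M \<inter> X)" unfolding forward_complete_def by blast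
  moreover have "((\<lambda>t. infdist (x t) \<Gamma>) \<longlongrightarrow> 0) at_top"
    if x: "solution_on X F {0..} x" "x 0 \<in> M \<inter> X" for x
  proof -
    obtain C where C: "compact C" "C \<subseteq> X" "C \<subseteq> N"
      "\<And>\<tau> z. \<lbrakk>0 \<le> \<tau>; solution_on X F {0..\<tau>} z; z 0 = x 0\<rbrakk> \<Longrightarrow> z \<tau> \<in> C"
      using trap'[of "x 0"] x by blast
    have "x t \<in> C" if "0 \<le> t" for t
      by (rule C(4)[OF that]) (use solution_on_atLeastAtMost[OF x(1) _ that] that in auto)
    then show ?thesis
      by (rule solution_attracted[OF stable_rel_state_space[OF conf stable attr] N(2) x(1) C(1-3)])
  qed
  ultimately have "attracted X F (M \<inter> X) \<Gamma>" unfolding attracted_def by blast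
  then show ?thesis using M unfolding attractive_rel_def by blast
qed

text \<open>Relative stability includes that the two sets meet. A solution inside
  \<open>\<Gamma>\<close> is confined to a compact set, so it has a limit point in
  \<open>\<O>\<close>, which lies in \<open>\<Gamma>\<close> because \<open>\<Gamma>\<close> is
  closed in \<open>X\<close>.\<close>

lemma zero_output_set_meets:
  assumes conf: "confining_near X F \<Gamma>"
  shows "\<O> \<inter> \<Gamma> \<noteq> {}"
proof -
  obtain x where x: "x \<in> \<Gamma>" using nonempty_\<Gamma> by blast
  obtain K r l where Krl: "confined_to X F \<Gamma> x K r l"
    using conf x unfolding confining_near_def by blast
  then have K: "compact K" "K \<subseteq> X" and rl: "0 < r" "0 < l" by (auto simp: confined_to_def)
  obtain y where y: "solution_on X F {0..} y" "y 0 = x" "\<And>t. 0 \<le> t \<Longrightarrow> y t \<in> \<Gamma>"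
    using solution_in_\<Gamma>[OF x] by blast
  have yK: "y t \<in> K" if "0 \<le> t" for t
  proof (rule confined_toD[OF Krl that])
    show "solution_on X F {0..t} y"
      by (rule solution_on_atLeastAtMost[OF y(1)]) (use that in auto)
    show "infdist (y s) \<Gamma> \<le> r" if "s \<in> {0..t}" for s
      using y(3)[of s] that rl by simp
  qed (use y rl in simp)
  obtain q s where q: "q \<in> K" "q \<in> \<O>" and s: "\<And>i::nat. 0 \<le> s i" and lim: "(\<lambda>i. y (s i)) \<longlonglongrightarrow> q"
    using omega_limit_point[OF y(1) K yK] by blast
  have "(\<lambda>i. infdist (y (s i)) \<Gamma>) \<longlonglongrightarrow> infdist q \<Gamma>" by (intro tendsto_infdist lim)
  moreover have "infdist (y (s i)) \<Gamma> = 0" for i using y(3)[OF s] by simp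
  ultimately have "infdist q \<Gamma> = 0" by (simp add: LIMSEQ_const_iff)
  then have "q \<in> \<Gamma>" using in_closedin_infdist_zero[OF closed_\<Gamma> nonempty_\<Gamma>] q K by blast
  then show ?thesis using q by blast
qed

text \<open>Necessity is restriction of the initial conditions to \<open>\<O>\<close>; sufficiency
  is the reduction carried out above.\<close>

lemma asymptotically_stable_iff:
  assumes conf: "confining_near X F \<Gamma>"
  shows "asymptotically_stable X F \<Gamma> \<longleftrightarrow> asymptotically_stable_rel X F \<O> \<Gamma>"
proof -
  have "\<O> \<subseteq> X" using zero_output_set_subset by blast
  moreover have "X \<inter> \<Gamma> \<noteq> {}" using \<Gamma>_subset nonempty_\<Gamma> by blast
  ultimately show ?thesis
    unfolding asymptotically_stable_def asymptotically_stable_rel_def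
    using zero_output_set_meets[OF conf] stable_rel_state_space[OF conf] attractive_rel_state_space[OF conf]
      stable_rel_subset attractive_rel_subset by blast
qed

lemma globally_asymptotically_stable_iff:
  assumes conf: "confining_near X F \<Gamma>" and bdd: "trajectories_bounded X F"
  shows "globally_asymptotically_stable X F \<Gamma> \<longleftrightarrow> globally_asymptotically_stable_rel X F \<O> \<Gamma>"
proof -
  have OX: "\<O> \<subseteq> X" using zero_output_set_subset by blast
  have meets: "X \<inter> \<Gamma> \<noteq> {}" using \<Gamma>_subset nonempty_\<Gamma> by blast
  have to_state_space: "stable_rel X F X \<Gamma> \<and> attracted X F X \<Gamma>"
    if stable: "stable_rel X F \<O> \<Gamma>" and attr: "attracted X F \<O> \<Gamma>"
  proof -
    have nb: "open_nbhd X \<Gamma> X" unfolding open_nbhd_def using \<Gamma>_subset by simp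
    have XO: "attracted X F (X \<inter> \<O>) \<Gamma>" using attr OX by (simp add: Int_absorb1)
    then have "attractive_rel X F \<O> \<Gamma>" unfolding attractive_rel_def using nb by blast
    then have st: "stable_rel X F X \<Gamma>" by (rule stable_rel_state_space[OF conf stable])
    have "((\<lambda>t. infdist (x t) \<Gamma>) \<longlongrightarrow> 0) at_top" if x: "solution_on X F {0..} x" "x 0 \<in> X" for x
    proof -
      \<comment> \<open>By \<open>bounded_in\<close>, the closure of this orbit is a compact subset
        of \<open>X\<close>. As attractivity relative to \<open>\<O>\<close> is now global, the
        neighbourhood can be all of \<open>X\<close>, and this closure is the trapping set even far
        from \<open>\<Gamma>\<close>.\<close>
      let ?R = "reach X F {0..} {x 0}"
      have R: "bounded ?R" "closure ?R \<subseteq> X"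
        using bdd x(2) unfolding trajectories_bounded_def bounded_in_def by blast+
      have "x t \<in> ?R" if "0 \<le> t" for t
        unfolding reach_def using x that
        by (intro CollectI exI[of _ "{0..}"] exI[of _ x] exI[of _ t]) simp
      then have "x t \<in> closure ?R" if "0 \<le> t" for t using that closure_subset by blast
      then show ?thesis
        using R by (intro solution_attracted[OF st XO x(1), of "closure ?R"]) auto
    qed
    moreover have "forward_complete X F X" using bdd unfolding trajectories_bounded_def by blast
    ultimately show ?thesis using st unfolding attracted_def by blast
  qed
  show ?thesis
    unfolding globally_asymptotically_stable_def globally_asymptotically_stable_rel_def
      globally_attractive_rel_def
    using zero_output_set_meets[OF conf] meets to_state_space stable_rel_subset[OF _ OX] attracted_subset[OF _ OX]
    by blast
qed

end

section \<open>Passive systems\<close>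

lemma regular_field_if_tangent:
  fixes X :: "'a::euclidean_space set"
  assumes X: "open X \<or> smooth_submanifold X" and F: "locally_lipschitz_extendable X F"
    and tangent: "\<And>x. x \<in> X \<Longrightarrow> F x \<in> velocities X x"
  shows "regular_field X F"
proof
  show "locally_lipschitz_extendable X F" by (rule F)
  show "locally_solvable X F"
    by (rule locally_solvable_if_tangent[OF locally_compact_state_space[OF X] F tangent])
  show "locally_solvable X (\<lambda>x. - F x)"
  proof (rule locally_solvable_if_tangent[OF locally_compact_state_space[OF X]])
    show "locally_lipschitz_extendable X (\<lambda>x. - F x)"
      using locally_lipschitz_extendable_diff[OF locally_lipschitz_extendable_const[of X 0] F] by simp
    show "- F x \<in> velocities X x" if "x \<in> X" for x
      using subspace_neg[OF subspace_velocities[OF X that] tangent[OF that]] .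
  qed
qed

section \<open>Regularity and dissipation of the closed loop\<close>

lemma smooth_vector_field_velocities:
  "\<lbrakk>smooth_vector_field X F; x \<in> X\<rbrakk> \<Longrightarrow> F x \<in> velocities X x"
  unfolding smooth_vector_field_def using tangent_space_subset_velocities by blast

lemma regular_field_smooth:
  assumes "open X \<or> smooth_submanifold X" "smooth_vector_field X F"
  shows "regular_field X F"
  using assms smooth_vector_field_velocities[OF assms(2)]
  by (intro regular_field_if_tangent smooth_on_locally_lipschitz_extendable)
    (auto simp: smooth_vector_field_def)

lemma regular_field_closed_loop:
  assumes X: "open X \<or> smooth_submanifold X" and f: "smooth_vector_field X f"
    and g: "\<And>i. smooth_vector_field X (g i)" and \<phi>: "smooth_on X \<phi>"
  shows "regular_field X (closed_loop f g \<phi>)"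
proof (rule regular_field_if_tangent[OF X])
  have "locally_lipschitz_extendable X f" "\<And>i. locally_lipschitz_extendable X (g i)"
    using f g smooth_on_locally_lipschitz_extendable unfolding smooth_vector_field_def by blast+
  then show "locally_lipschitz_extendable X (closed_loop f g \<phi>)"
    unfolding closed_loop_def[abs_def]
    by (intro locally_lipschitz_extendable_diff locally_lipschitz_extendable_sum
        locally_lipschitz_extendable_scaleR locally_lipschitz_extendable_vec_nth
        smooth_on_locally_lipschitz_extendable[OF \<phi>])
  show "closed_loop f g \<phi> x \<in> velocities X x" if "x \<in> X" for x
    unfolding closed_loop_def
    by (intro subspace_diff subspace_sum subspace_scale subspace_velocities[OF X that]
        smooth_vector_field_velocities[OF f that] smooth_vector_field_velocities[OF g that])
qed

lemma closed_loop_dissipation: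
  assumes passivity: "passive_system X U f g h V" and \<phi>: "continuous_on X \<phi>" "\<And>x. x \<in> X \<Longrightarrow> - \<phi> x \<in> U"
    and \<tau>: "0 \<le> \<tau>" and z: "solution_on X (closed_loop f g \<phi>) {0..\<tau>} z"
  shows "V (z \<tau>) - V (z 0) \<le> - integral {0..\<tau>} (\<lambda>s. h (z s) \<bullet> \<phi> (z s))"
proof -
  \<comment> \<open>Passivity quantifies over inputs on the whole half-line, while \<open>z\<close>
    is given up to \<open>\<tau>\<close>. Freezing the feedback at its last value gives a continuous
    admissible input.\<close>
  define c where "c s = max 0 (min s \<tau>)" for s :: real
  have c: "c s \<in> {0..\<tau>}" for s using \<tau> by (auto simp: c_def)
  have c_id: "c s = s" if "s \<in> {0..\<tau>}" for s using that by (auto simp: c_def)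
  define u where "u s = - \<phi> (z (c s))" for s
  have zX: "z (c s) \<in> X" for s by (rule solution_on_mem[OF z c])
  have "continuous_on UNIV (\<lambda>s. z (c s))"
    by (rule continuous_on_compose2[OF solution_on_continuous[OF z]])
      (use c in \<open>auto simp: c_def[abs_def] intro!: continuous_intros\<close>)
  then have "continuous_on UNIV (\<lambda>s. \<phi> (z (c s)))"
    by (rule continuous_on_compose2[OF \<phi>(1)]) (use zX in auto)
  then have contu: "continuous_on UNIV u"
    unfolding u_def by (rule continuous_on_minus)
  then have isCont: "isCont u t" for t by (simp add: continuous_on_eq_continuous_at)
  have "piecewise_continuous u"
    unfolding piecewise_continuous_def
  proof (intro conjI allI impI)
    show "finite {t \<in> {0..T}. \<not> continuous (at t within {0..}) u}" for T
      using isCont by (simp add: continuous_at_imp_continuous_at_within)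
    show "\<exists>l. (u \<longlongrightarrow> l) (at_right t)" "\<exists>l. (u \<longlongrightarrow> l) (at_left t)" for t
      using isCont[of t] unfolding isCont_def by (blast intro: tendsto_within_subset)+
  qed
  moreover have "u ` {0..} \<subseteq> U" using \<phi>(2) zX by (auto simp: u_def)
  moreover have field: "control_field f g (u s) (z s) = closed_loop f g \<phi> (z s)" if "s \<in> {0..\<tau>}" for s
    using c_id[OF that] by (simp add: control_field_def closed_loop_def u_def sum_negf)
  have "control_solution_on X f g u {0..\<tau>} z"
    unfolding control_solution_on_def
  proof (intro conjI ballI)
    show "z ` {0..\<tau>} \<subseteq> X" using solution_on_mem[OF z] by blast
    show "continuous_on {0..\<tau>} z" by (rule solution_on_continuous[OF z])
    fix t assume t: "t \<in> {0..\<tau>}"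
    have zt: "solution_on X (closed_loop f g \<phi>) {0..t} z"
      by (rule solution_on_atLeastAtMost[OF z]) (use t in auto)
    have "((\<lambda>s. closed_loop f g \<phi> (z s)) has_integral (z t - z 0)) {0..t}"
      by (rule fundamental_theorem_of_calculus) (use t solution_on_derivative[OF zt] in auto)
    then show "((\<lambda>s. control_field f g (u s) (z s)) has_integral (z t - z 0)) {0..t}"
      by (rule has_integral_eq[rotated]) (use field t in auto)
  qed (use \<tau> in auto)
  ultimately have "V (z \<tau>) - V (z 0) \<le> integral {0..\<tau>} (\<lambda>s. u s \<bullet> h (z s))"
    using passivity \<tau> unfolding passive_system_def by (meson atLeastAtMost_iff order_refl)
  also have "integral {0..\<tau>} (\<lambda>s. u s \<bullet> h (z s)) = integral {0..\<tau>} (\<lambda>s. - (h (z s) \<bullet> \<phi> (z s)))"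
    by (rule integral_cong) (simp add: u_def c_id inner_commute)
  also have "\<dots> = - integral {0..\<tau>} (\<lambda>s. h (z s) \<bullet> \<phi> (z s))"
    by (rule integral_neg)
  finally show ?thesis .
qed

text \<open>A locally compact set is the intersection of a closed set \<open>A\<close> and an open
  set \<open>W\<close>. A closed tube around \<open>\<Gamma>\<close> fits into \<open>W\<close>, so
  its part in \<open>A\<close> is a compact subset of \<open>X\<close>. Staying in the tube already
  confines, hence the arbitrary starting radius 1.\<close>

lemma confining_near_compact:
  assumes X: "locally compact X" and \<Gamma>: "compact \<Gamma>" "\<Gamma> \<subseteq> X" "\<Gamma> \<noteq> {}"
  shows "confining_near X F \<Gamma>"
proof -
  obtain A W where AW: "closed A" "open W" "X = A \<inter> W"
    using X unfolding locally_compact_closed_Int_open by blast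
  obtain e where e: "0 < e" "(\<Union>x\<in>\<Gamma>. cball x e) \<subseteq> W"
    using compact_subset_open_imp_cball_epsilon_subset[OF \<Gamma>(1) AW(2)] \<Gamma>(2) AW(3) by blast
  define K where "K = A \<inter> {y. infdist y \<Gamma> \<le> e}"
  have "compact K"
    unfolding K_def using compact_infdist_le[OF \<Gamma>(3,1) e(1)] AW(1) by (simp add: closed_Int_compact)
  moreover have "K \<subseteq> X"
  proof
    fix y assume y: "y \<in> K"
    obtain x where "x \<in> \<Gamma>" "infdist y \<Gamma> = dist y x"
      using infdist_attains_inf[OF compact_imp_closed[OF \<Gamma>(1)] \<Gamma>(3)] by blast
    then have "y \<in> cball x e" "x \<in> \<Gamma>" using y by (auto simp: K_def dist_commute)
    then have "y \<in> W" using e(2) by blast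
    then show "y \<in> X" using y AW(3) by (simp add: K_def)
  qed
  moreover have "z \<tau> \<in> K"
    if "0 \<le> \<tau>" "solution_on X F {0..\<tau>} z" "\<forall>t\<in>{0..\<tau>}. infdist (z t) \<Gamma> \<le> e" for \<tau> z
    using solution_on_mem[OF that(2), of \<tau>] that AW(3) by (simp add: K_def)
  ultimately have "confined_to X F \<Gamma> x K e 1" for x
    unfolding confined_to_def using e(1) by simp
  then show ?thesis unfolding confining_near_def by blast
qed

text \<open>The closure of the reachable set of the ball confines regardless of the distance to
  \<open>\<Gamma>\<close>, hence the arbitrary tube width 1.\<close>

lemma confining_near_locally_uniformly_bounded:
  assumes "locally_uniformly_bounded_near X F \<Gamma>"
  shows "confining_near X F \<Gamma>"
  unfolding confining_near_def
proof
  fix x assume "x \<in> \<Gamma>"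
  then obtain l where l: "0 < l" and R: "bounded_in X (reach X F {0..} (ball_in X x l))"
    using assms unfolding locally_uniformly_bounded_near_def by blast
  define K where "K = closure (reach X F {0..} (ball_in X x l))"
  have "compact K" "K \<subseteq> X" using R unfolding bounded_in_def K_def by auto
  moreover have "z \<tau> \<in> K"
    if "0 \<le> \<tau>" "solution_on X F {0..\<tau>} z" "dist (z 0) x < l" for \<tau> z
  proof -
    have "z 0 \<in> ball_in X x l"
      using that solution_on_mem[OF that(2), of 0] by (simp add: ball_in_def dist_norm)
    then have "z \<tau> \<in> reach X F {0..} (ball_in X x l)"
      unfolding reach_def using that by (intro CollectI exI[of _ "{0..\<tau>}"] exI[of _ z] exI[of _ \<tau>]) simp
    then show ?thesis unfolding K_def using closure_subset by blast
  qed
  ultimately have "confined_to X F \<Gamma> x K 1 l"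
    unfolding confined_to_def using l by simp
  then show "\<exists>K r l. confined_to X F \<Gamma> x K r l" by blast
qed

theorem theorem5p2:
  fixes X :: "(real^'n) set" and U Y :: "(real^'m) set"
    and f :: "real^'n \<Rightarrow> real^'n" and g :: "'m \<Rightarrow> real^'n \<Rightarrow> real^'n"
    and h \<phi> :: "real^'n \<Rightarrow> real^'m"
    and V :: "real^'n \<Rightarrow> real" and r :: enat and \<Gamma> :: "(real^'n) set"
  assumes state_space: "open X \<or> smooth_submanifold X"
    and f: "smooth_vector_field X f"
    and g: "\<And>i. smooth_vector_field X (g i)"
    and h: "smooth_on X h" "h ` X \<subseteq> Y"
    and V: "1 \<le> r" "Cr_on r X V" "\<And>x. x \<in> X \<Longrightarrow> 0 \<le> V x"
    and passivity: "passive_system X U f g h V"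
    and \<Gamma>: "\<Gamma> \<noteq> {}" "closedin (top_of_set X) \<Gamma>" "\<Gamma> \<subseteq> {x\<in>X. V x = 0}"
            "positively_invariant X f \<Gamma>"
    and feedback: "passivity_based_feedback X U h \<phi>"
  shows "(compact \<Gamma> \<longrightarrow>
            (asymptotically_stable X (closed_loop f g \<phi>) \<Gamma> \<longleftrightarrow> locally_detectable X f h \<Gamma>) \<and>
            (trajectories_bounded X (closed_loop f g \<phi>) \<longrightarrow>
               (globally_asymptotically_stable X (closed_loop f g \<phi>) \<Gamma> \<longleftrightarrow> detectable X f h \<Gamma>))) \<and>
         (\<not> bounded \<Gamma> \<and> locally_uniformly_bounded_near X (closed_loop f g \<phi>) \<Gamma> \<longrightarrow>
            (asymptotically_stable X (closed_loop f g \<phi>) \<Gamma> \<longleftrightarrow> locally_detectable X f h \<Gamma>) \<and>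
            (trajectories_bounded X (closed_loop f g \<phi>) \<longrightarrow>
               (globally_asymptotically_stable X (closed_loop f g \<phi>) \<Gamma> \<longleftrightarrow> detectable X f h \<Gamma>)))"
proof -
  define F where "F = closed_loop f g \<phi>"
  define k where "k x = h x \<bullet> \<phi> x" for x
  have \<phi>: "smooth_on X \<phi>" "\<And>x. x \<in> X \<Longrightarrow> - \<phi> x \<in> U"
    and \<phi>_zero: "\<And>x. \<lbrakk>x \<in> X; h x = 0\<rbrakk> \<Longrightarrow> \<phi> x = 0"
    and \<phi>_pos: "\<And>x. \<lbrakk>x \<in> X; h x \<noteq> 0\<rbrakk> \<Longrightarrow> 0 < k x"
    using feedback unfolding passivity_based_feedback_def k_def by blast+
  have cont: "continuous_on X h" "continuous_on X \<phi>" "continuous_on X V"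
    using h(1) \<phi>(1) V(2) by (auto intro: Cr_on_continuous_on)
  have k_zero: "k x = 0 \<longleftrightarrow> h x = 0" if "x \<in> X" for x
    using \<phi>_pos[OF that] by (cases "h x = 0") (auto simp: k_def)
  have F_eq: "F x = f x" if "x \<in> X" "h x = 0" for x
    using \<phi>_zero[OF that] by (simp add: F_def closed_loop_def)
  interpret f: regular_field X f by (rule regular_field_smooth[OF state_space f])
  interpret F: regular_field X F
    unfolding F_def by (rule regular_field_closed_loop[OF state_space f g \<phi>(1)])
  interpret passive_field X F V k
  proof
    show "continuous_on X k" unfolding k_def by (intro continuous_intros cont)
    show "0 \<le> k x" if "x \<in> X" for x
      using \<phi>_pos[OF that] by (cases "h x = 0") (auto simp: k_def)
    show "V (z \<tau>) - V (z 0) \<le> - integral {0..\<tau>} (\<lambda>s. k (z s))"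
      if "0 \<le> \<tau>" "solution_on X F {0..\<tau>} z" for \<tau> z
      using closed_loop_dissipation[OF passivity cont(2) \<phi>(2)] that unfolding F_def k_def by blast
  qed (use cont V(3) in auto)
  have \<Gamma>_V: "x \<in> X" "V x = 0" if "x \<in> \<Gamma>" for x using \<Gamma>(3) that by auto
  \<comment> \<open>\<open>V\<close> is nonincreasing along closed-loop solutions and already
    minimal on \<open>\<Gamma>\<close>, so it stays 0 and nothing is dissipated. This makes
    solutions of \<open>f\<close> inside \<open>\<Gamma>\<close> solutions of the closed
    loop.\<close>
  have h_\<Gamma>: "h x = 0" if "x \<in> \<Gamma>" for x
  proof -
    have "V (w \<tau>) = 0" if "0 \<le> \<tau>" "solution_on X F {0..\<tau>} w" "w 0 = x" for \<tau> w
    proof -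
      have "V (w \<tau>) \<le> V (w 0)" by (rule V_nonincreasing[OF that(2)]) (use that in auto)
      moreover have "0 \<le> V (w \<tau>)" by (rule V(3)[OF solution_on_mem[OF that(2)]]) (use that in auto)
      ultimately show ?thesis using that(3) \<Gamma>_V(2)[OF \<open>x \<in> \<Gamma>\<close>] by simp
    qed
    then have "k x = 0" by (rule k_zero_if_V_constant[OF \<Gamma>_V(1)[OF that]])
    then show ?thesis using k_zero \<Gamma>_V(1)[OF that] by simp
  qed
  interpret passive_field_set X F V k \<Gamma>
  proof
    fix x assume x: "x \<in> \<Gamma>"
    then obtain y where y: "solution_on X f {0..} y" "y 0 = x"
      using \<Gamma>(4) unfolding positively_invariant_def forward_complete_def by blast
    have "y t \<in> reach X f {0..} \<Gamma>" if "0 \<le> t" for t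
      unfolding reach_def using y x that by (intro CollectI exI[of _ "{0..}"] exI[of _ y] exI[of _ t]) simp
    then have y\<Gamma>: "y t \<in> \<Gamma>" if "0 \<le> t" for t
      using \<Gamma>(4) that unfolding positively_invariant_def by blast
    have "solution_on X F {0..} y"
      by (rule solution_on_field_cong[OF y(1)]) (use y\<Gamma> F_eq h_\<Gamma> \<Gamma>_V(1) in auto)
    then show "\<exists>y. solution_on X F {0..} y \<and> y 0 = x \<and> (\<forall>t\<ge>0. y t \<in> \<Gamma>)"
      using y(2) y\<Gamma> by blast
  qed (use \<Gamma>(1,2) \<Gamma>_V(2) in auto)
  have O_eq: "zero_output_set X f h = zero_output_set X F k"
  proof -
    have "zero_output_set X f h = zero_output_set X F h"
      by (rule zero_output_set_cong[OF f.regular_field_axioms F.regular_field_axioms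
            continuous_closedin_preimage_constant[OF cont(1)]]) (simp add: F_eq)
    moreover have "{x\<in>X. h x = 0} = {x\<in>X. k x = 0}" using k_zero by blast
    ultimately show ?thesis unfolding zero_output_set_def by simp
  qed
  \<comment> \<open>Detectability is phrased with \<open>f\<close>, the reduction with
    \<open>F\<close>. On this set, invariant for both, the fields agree, which transfers the
    relative notions.\<close>
  have inv: "invariant X f (zero_output_set X F k)" "invariant X F (zero_output_set X F k)"
    using invariant_zero_output_set[of X f h] invariant_zero_output_set[of X F k] O_eq by simp_all
  have eq: "f x = F x" if "x \<in> zero_output_set X F k" for x
    using that zero_output_set_subset[of X F k] k_zero F_eq by auto
  have detectable: "locally_detectable X f h \<Gamma> \<longleftrightarrow> asymptotically_stable_rel X F (zero_output_set X F k) \<Gamma>"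
    "detectable X f h \<Gamma> \<longleftrightarrow> globally_asymptotically_stable_rel X F (zero_output_set X F k) \<Gamma>"
    unfolding locally_detectable_def detectable_def O_eq asymptotically_stable_rel_def
      globally_asymptotically_stable_rel_def globally_attractive_rel_def
    using stable_rel_cong_invariant[OF inv eq] attractive_rel_cong_invariant[OF inv eq]
      attracted_cong_invariant[OF inv eq] by simp_all
  have "(asymptotically_stable X F \<Gamma> \<longleftrightarrow> locally_detectable X f h \<Gamma>) \<and>
      (trajectories_bounded X F \<longrightarrow>
        (globally_asymptotically_stable X F \<Gamma> \<longleftrightarrow> detectable X f h \<Gamma>))"
    if "confining_near X F \<Gamma>"
    using asymptotically_stable_iff[OF that] globally_asymptotically_stable_iff[OF that] detectable by blast
  moreover have "confining_near X F \<Gamma>" if "compact \<Gamma>"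
    by (rule confining_near_compact[OF locally_compact_state_space[OF state_space] that \<Gamma>_subset \<Gamma>(1)])
  ultimately show ?thesis
    using confining_near_locally_uniformly_bounded[of X F \<Gamma>] unfolding F_def by blast
qed

end
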